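(* Let $\tau:E\to M$ be a skew-symmetric algebroid, let $L:E\to\mathbb{R}$ be a Lagrangian system (a smooth function), and let $\gamma:[t_0,t_1]\to E$ be an admissible curve which is a solution of the Euler–Lagrange equation for $L$ on $E$. Then a curve $\eta(t)\in E_{\tau(\gamma(t))}$ is a Jacobi vector field along $\gamma$ if and only if the associated infinitesimal admissible variation $\delta_\eta\gamma(t)\in\mathrm{T}_{\gamma(t)}E$, regarded as a curve in $\mathrm{T}E$, is a solution of the Euler–Lagrange equation for the lifted Lagrangian $\mathrm{d_T}L:\mathrm{T}E\to\mathbb{R}$ on the tangent lift algebroid $\mathrm{T}\tau:\mathrm{T}E\to\mathrm{T}M$.
   Context: All manifolds, maps and curves are smooth; curves are defined on $[t_0,t_1]$. **Skew algebroid.** A skew-symmetric algebroid structure on a vector bundle $\tau:E\to M$ is a skew-symmetric $\mathbb{R}$-bilinear bracket $[\cdot,\cdot]$ on sections of $\tau$ together with a vector bundle morphism $\rho:E\to\mathrm{T}M$ (the anchor) such that $[X,fY]=f[X,Y]+\rho(X)(f)Y$ for all sections $X,Y$ and $f\in C^\infty(M)$. For local base coordinates $x^a$ and a local basis of sections $e_i$ with fibre coordinates $y^i$, write $\rho(e_i)=\rho^a_i(x)\partial_{x^a}$ and $[e_j,e_k]=c^i_{jk}(x)e_i$. **Morphism $\varepsilon$.** Let $\pi:E^*\to M$ be the dual bundle with dual coordinates $z_i$. The algebroid structure is equivalently encoded in a double vector bundle morphism $\varepsilon:\mathrm{T}^*E\to\mathrm{T}E^*$, given in induced coordinates $(x^a,y^i,p_b,\pi_j)$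 on $\mathrm{T}^*E$ and $(x^a,z_i,\dot x^b,\dot z_j)$ on $\mathrm{T}E^*$ by $$\varepsilon(x^a,y^i,p_b,\pi_j)=\big(x^a,\ \pi_i,\ \rho^b_k(x)y^k,\ c^k_{ij}(x)y^i\pi_k+\rho^a_j(x)p_a\big).$$ **Admissible curves and variations.** A curve $\gamma(t)\in E$ is admissible if $\rho(\gamma(t))=\frac{\mathrm{d}}{\mathrm{d}t}\tau(\gamma(t))$. For an admissible $\gamma(t)\sim(x^a(t),y^i(t))$ and a curve $\xi(t)\sim(x^a(t),f^i(t))\in E_{\tau(\gamma(t))}$ over the same base path, the infinitesimal admissible variation generated by $\xi$ is the (coordinate-independent) curve $\delta_\xi\gamma(t)\in\mathrm{T}_{\gamma(t)}E$ $$\delta_\xi\gamma\sim\big(x^a,\ y^i,\ \rho^a_i(x)f^i,\ \dot f^j+c^j_{kl}(x)y^kf^l\big).$$ **Euler–Lagrange equation.** For $L:E\to\mathbb{R}$ put $\Lambda_L=\varepsilon\circ\mathrm{d}L:E\to\mathrm{T}E^*$ and $\lambda_L=\tau_{E^*}\circ\Lambda_L:E\to E^*$ (the fibre derivative of $L$), where $\tau_{E^*}:\mathrm{T}E^*\to E^*$ is the tangent projection. The Euler–Lagrange (EL) equation for $\gamma(t)\in E$ is $\frac{\mathrm{d}}{\mathrm{d}t}\lambda_L(\gamma(t))=\Lambda_L(\gamma(t))$; in coordinates $\dot x^a=\rho^a_iy^i$ and $\frac{\mathrm{d}}{\mathrm{d}t}\frac{\partial L}{\partial y^j}=\rho^a_j\frac{\partial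 L}{\partial x^a}+c^k_{ij}y^i\frac{\partial L}{\partial y^k}$. **Jacobi vector fields.** For a manifold $Q$ let $\kappa_Q:\mathrm{T}\mathrm{T}Q\to\mathrm{T}\mathrm{T}Q$ be the canonical flip. Let $\gamma$ be a solution of the EL equation for $L$. A Jacobi vector field (JVF) along $\gamma$ is a curve $\eta(t)\in E_{\tau(\gamma(t))}$ satisfying the Jacobi equation $$\frac{\mathrm{d}}{\mathrm{d}t}\,\mathrm{T}\lambda_L\big(\delta_\eta\gamma(t)\big)=\kappa_{E^*}\circ\mathrm{T}\Lambda_L\big(\delta_\eta\gamma(t)\big).$$ **Tangent lifts.** For a function $F:Q\to\mathbb{R}$, $\mathrm{d_T}F:\mathrm{T}Q\to\mathbb{R}$ is $\mathrm{d_T}F(v)=\langle\mathrm{d}F,v\rangle$. The tangent lift $\mathrm{d_T}E$ of a skew algebroid is the skew algebroid structure on the vector bundle $\mathrm{T}\tau:\mathrm{T}E\to\mathrm{T}M$ corresponding to the tangent (complete) lift of the linear bivector on $E^*$ that encodes the algebroid $E$. Explicitly: its anchor is $\kappa_M\circ\mathrm{T}\rho$, and its bracket is the one determined by $[\mathrm{T}X,\mathrm{T}Y]=\mathrm{T}[X,Y]$, $[\mathrm{T}X,Y^v]=[X,Y]^v$, $[X^v,Y^v]=0$ for sections $X,Y$ of $\tau$. Here $\mathrm{T}X:\mathrm{T}M\to\mathrm{T}E$ is the tangent map of $X$, and $X^v:\mathrm{T}M\to\mathrm{T}E$ sends $w\in\mathrm{T}_xM$ to the sum (in $\mathrm{T}_{0_x}E$)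 of $\mathrm{T}0(w)$, with $0$ the zero section, and the vertical vector at $0_x$ determined by $X(x)$. The dual bundle of $\mathrm{T}\tau$ is identified with $\mathrm{T}\pi:\mathrm{T}E^*\to\mathrm{T}M$ by the tangent of the pairing $E\times_ME^*\to\mathbb{R}$. The EL equation for $\mathrm{d_T}L$ is the EL equation above for the algebroid $\mathrm{d_T}E$. *)

theory Defs
  imports "HOL-Analysis.Analysis"
begin

section \<open>Model spaces and smoothness\<close>

text \<open>
  Charts and fibre coordinates take values in finite-dimensional inner product spaces. The class
  \<^class>\<open>euclidean_space\<close> would do, except that it excludes dimension 0 and hence a Lie
  algebra regarded as an algebroid over a point. As there, the axiom says that finitely many
  functionals \<open>x \<mapsto> x \<bullet> u\<close> separate points.
\<close>

class finite_dim_inner = real_inner +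
  assumes finite_dim: "\<exists>B. finite B \<and> (\<forall>x. (\<forall>u\<in>B. inner x u = 0) \<longrightarrow> x = 0)"

instance prod :: (finite_dim_inner, finite_dim_inner) finite_dim_inner
proof
  obtain B :: "'a set" where B: "finite B" "\<And>x. (\<forall>u\<in>B. inner x u = 0) \<Longrightarrow> x = 0"
    using finite_dim by blast
  obtain C :: "'b set" where C: "finite C" "\<And>x. (\<forall>u\<in>C. inner x u = 0) \<Longrightarrow> x = 0"
    using finite_dim by blast
  let ?D = "(\<lambda>u. (u, 0 :: 'b)) ` B \<union> (\<lambda>u. (0 :: 'a, u)) ` C"
  have "finite ?D" using B C by simp
  moreover have "\<forall>x. (\<forall>u\<in>?D. inner x u = 0) \<longrightarrow> x = 0"
  proof (intro allI impI)
    fix x :: "'a \<times> 'b" assume x: "\<forall>u\<in>?D. inner x u = 0"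
    have "fst x = 0" using x by (intro B(2)) (simp add: inner_prod_def ball_Un)
    moreover have "snd x = 0" using x by (intro C(2)) (simp add: inner_prod_def ball_Un)
    ultimately show "x = 0" by (simp add: prod_eq_iff)
  qed
  ultimately show "\<exists>D. finite D \<and> (\<forall>x :: 'a \<times> 'b. (\<forall>u\<in>D. inner x u = 0) \<longrightarrow> x = 0)" by blast
qed

subclass (in euclidean_space) finite_dim_inner
  by standard (use finite_Basis euclidean_all_zero_iff in blast)

text \<open>
  All derivatives are taken within \<open>S\<close>. The notion is used for open sets \<open>S\<close> and for relatively
  open subsets of a nondegenerate compact interval (where derivatives at the end points are
  one-sided); in both cases derivatives within \<open>S\<close> are unique.
\<close>

primrec Ck_on :: "nat \<Rightarrow> 'a::real_normed_vector set \<Rightarrow> ('a \<Rightarrow> 'b::real_normed_vector) \<Rightarrow> bool" where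
  "Ck_on 0 S f \<longleftrightarrow> continuous_on S f"
| "Ck_on (Suc k) S f \<longleftrightarrow>
     f differentiable_on S \<and> (\<forall>v. Ck_on k S (\<lambda>x. frechet_derivative f (at x within S) v))"

definition smooth_on :: "'a::real_normed_vector set \<Rightarrow> ('a \<Rightarrow> 'b::real_normed_vector) \<Rightarrow> bool" where
  "smooth_on S f \<longleftrightarrow> (\<forall>k. Ck_on k S f)"


section \<open>Manifolds\<close>

record ('i, 'a, 'm) manifold =
  pts :: "'a set"
  idx :: "'i set"
  chart_dom :: "'i \<Rightarrow> 'a set"
  chart :: "'i \<Rightarrow> 'a \<Rightarrow> 'm"

definition chart_inv :: "('i, 'a, 'm) manifold \<Rightarrow> 'i \<Rightarrow> 'm \<Rightarrow> 'a" where
  "chart_inv M i = inv_into (chart_dom M i) (chart M i)"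

definition chart_at :: "('i, 'a, 'm) manifold \<Rightarrow> 'a \<Rightarrow> 'i" where
  "chart_at M p = (SOME i. i \<in> idx M \<and> p \<in> chart_dom M i)"

definition manifold_topology :: "('i, 'a, 'm::topological_space) manifold \<Rightarrow> 'a topology" where
  "manifold_topology M = topology_generated_by
     {chart_dom M i \<inter> chart M i -` W | i W. i \<in> idx M \<and> open W}"

definition smooth_manifold :: "('i, 'a, 'm::finite_dim_inner) manifold \<Rightarrow> bool" where
  "smooth_manifold M \<longleftrightarrow>
     pts M = (\<Union>i\<in>idx M. chart_dom M i) \<and>
     (\<forall>i\<in>idx M. inj_on (chart M i) (chart_dom M i)) \<and>
     (\<forall>i\<in>idx M. \<forall>j\<in>idx M.
        open (chart M i ` (chart_dom M i \<inter> chart_dom M j)) \<and>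
        smooth_on (chart M i ` (chart_dom M i \<inter> chart_dom M j))
          (\<lambda>x. chart M j (chart_inv M i x))) \<and>
     Hausdorff_space (manifold_topology M) \<and>
     second_countable (manifold_topology M)"

definition smooth_map ::
  "('i, 'a, 'm::finite_dim_inner) manifold \<Rightarrow> ('j, 'b, 'n::finite_dim_inner) manifold \<Rightarrow> ('a \<Rightarrow> 'b) \<Rightarrow> bool"
where
  "smooth_map M N F \<longleftrightarrow>
     F \<in> pts M \<rightarrow> pts N \<and>
     continuous_map (manifold_topology M) (manifold_topology N) F \<and>
     (\<forall>i\<in>idx M. \<forall>j\<in>idx N.
        smooth_on (chart M i ` (chart_dom M i \<inter> F -` chart_dom N j))
          (\<lambda>x. chart N j (F (chart_inv M i x))))"

definition smooth_fun :: "('i, 'a, 'm::finite_dim_inner) manifold \<Rightarrow> ('a \<Rightarrow> real) \<Rightarrow> bool" where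
  "smooth_fun M f \<longleftrightarrow>
     (\<forall>i\<in>idx M. smooth_on (chart M i ` chart_dom M i) (\<lambda>x. f (chart_inv M i x)))"

definition smooth_curve ::
  "('i, 'a, 'm::finite_dim_inner) manifold \<Rightarrow> real \<Rightarrow> real \<Rightarrow> (real \<Rightarrow> 'a) \<Rightarrow> bool"
where
  "smooth_curve M t0 t1 c \<longleftrightarrow>
     c \<in> {t0..t1} \<rightarrow> pts M \<and>
     continuous_map (top_of_set {t0..t1}) (manifold_topology M) c \<and>
     (\<forall>i\<in>idx M. smooth_on {t \<in> {t0..t1}. c t \<in> chart_dom M i} (\<lambda>t. chart M i (c t)))"


section \<open>Vector bundles\<close>

text \<open>
  A vector bundle is given by an atlas of the base together with a local trivialization over each
  chart domain: \<open>triv V i\<close> is the fibre coordinate \<open>y\<close> over the chart domain \<open>i\<close>. Any vector bundle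
  is trivial over the charts of a sufficiently fine atlas. The vector space structure of the
  fibres is the one transported from the model fibre.
\<close>

record ('i, 'a, 'm, 'e, 'k) vbundle =
  base :: "('i, 'a, 'm) manifold"
  tot :: "'e set"
  proj :: "'e \<Rightarrow> 'a"
  triv :: "'i \<Rightarrow> 'e \<Rightarrow> 'k"

definition fibre :: "('i, 'a, 'm, 'e, 'k) vbundle \<Rightarrow> 'a \<Rightarrow> 'e set" where
  "fibre V p = {e \<in> tot V. proj V e = p}"

definition from_triv :: "('i, 'a, 'm, 'e, 'k) vbundle \<Rightarrow> 'i \<Rightarrow> 'a \<Rightarrow> 'k \<Rightarrow> 'e" where
  "from_triv V i p = inv_into (fibre V p) (triv V i)"

definition vector_bundle ::
  "('i, 'a, 'm::finite_dim_inner, 'e, 'k::finite_dim_inner) vbundle \<Rightarrow> bool"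
where
  "vector_bundle V \<longleftrightarrow>
     smooth_manifold (base V) \<and>
     proj V \<in> tot V \<rightarrow> pts (base V) \<and>
     (\<forall>i\<in>idx (base V). \<forall>p\<in>chart_dom (base V) i. bij_betw (triv V i) (fibre V p) UNIV) \<and>
     (\<forall>i\<in>idx (base V). \<forall>j\<in>idx (base V).
        (\<forall>p \<in> chart_dom (base V) i \<inter> chart_dom (base V) j.
           linear (\<lambda>y. triv V j (from_triv V i p y))) \<and>
        (\<forall>y. smooth_on (chart (base V) i ` (chart_dom (base V) i \<inter> chart_dom (base V) j))
           (\<lambda>x. triv V j (from_triv V i (chart_inv (base V) i x) y))))"

definition total_space :: "('i, 'a, 'm, 'e, 'k) vbundle \<Rightarrow> ('i, 'e, 'm \<times> 'k) manifold" where
  "total_space V = \<lparr> pts = tot V, idx = idx (base V),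
     chart_dom = (\<lambda>i. {e \<in> tot V. proj V e \<in> chart_dom (base V) i}),
     chart = (\<lambda>i e. (chart (base V) i (proj V e), triv V i e)) \<rparr>"

definition vzero :: "('i, 'a, 'm, 'e, 'k::zero) vbundle \<Rightarrow> 'a \<Rightarrow> 'e" where
  "vzero V p = from_triv V (chart_at (base V) p) p 0"

definition vadd :: "('i, 'a, 'm, 'e, 'k::plus) vbundle \<Rightarrow> 'e \<Rightarrow> 'e \<Rightarrow> 'e" where
  "vadd V e e' = (let i = chart_at (base V) (proj V e)
     in from_triv V i (proj V e) (triv V i e + triv V i e'))"

definition vscale :: "('i, 'a, 'm, 'e, 'k::scaleR) vbundle \<Rightarrow> real \<Rightarrow> 'e \<Rightarrow> 'e" where
  "vscale V r e = (let i = chart_at (base V) (proj V e)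
     in from_triv V i (proj V e) (r *\<^sub>R triv V i e))"

text \<open>Morphisms over the identity of the base; the two bundles may be trivialized by different atlases.\<close>

definition vb_morphism ::
  "('i, 'a, 'm::finite_dim_inner, 'e, 'k::finite_dim_inner) vbundle \<Rightarrow>
   ('j, 'a, 'n::finite_dim_inner, 'f, 'l::finite_dim_inner) vbundle \<Rightarrow> ('e \<Rightarrow> 'f) \<Rightarrow> bool"
where
  "vb_morphism V W F \<longleftrightarrow>
     smooth_map (total_space V) (total_space W) F \<and>
     (\<forall>e\<in>tot V. proj W (F e) = proj V e) \<and>
     (\<forall>i\<in>idx (base V). \<forall>j\<in>idx (base W). \<forall>p \<in> chart_dom (base V) i \<inter> chart_dom (base W) j.
        linear (\<lambda>y. triv W j (F (from_triv V i p y))))"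

text \<open>Sections are extensional functions, so that equality of functions is equality of sections.\<close>

definition sections ::
  "('i, 'a, 'm::finite_dim_inner, 'e, 'k::finite_dim_inner) vbundle \<Rightarrow> ('a \<Rightarrow> 'e) set"
where
  "sections V = {X \<in> (\<Pi>\<^sub>E p\<in>pts (base V). fibre V p).
     \<forall>i\<in>idx (base V). smooth_on (chart (base V) i ` chart_dom (base V) i)
       (\<lambda>x. triv V i (X (chart_inv (base V) i x)))}"

definition sec_add ::
  "('i, 'a, 'm, 'e, 'k::plus) vbundle \<Rightarrow> ('a \<Rightarrow> 'e) \<Rightarrow> ('a \<Rightarrow> 'e) \<Rightarrow> 'a \<Rightarrow> 'e"
where
  "sec_add V X Y = (\<lambda>p\<in>pts (base V). vadd V (X p) (Y p))"

definition sec_scale ::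
  "('i, 'a, 'm, 'e, 'k::scaleR) vbundle \<Rightarrow> ('a \<Rightarrow> real) \<Rightarrow> ('a \<Rightarrow> 'e) \<Rightarrow> 'a \<Rightarrow> 'e"
where
  "sec_scale V f X = (\<lambda>p\<in>pts (base V). vscale V (f p) (X p))"

text \<open>Points of the dual bundle are pairs of a base point and a linear functional on the fibre,
  extended by 0 to the whole type. The dual coordinates \<open>z\<close> are taken with respect to the inner
  product of the model fibre: \<open>\<langle>\<xi>, e\<rangle> = z \<bullet> y\<close> if \<open>y\<close> is the fibre coordinate of \<open>e\<close>.\<close>

definition dual_bundle ::
  "('i, 'a, 'm, 'e, 'k::real_inner) vbundle \<Rightarrow> ('i, 'a, 'm, 'a \<times> ('e \<Rightarrow> real), 'k) vbundle"
where
  "dual_bundle V = \<lparr> base = base V,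
     tot = {(p, \<xi>). p \<in> pts (base V) \<and>
        (\<forall>i\<in>idx (base V). p \<in> chart_dom (base V) i \<longrightarrow> linear (\<lambda>y. \<xi> (from_triv V i p y))) \<and>
        (\<forall>e. e \<notin> fibre V p \<longrightarrow> \<xi> e = 0)},
     proj = fst,
     triv = (\<lambda>i (p, \<xi>). THE z. \<forall>e\<in>fibre V p. \<xi> e = inner z (triv V i e)) \<rparr>"


section \<open>Tangent bundles\<close>

text \<open>
  A tangent vector at \<open>p\<close> is a pair \<open>(p, v)\<close>, where \<open>v i\<close> is its coordinate vector in the chart
  \<open>i\<close>, for every chart around \<open>p\<close> (and 0 for the other indices); the coordinate vectors are related
  by the derivatives of the transition maps.
\<close>

type_synonym ('i, 'a, 'm) tvec = "'a \<times> ('i \<Rightarrow> 'm)"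

definition tangent_bundle ::
  "('i, 'a, 'm::real_normed_vector) manifold \<Rightarrow> ('i, 'a, 'm, ('i, 'a, 'm) tvec, 'm) vbundle"
where
  "tangent_bundle M = \<lparr> base = M,
     tot = {(p, v). p \<in> pts M \<and>
        (\<forall>i\<in>idx M. \<forall>j\<in>idx M. p \<in> chart_dom M i \<inter> chart_dom M j \<longrightarrow>
           v j = frechet_derivative (\<lambda>x. chart M j (chart_inv M i x)) (at (chart M i p)) (v i)) \<and>
        (\<forall>i. \<not> (i \<in> idx M \<and> p \<in> chart_dom M i) \<longrightarrow> v i = 0)},
     proj = fst,
     triv = (\<lambda>i (p, v). v i) \<rparr>"

abbreviation tangent ::
  "('i, 'a, 'm::real_normed_vector) manifold \<Rightarrow> ('i, ('i, 'a, 'm) tvec, 'm \<times> 'm) manifold"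
where
  "tangent M \<equiv> total_space (tangent_bundle M)"

abbreviation cotangent_bundle ::
  "('i, 'a, 'm::real_inner) manifold \<Rightarrow>
   ('i, 'a, 'm, 'a \<times> (('i, 'a, 'm) tvec \<Rightarrow> real), 'm) vbundle"
where
  "cotangent_bundle M \<equiv> dual_bundle (tangent_bundle M)"

definition tangent_map ::
  "('i, 'a, 'm::real_normed_vector) manifold \<Rightarrow> ('j, 'b, 'n::real_normed_vector) manifold \<Rightarrow>
   ('a \<Rightarrow> 'b) \<Rightarrow> ('i, 'a, 'm) tvec \<Rightarrow> ('j, 'b, 'n) tvec"
where
  "tangent_map M N F = (\<lambda>(p, v). let i = chart_at M p in
     (F p, \<lambda>j. if j \<in> idx N \<and> F p \<in> chart_dom N j
       then frechet_derivative (\<lambda>x. chart N j (F (chart_inv M i x))) (at (chart M i p)) (v i)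
       else 0))"

text \<open>The function \<open>d\<^sub>T f\<close> on the tangent bundle.\<close>

definition dT_fun :: "('i, 'a, 'm::real_normed_vector) manifold \<Rightarrow> ('a \<Rightarrow> real) \<Rightarrow> ('i, 'a, 'm) tvec \<Rightarrow> real" where
  "dT_fun M f = (\<lambda>(p, v). let i = chart_at M p in
     frechet_derivative (\<lambda>x. f (chart_inv M i x)) (at (chart M i p)) (v i))"

definition differential ::
  "('i, 'a, 'm::real_normed_vector) manifold \<Rightarrow> ('a \<Rightarrow> real) \<Rightarrow>
   'a \<Rightarrow> 'a \<times> (('i, 'a, 'm) tvec \<Rightarrow> real)"
where
  "differential M f p =
     (p, \<lambda>w. if w \<in> fibre (tangent_bundle M) p then dT_fun M f w else 0)"

definition velocity ::
  "('i, 'a, 'm::real_normed_vector) manifold \<Rightarrow> real \<Rightarrow> real \<Rightarrow> (real \<Rightarrow> 'a) \<Rightarrow> real \<Rightarrow> ('i, 'a, 'm) tvec"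
where
  "velocity M t0 t1 c t =
     (c t, \<lambda>i. if i \<in> idx M \<and> c t \<in> chart_dom M i
       then vector_derivative (\<lambda>s. chart M i (c s)) (at t within {t0..t1}) else 0)"

text \<open>The canonical flip \<open>\<kappa>\<close>, in coordinates
  \<open>(q, v, q', v') \<mapsto> (q, q', v, v')\<close>.\<close>

definition flip ::
  "('i, ('i, 'q, 'm) tvec, 'm \<times> 'm) tvec \<Rightarrow> ('i, ('i, 'q, 'm) tvec, 'm \<times> 'm) tvec"
where
  "flip = (\<lambda>((q, v), w). ((q, \<lambda>i. fst (w i)), \<lambda>i. (v i, snd (w i))))"

text \<open>The vertical vector at \<open>e\<close> determined by \<open>e'\<close>, i.e. the velocity of \<open>s \<mapsto> e + s e'\<close> at 0.\<close>

definition vertical :: "('i, 'a, 'm::zero, 'e, 'k::zero) vbundle \<Rightarrow> 'e \<Rightarrow> 'e \<Rightarrow> ('i, 'e, 'm \<times> 'k) tvec" where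
  "vertical V e e' = (e, \<lambda>i. if i \<in> idx (base V) \<and> proj V e \<in> chart_dom (base V) i
     then (0, triv V i e') else 0)"


section \<open>Skew algebroids\<close>

record ('i, 'a, 'm, 'e) algebroid =
  anchor :: "'e \<Rightarrow> ('i, 'a, 'm) tvec"
  bracket :: "('a \<Rightarrow> 'e) \<Rightarrow> ('a \<Rightarrow> 'e) \<Rightarrow> 'a \<Rightarrow> 'e"

definition skew_algebroid ::
  "('i, 'a, 'm::finite_dim_inner, 'e, 'k::finite_dim_inner) vbundle \<Rightarrow>
   ('i, 'a, 'm, 'e) algebroid \<Rightarrow> bool"
where
  "skew_algebroid V A \<longleftrightarrow>
     vector_bundle V \<and>
     vb_morphism V (tangent_bundle (base V)) (anchor A) \<and>
     (\<forall>X\<in>sections V. \<forall>Y\<in>sections V.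
        bracket A X Y \<in> sections V \<and>
        bracket A X Y = sec_scale V (\<lambda>_. - 1) (bracket A Y X)) \<and>
     (\<forall>X\<in>sections V. \<forall>Y\<in>sections V. \<forall>Z\<in>sections V.
        bracket A (sec_add V X Y) Z = sec_add V (bracket A X Z) (bracket A Y Z) \<and>
        bracket A X (sec_add V Y Z) = sec_add V (bracket A X Y) (bracket A X Z)) \<and>
     (\<forall>X\<in>sections V. \<forall>Y\<in>sections V. \<forall>r.
        bracket A (sec_scale V (\<lambda>_. r) X) Y = sec_scale V (\<lambda>_. r) (bracket A X Y) \<and>
        bracket A X (sec_scale V (\<lambda>_. r) Y) = sec_scale V (\<lambda>_. r) (bracket A X Y)) \<and>
     (\<forall>X\<in>sections V. \<forall>Y\<in>sections V. \<forall>f. smooth_fun (base V) f \<longrightarrow>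
        bracket A X (sec_scale V f Y) =
          sec_add V (sec_scale V f (bracket A X Y))
            (sec_scale V (\<lambda>p. dT_fun (base V) f (anchor A (X p))) Y))"

text \<open>\<open>\<rho>\<^sup>a\<^sub>k(x) y\<^sup>k\<close> in the chart \<open>i\<close>.\<close>

definition anchor_coord ::
  "('i, 'a, 'm, 'e, 'k) vbundle \<Rightarrow> ('i, 'a, 'm, 'e) algebroid \<Rightarrow> 'i \<Rightarrow> 'a \<Rightarrow> 'k \<Rightarrow> 'm"
where
  "anchor_coord V A i p y = snd (anchor A (from_triv V i p y)) i"

text \<open>
  The bracket is defined on global sections only. By the Leibniz rule (and skew symmetry) its
  value at \<open>p\<close> depends only on the germs of the arguments, so a local section is represented by
  any global section with the same germ. Here this is done for the section \<open>y\<^sup>k e\<^sub>k\<close> with constant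
  coefficients in the local basis given by the trivialization \<open>i\<close>. Hence
  \<open>structure_coord V A i p y f\<close> is \<open>c\<^sup>j\<^sub>k\<^sub>l(x) y\<^sup>k f\<^sup>l\<close>; with \<open>y\<close>, \<open>f\<close> basis vectors one gets the
  structure functions themselves.
\<close>

definition const_section ::
  "('i, 'a, 'm::finite_dim_inner, 'e, 'k::finite_dim_inner) vbundle \<Rightarrow> 'i \<Rightarrow> 'a \<Rightarrow> 'k \<Rightarrow> 'a \<Rightarrow> 'e"
where
  "const_section V i p y = (SOME X. X \<in> sections V \<and>
     (\<exists>U. openin (manifold_topology (base V)) U \<and> p \<in> U \<and> U \<subseteq> chart_dom (base V) i \<and>
        (\<forall>q\<in>U. triv V i (X q) = y)))"

definition structure_coord ::
  "('i, 'a, 'm::finite_dim_inner, 'e, 'k::finite_dim_inner) vbundle \<Rightarrow>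
   ('i, 'a, 'm, 'e) algebroid \<Rightarrow> 'i \<Rightarrow> 'a \<Rightarrow> 'k \<Rightarrow> 'k \<Rightarrow> 'k"
where
  "structure_coord V A i p y f =
     triv V i (bracket A (const_section V i p y) (const_section V i p f) p)"

text \<open>
  The morphism \<open>\<epsilon>\<close> from the cotangent bundle of \<open>E\<close> to the tangent bundle of \<open>E\<^sup>*\<close>, by its
  coordinate expression, which is used in every chart. Its base point, with coordinates
  \<open>(x\<^sup>a, \<pi>\<^sub>i)\<close>, is the restriction of the covector to vertical vectors. The last
  component \<open>z\<close> is the vector with entries \<open>c\<^sup>k\<^sub>i\<^sub>j y\<^sup>i \<pi>\<^sub>k + \<rho>\<^sup>a\<^sub>j p\<^sub>a\<close>, described by its inner
  products with arbitrary \<open>f\<close>.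
\<close>

definition eps ::
  "('i, 'a, 'm::finite_dim_inner, 'e, 'k::finite_dim_inner) vbundle \<Rightarrow>
   ('i, 'a, 'm, 'e) algebroid \<Rightarrow>
   'e \<times> (('i, 'e, 'm \<times> 'k) tvec \<Rightarrow> real) \<Rightarrow> ('i, 'a \<times> ('e \<Rightarrow> real), 'm \<times> 'k) tvec"
where
  "eps V A = (\<lambda>(e, \<omega>). let x = proj V e in
     ((x, \<lambda>e'. if e' \<in> fibre V x then \<omega> (vertical V e e') else 0),
      \<lambda>i. if i \<in> idx (base V) \<and> x \<in> chart_dom (base V) i
        then let y = triv V i e;
                 (p, \<pi>) = triv (cotangent_bundle (total_space V)) i (e, \<omega>)
             in (anchor_coord V A i x y,
                 THE z. \<forall>f. inner z f =
                   inner \<pi> (structure_coord V A i x y f) + inner p (anchor_coord V A i x f))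
        else 0))"


section \<open>Admissible curves, variations and the Euler--Lagrange equation\<close>

definition admissible ::
  "('i, 'a, 'm::finite_dim_inner, 'e, 'k::finite_dim_inner) vbundle \<Rightarrow>
   ('i, 'a, 'm, 'e) algebroid \<Rightarrow> real \<Rightarrow> real \<Rightarrow> (real \<Rightarrow> 'e) \<Rightarrow> bool"
where
  "admissible V A t0 t1 \<gamma> \<longleftrightarrow>
     smooth_curve (total_space V) t0 t1 \<gamma> \<and>
     (\<forall>t\<in>{t0..t1}. anchor A (\<gamma> t) = velocity (base V) t0 t1 (\<lambda>s. proj V (\<gamma> s)) t)"

text \<open>The variation \<open>\<delta>\<^sub>\<xi>\<gamma>\<close>, a curve in the tangent bundle of \<open>E\<close>.\<close>

definition variation ::
  "('i, 'a, 'm::finite_dim_inner, 'e, 'k::finite_dim_inner) vbundle \<Rightarrow>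
   ('i, 'a, 'm, 'e) algebroid \<Rightarrow> real \<Rightarrow> real \<Rightarrow> (real \<Rightarrow> 'e) \<Rightarrow> (real \<Rightarrow> 'e) \<Rightarrow>
   real \<Rightarrow> ('i, 'e, 'm \<times> 'k) tvec"
where
  "variation V A t0 t1 \<gamma> \<xi> t = (\<gamma> t, \<lambda>i.
     let x = proj V (\<gamma> t); y = triv V i (\<gamma> t); f = triv V i (\<xi> t) in
     if i \<in> idx (base V) \<and> x \<in> chart_dom (base V) i
     then (anchor_coord V A i x f,
           vector_derivative (\<lambda>s. triv V i (\<xi> s)) (at t within {t0..t1}) +
             structure_coord V A i x y f)
     else 0)"

definition Lambda ::
  "('i, 'a, 'm::finite_dim_inner, 'e, 'k::finite_dim_inner) vbundle \<Rightarrow>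
   ('i, 'a, 'm, 'e) algebroid \<Rightarrow> ('e \<Rightarrow> real) \<Rightarrow> 'e \<Rightarrow> ('i, 'a \<times> ('e \<Rightarrow> real), 'm \<times> 'k) tvec"
where
  "Lambda V A L e = eps V A (differential (total_space V) L e)"

definition lambda ::
  "('i, 'a, 'm::finite_dim_inner, 'e, 'k::finite_dim_inner) vbundle \<Rightarrow>
   ('i, 'a, 'm, 'e) algebroid \<Rightarrow> ('e \<Rightarrow> real) \<Rightarrow> 'e \<Rightarrow> 'a \<times> ('e \<Rightarrow> real)"
where
  "lambda V A L e = proj (tangent_bundle (total_space (dual_bundle V))) (Lambda V A L e)"

definition EL_solution ::
  "('i, 'a, 'm::finite_dim_inner, 'e, 'k::finite_dim_inner) vbundle \<Rightarrow>
   ('i, 'a, 'm, 'e) algebroid \<Rightarrow> ('e \<Rightarrow> real) \<Rightarrow> real \<Rightarrow> real \<Rightarrow> (real \<Rightarrow> 'e) \<Rightarrow> bool"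
where
  "EL_solution V A L t0 t1 \<gamma> \<longleftrightarrow>
     smooth_curve (total_space V) t0 t1 \<gamma> \<and>
     (\<forall>t\<in>{t0..t1}.
        velocity (total_space (dual_bundle V)) t0 t1 (\<lambda>s. lambda V A L (\<gamma> s)) t = Lambda V A L (\<gamma> t))"

definition curve_over ::
  "('i, 'a, 'm::finite_dim_inner, 'e, 'k::finite_dim_inner) vbundle \<Rightarrow> real \<Rightarrow> real \<Rightarrow>
   (real \<Rightarrow> 'e) \<Rightarrow> (real \<Rightarrow> 'e) \<Rightarrow> bool"
where
  "curve_over V t0 t1 \<gamma> \<eta> \<longleftrightarrow>
     smooth_curve (total_space V) t0 t1 \<eta> \<and> (\<forall>t\<in>{t0..t1}. proj V (\<eta> t) = proj V (\<gamma> t))"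

definition jacobi_field ::
  "('i, 'a, 'm::finite_dim_inner, 'e, 'k::finite_dim_inner) vbundle \<Rightarrow>
   ('i, 'a, 'm, 'e) algebroid \<Rightarrow> ('e \<Rightarrow> real) \<Rightarrow> real \<Rightarrow> real \<Rightarrow>
   (real \<Rightarrow> 'e) \<Rightarrow> (real \<Rightarrow> 'e) \<Rightarrow> bool"
where
  "jacobi_field V A L t0 t1 \<gamma> \<eta> \<longleftrightarrow>
     curve_over V t0 t1 \<gamma> \<eta> \<and>
     (\<forall>t\<in>{t0..t1}.
        velocity (tangent (total_space (dual_bundle V))) t0 t1
          (\<lambda>s. tangent_map (total_space V) (total_space (dual_bundle V)) (lambda V A L)
                 (variation V A t0 t1 \<gamma> \<eta> s)) t
        = flip (tangent_map (total_space V) (tangent (total_space (dual_bundle V))) (Lambda V A L)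
                 (variation V A t0 t1 \<gamma> \<eta> t)))"


section \<open>The tangent lift\<close>

text \<open>
  The vector bundle \<open>T\<tau>\<close> from \<open>TE\<close> to \<open>TM\<close>. A tangent vector of \<open>E\<close> with coordinates
  \<open>((x, y), (x', y'))\<close> has base coordinates \<open>(x, x')\<close> and fibre coordinates \<open>(y, y')\<close>.
\<close>

definition tangent_lift_bundle ::
  "('i, 'a, 'm::real_normed_vector, 'e, 'k::real_normed_vector) vbundle \<Rightarrow>
   ('i, ('i, 'a, 'm) tvec, 'm \<times> 'm, ('i, 'e, 'm \<times> 'k) tvec, 'k \<times> 'k) vbundle"
where
  "tangent_lift_bundle V = \<lparr> base = tangent (base V),
     tot = tot (tangent_bundle (total_space V)),
     proj = tangent_map (total_space V) (base V) (proj V),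
     triv = (\<lambda>i (e, v). (triv V i e, snd (v i))) \<rparr>"

definition tangent_section ::
  "('i, 'a, 'm::real_normed_vector, 'e, 'k::real_normed_vector) vbundle \<Rightarrow> ('a \<Rightarrow> 'e) \<Rightarrow>
   ('i, 'a, 'm) tvec \<Rightarrow> ('i, 'e, 'm \<times> 'k) tvec"
where
  "tangent_section V X = (\<lambda>w\<in>pts (tangent (base V)). tangent_map (base V) (total_space V) X w)"

definition vertical_section ::
  "('i, 'a, 'm::real_normed_vector, 'e, 'k::real_normed_vector) vbundle \<Rightarrow> ('a \<Rightarrow> 'e) \<Rightarrow>
   ('i, 'a, 'm) tvec \<Rightarrow> ('i, 'e, 'm \<times> 'k) tvec"
where
  "vertical_section V X = (\<lambda>w\<in>pts (tangent (base V)).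
     let x = proj (tangent_bundle (base V)) w in
     vadd (tangent_bundle (total_space V))
       (tangent_map (base V) (total_space V) (vzero V) w)
       (vertical V (vzero V x) (X x)))"

text \<open>
  \<open>A'\<close> is the tangent lift \<open>d\<^sub>T E\<close> of the algebroid \<open>A\<close> on \<open>V\<close>. The bracket relations determine
  the bracket, since the sections \<open>TX\<close> and \<open>X\<^sup>v\<close> locally generate all sections of \<open>T\<tau>\<close>.
\<close>

definition is_tangent_lift ::
  "('i, 'a, 'm::finite_dim_inner, 'e, 'k::finite_dim_inner) vbundle \<Rightarrow>
   ('i, 'a, 'm, 'e) algebroid \<Rightarrow>
   ('i, ('i, 'a, 'm) tvec, 'm \<times> 'm, ('i, 'e, 'm \<times> 'k) tvec) algebroid \<Rightarrow> bool"
where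
  "is_tangent_lift V A A' \<longleftrightarrow>
     skew_algebroid (tangent_lift_bundle V) A' \<and>
     (\<forall>w\<in>tot (tangent_lift_bundle V).
        anchor A' w = flip (tangent_map (total_space V) (tangent (base V)) (anchor A) w)) \<and>
     (\<forall>X\<in>sections V. \<forall>Y\<in>sections V.
        bracket A' (tangent_section V X) (tangent_section V Y)
          = tangent_section V (bracket A X Y) \<and>
        bracket A' (tangent_section V X) (vertical_section V Y)
          = vertical_section V (bracket A X Y) \<and>
        bracket A' (vertical_section V X) (vertical_section V Y)
          = (\<lambda>w\<in>pts (tangent (base V)). vzero (tangent_lift_bundle V) w))"

end

theory Submission
  imports Defs
begin

text \<open>
  Everything is computed in a chart, where \<open>L\<close>, the anchor and the bracket become functions \<open>\<ell>(x, y)\<close>,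
  \<open>\<rho>(x) y\<close> and \<open>c(x)(y, f)\<close>. Put \<open>p = \<partial>\<ell>/\<partial>y\<close> and let \<open>F(x, y)\<close> be the covector with
  \<open>F f = p (c(y, f)) + \<partial>\<ell>/\<partial>x (\<rho> f)\<close>, so that the Euler--Lagrange equation reads \<open>x\<^sup>\<bullet> = \<rho> y\<close>,
  \<open>p\<^sup>\<bullet> = F\<close>. Evaluating the bracket of the lift on the sections \<open>TX + Y\<^sup>v\<close> shows that the anchor and
  structure functions of the lift are the tangent lifts of those of \<open>E\<close>. Together with the symmetry of
  the second derivatives of \<open>\<ell>\<close> this gives the momentum \<open>(Dp(v), p)\<close> and the force \<open>(DF(v), F)\<close> for
  \<open>d\<^sub>TL\<close> at a tangent vector with coordinates \<open>v\<close>. For \<open>v = \<delta>\<^sub>\<eta>\<gamma>\<close> the components \<open>x\<^sup>\<bullet> = \<rho> y\<close> and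
  \<open>p\<^sup>\<bullet> = F\<close> hold because \<open>\<gamma>\<close> is a solution. What remains, in the lifted equation as well as in the
  Jacobi equation, is the pair \<open>(\<rho> \<eta>)\<^sup>\<bullet> = D(\<rho> y)(v)\<close>, \<open>(Dp(v))\<^sup>\<bullet> = DF(v)\<close>.
\<close>


section \<open>Finite-dimensional inner product spaces\<close>

text \<open>The bracket acts on global sections, while all formulas are local. Structure functions
  therefore become usable only after local sections have been extended with bump functions and the
  Leibniz rule has shown that the bracket depends on germs. The model spaces may have dimension 0.
  Coordinates refer to one orthonormal basis, and linear maps are expanded in it whenever smoothness
  in a moving argument has to be shown. A tangent vector is a family over all charts with default
  value 0, and tangent maps are evaluated in an arbitrarily chosen chart. A coordinate formula can
  thus be used only for families known to obey the transition law. For the variation this rests on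
  the admissibility of \<open>\<gamma>\<close> and on the non-tensorial transition law of the
  structure functions; for \<open>Lambda V A L\<close> along \<open>\<gamma>\<close> it is read off
  from the Euler-Lagrange equation, which exhibits these values as velocities.\<close>

lemma orthonormal_set_exists:
  "\<exists>B::'a::finite_dim_inner set. finite B \<and> pairwise orthogonal B \<and> (\<forall>b\<in>B. norm b = 1) \<and>
     (\<forall>x. (\<Sum>b\<in>B. (x \<bullet> b) *\<^sub>R b) = x)"
proof -
  obtain S :: "'a set" where S: "finite S" "\<And>x. (\<forall>u\<in>S. inner x u = 0) \<Longrightarrow> x = 0"
    using finite_dim by blast
  obtain C where C: "finite C" "span C = span S" "pairwise orthogonal C"
    using basis_orthogonal[OF S(1)] by blast
  \<comment> \<open>Orthogonalising a dependent family may yield zero vectors; they are dropped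
    before normalising.\<close>
  define B where "B = (\<lambda>c. c /\<^sub>R norm c) ` (C - {0})"
  have fB: "finite B" using C by (simp add: B_def)
  have nB: "norm b = 1" if b: "b \<in> B" for b
  proof -
    obtain c where c: "c \<noteq> 0" "b = c /\<^sub>R norm c" using b unfolding B_def by (elim imageE) auto
    then show ?thesis by simp
  qed
  have oB: "pairwise orthogonal B"
    using C(3) by (fastforce simp: B_def pairwise_def orthogonal_def)
  have ip: "b \<bullet> c = (if b = c then 1 else 0)" if "b \<in> B" "c \<in> B" for b c
    using oB nB that by (auto simp: pairwise_def orthogonal_def norm_eq_1)
  have "(\<Sum>b\<in>B. (x \<bullet> b) *\<^sub>R b) = x" for x
  proof -
    define y where "y = x - (\<Sum>b\<in>B. (x \<bullet> b) *\<^sub>R b)"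
    have yB: "y \<bullet> b = 0" if "b \<in> B" for b
    proof -
      have "(\<Sum>c\<in>B. (x \<bullet> c) *\<^sub>R c) \<bullet> b = (\<Sum>c\<in>B. if c = b then x \<bullet> c else 0)"
        unfolding inner_sum_left by (rule sum.cong) (use that ip in auto)
      also have "\<dots> = x \<bullet> b" using fB that by simp
      finally show ?thesis by (simp add: y_def inner_diff_left)
    qed
    \<comment> \<open>The defect \<open>y\<close> of the expansion is orthogonal to
      \<open>C\<close>, hence to the common span of \<open>C\<close> and \<open>S\<close>, and the
      functionals in \<open>S\<close> separate points.\<close>
    have "orthogonal y c" if "c \<in> C" for c
    proof (cases "c = 0")
      case False
      then have "c /\<^sub>R norm c \<in> B" using that by (auto simp: B_def)
      from yB[OF this] False show ?thesis by (simp add: orthogonal_def)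
    qed (simp add: orthogonal_def)
    then have "orthogonal y u" if "u \<in> span C" for u
      using that orthogonal_to_span by blast
    then have "\<forall>u\<in>S. y \<bullet> u = 0"
      using C(2) span_superset[of S] by (auto simp: orthogonal_def)
    then have "y = 0" by (rule S(2))
    then show ?thesis by (simp add: y_def)
  qed
  then show ?thesis using fB nB oB by blast
qed

text \<open>One orthonormal basis per type, fixed by choice. In dimension 0 it is empty and every
  sum over it vanishes.\<close>

definition onb :: "'a::finite_dim_inner set" where
  "onb = (SOME B. finite B \<and> pairwise orthogonal B \<and> (\<forall>b\<in>B. norm b = 1) \<and>
     (\<forall>x. (\<Sum>b\<in>B. (x \<bullet> b) *\<^sub>R b) = x))"

lemma
  shows finite_onb [simp]: "finite (onb :: 'a::finite_dim_inner set)"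
    and orthogonal_onb: "pairwise orthogonal (onb :: 'a set)"
    and norm_onb: "b \<in> (onb :: 'a set) \<Longrightarrow> norm b = 1"
    and onb_expand: "(\<Sum>b\<in>onb. (x \<bullet> b) *\<^sub>R b) = (x :: 'a)"
  using someI_ex[OF orthonormal_set_exists[where 'a='a]] by (auto simp: onb_def)

lemma inner_onb: "b \<in> (onb :: 'a::finite_dim_inner set) \<Longrightarrow> c \<in> onb \<Longrightarrow> b \<bullet> c = (if b = c then 1 else 0)"
proof (cases "b = c")
  case True
  moreover assume "b \<in> onb"
  ultimately show ?thesis using norm_onb[of b] by (simp add: norm_eq_1)
next
  case False
  moreover assume "b \<in> onb" "c \<in> onb"
  ultimately show ?thesis using orthogonal_onb[where 'a='a] by (simp add: pairwise_def orthogonal_def)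
qed

lemma linear_onb: "linear f \<Longrightarrow> f x = (\<Sum>b\<in>onb. (x \<bullet> b) *\<^sub>R f b)"
  by (subst onb_expand[symmetric]) (simp add: linear_sum linear_scale)

lemma inner_eqI: "(\<And>u. a \<bullet> u = b \<bullet> u) \<Longrightarrow> a = (b :: 'a::real_inner)"
  using vector_eq_rdot[of a b] by blast

text \<open>Covectors are encoded as vectors paired by the inner product. This is the explicit
  representing vector; written as a finite sum, it visibly depends smoothly on parameters of
  \<open>g\<close>.\<close>

lemma riesz_onb:
  fixes g :: "'a::finite_dim_inner \<Rightarrow> real"
  assumes "linear g" shows "(\<Sum>b\<in>onb. g b *\<^sub>R b) \<bullet> f = g f"
proof -
  have "(\<Sum>b\<in>onb. g b *\<^sub>R b) \<bullet> f = (\<Sum>b\<in>onb. (f \<bullet> b) *\<^sub>R g b)"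
    unfolding inner_sum_left by (rule sum.cong) (auto simp: inner_commute)
  then show ?thesis using linear_onb[OF assms, of f] by simp
qed

lemma riesz_the:
  fixes g :: "'a::finite_dim_inner \<Rightarrow> real"
  assumes "linear g"
  shows "(THE z. \<forall>f. z \<bullet> f = g f) = (\<Sum>b\<in>onb. g b *\<^sub>R b)"
proof (rule the_equality)
  show "z = (\<Sum>b\<in>onb. g b *\<^sub>R b)" if "\<forall>f. z \<bullet> f = g f" for z
  proof -
    have "\<forall>f. z \<bullet> f = (\<Sum>b\<in>onb. g b *\<^sub>R b) \<bullet> f" using that riesz_onb[OF assms] by simp
    then show ?thesis by (simp only: vector_eq_rdot)
  qed
qed (use riesz_onb[OF assms] in blast)

text \<open>Bolzano-Weierstrass: the finitely many coordinates with respect to \<open>onb\<close>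
  are bounded, hence converge along a common subsequence, and they determine the vector.\<close>

lemma bounded_convergent_subsequence:
  fixes f :: "nat \<Rightarrow> 'a::finite_dim_inner"
  assumes f: "bounded (range f)"
  shows "\<exists>l r. strict_mono r \<and> (f \<circ> r) \<longlonglongrightarrow> l"
proof -
  have "\<forall>d\<subseteq>onb. \<exists>l::'a. \<exists>r::nat\<Rightarrow>nat. strict_mono r \<and>
      (\<forall>e>0. eventually (\<lambda>n. \<forall>i\<in>d. dist (f (r n) \<bullet> i) (l \<bullet> i) < e) sequentially)"
  proof (rule compact_lemma_general[where unproj="\<lambda>e. \<Sum>i\<in>onb. e i *\<^sub>R i"])
    show "bounded ((\<lambda>x. x \<bullet> k) ` range f)" for k
      by (intro bounded_linear_image f bounded_linear_inner_left)
    show "(\<Sum>i\<in>onb. e i *\<^sub>R i) \<bullet> k = e k" if "k \<in> onb" for k and e :: "'a \<Rightarrow> real"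
    proof -
      have "(\<Sum>i\<in>onb. e i *\<^sub>R i) \<bullet> k = (\<Sum>i\<in>onb. if i = k then e i else 0)"
        unfolding inner_sum_left by (rule sum.cong) (use that in \<open>auto simp: inner_onb\<close>)
      then show ?thesis using that by simp
    qed
  qed (auto simp: onb_expand)
  then obtain l :: 'a and r where r: "strict_mono r"
    and l: "\<And>e. e > 0 \<Longrightarrow> eventually (\<lambda>n. \<forall>i\<in>onb. dist (f (r n) \<bullet> i) (l \<bullet> i) < e) sequentially"
    by blast
  have "(\<lambda>n. \<Sum>i\<in>onb. (f (r n) \<bullet> i) *\<^sub>R i) \<longlonglongrightarrow> (\<Sum>i\<in>onb. (l \<bullet> i) *\<^sub>R i)"
  proof (intro tendsto_sum tendsto_scaleR tendsto_const)
    fix i :: 'a assume i: "i \<in> onb"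
    show "(\<lambda>n. f (r n) \<bullet> i) \<longlonglongrightarrow> l \<bullet> i"
    proof (rule tendstoI)
      fix e :: real assume "0 < e"
      from l[OF this] show "eventually (\<lambda>n. dist (f (r n) \<bullet> i) (l \<bullet> i) < e) sequentially"
        by (rule eventually_mono) (use i in blast)
    qed
  qed
  then have "(f \<circ> r) \<longlonglongrightarrow> l" by (simp add: onb_expand o_def)
  with r show ?thesis by blast
qed

text \<open>Supplies the compact sets that carry the bump functions on a manifold.\<close>

lemma compact_cball_fdi: "compact (cball a r :: 'a::finite_dim_inner set)"
  unfolding compact_eq_seq_compact_metric seq_compact_def
proof (intro allI impI)
  fix f :: "nat \<Rightarrow> 'a" assume f: "\<forall>n. f n \<in> cball a r"
  then have "bounded (range f)" by (intro bounded_subset[OF bounded_cball[of a r]]) auto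
  from bounded_convergent_subsequence[OF this] obtain l s
    where ls: "strict_mono s" "(f \<circ> s) \<longlonglongrightarrow> l" by blast
  have "l \<in> cball a r"
    by (rule closed_sequentially[OF closed_cball _ ls(2)]) (use f in auto)
  with ls show "\<exists>l\<in>cball a r. \<exists>s. strict_mono s \<and> (f \<circ> s) \<longlonglongrightarrow> l" by blast
qed


section \<open>Calculus of smooth functions\<close>

text \<open>By linearity it suffices to ask for the uniqueness of the derivative of the zero function.\<close>

definition uniq_diff :: "'a::real_normed_vector set \<Rightarrow> bool" where
  "uniq_diff S \<longleftrightarrow> (\<forall>x\<in>S. \<forall>D::'a \<Rightarrow> real. ((\<lambda>_. 0) has_derivative D) (at x within S) \<longrightarrow> D = (\<lambda>_. 0))"

lemma uniq_diff_unique: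
  fixes f :: "'a::real_normed_vector \<Rightarrow> 'b::real_inner"
  assumes "uniq_diff S" "x \<in> S" "(f has_derivative D) (at x within S)" "(f has_derivative D') (at x within S)"
  shows "D = D'"
proof
  fix h
  \<comment> \<open>Pairing with the fixed vector \<open>D h - D' h\<close> reduces to a real-valued
    derivative of the zero function; at \<open>k = h\<close> it is a squared norm.\<close>
  have "((\<lambda>y. (f y - f y) \<bullet> (D h - D' h)) has_derivative (\<lambda>k. (D k - D' k) \<bullet> (D h - D' h))) (at x within S)"
    by (intro has_derivative_inner_left has_derivative_diff assms)
  then have "(\<lambda>k. (D k - D' k) \<bullet> (D h - D' h)) = (\<lambda>_. 0)"
    using assms(1,2) by (simp add: uniq_diff_def)
  then have "(D h - D' h) \<bullet> (D h - D' h) = 0" by meson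
  then show "D h = D' h" by simp
qed

lemma uniq_diff_fd:
  fixes f :: "'a::real_normed_vector \<Rightarrow> 'b::real_inner"
  assumes "uniq_diff S" "x \<in> S" "(f has_derivative D) (at x within S)"
  shows "frechet_derivative f (at x within S) = D"
proof (rule uniq_diff_unique[OF assms(1,2) _ assms(3)])
  show "(f has_derivative frechet_derivative f (at x within S)) (at x within S)"
    using assms(3) frechet_derivative_works differentiable_def by blast
qed

lemma uniq_diff_open: "open S \<Longrightarrow> uniq_diff S"
  unfolding uniq_diff_def
proof (intro ballI allI impI)
  fix x and D :: "'a \<Rightarrow> real"
  assume "open S" "x \<in> S" "((\<lambda>_. 0) has_derivative D) (at x within S)"
  then have "((\<lambda>_. 0) has_derivative D) (at x)" by (simp add: at_within_open_NO_MATCH)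
  from has_derivative_unique[OF this has_derivative_const] show "D = (\<lambda>_. 0)" .
qed

text \<open>In a nondegenerate interval the one-sided difference quotients still determine the
  derivative at an end point. The open set \<open>W\<close> later cuts out the times that a curve
  spends in one chart.\<close>

lemma uniq_diff_interval:
  assumes "t0 < t1" "open W" shows "uniq_diff ({t0..t1::real} \<inter> W)"
  unfolding uniq_diff_def
proof (intro ballI allI impI)
  fix x and D :: "real \<Rightarrow> real"
  assume x: "x \<in> {t0..t1} \<inter> W" and D: "((\<lambda>_. 0) has_derivative D) (at x within {t0..t1} \<inter> W)"
  have eq: "at x within {t0..t1} \<inter> W = at x within {t0..t1}"
    by (rule at_within_nhd[of _ W]) (use x assms in auto)
  interpret D: linear D using D by (rule has_derivative_linear)
  have D1: "D = (\<lambda>h. h *\<^sub>R D 1)"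
  proof
    show "D h = h *\<^sub>R D 1" for h using D.scale[of h 1] by (metis real_scaleR_def mult.right_neutral)
  qed
  have "((\<lambda>_. 0) has_vector_derivative D 1) (at x within {t0..t1})"
    using D unfolding eq has_vector_derivative_def D1[symmetric] .
  then have "D 1 = 0"
    using assms x vector_derivative_unique_within_closed_interval[of t0 t1 x "\<lambda>_. 0" "D 1" 0]
    by (simp add: has_vector_derivative_const)
  then show "D = (\<lambda>_. 0)" by (subst D1) simp
qed

abbreviation FD :: "('a::real_normed_vector \<Rightarrow> 'b::real_normed_vector) \<Rightarrow> 'a \<Rightarrow> 'a \<Rightarrow> 'b" where
  "FD f x \<equiv> frechet_derivative f (at x)"

section \<open>Locality and closure properties of \<open>Ck_on\<close> and
  \<open>smooth_on\<close>\<close>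

lemma frechet_derivative_cong_within:
  assumes "\<And>y. y \<in> S \<Longrightarrow> f y = g y" "x \<in> S"
  shows "frechet_derivative f (at x within S) = frechet_derivative g (at x within S)"
proof -
  have "(f has_derivative D) (at x within S) \<longleftrightarrow> (g has_derivative D) (at x within S)" for D
    using assms by (metis has_derivative_transform)
  then show ?thesis by (simp add: frechet_derivative_def)
qed

lemma Ck_on_cong:
  assumes "\<And>x. x \<in> S \<Longrightarrow> f x = g x" shows "Ck_on k S f = Ck_on k S g"
  using assms
proof (induction k arbitrary: f g)
  case 0
  then show ?case by (simp cong: continuous_on_cong_simp)
next
  case (Suc k)
  have "f differentiable_on S \<longleftrightarrow> g differentiable_on S"
    using Suc.prems unfolding differentiable_on_def differentiable_def
    by (metis has_derivative_transform)
  moreover have "Ck_on k S (\<lambda>x. frechet_derivative f (at x within S) v) =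
      Ck_on k S (\<lambda>x. frechet_derivative g (at x within S) v)" for v
    by (rule Suc.IH) (use Suc.prems frechet_derivative_cong_within in metis)
  ultimately show ?case by simp
qed

lemma smooth_on_cong: "(\<And>x. x \<in> S \<Longrightarrow> f x = g x) \<Longrightarrow> smooth_on S f = smooth_on S g"
  unfolding smooth_on_def using Ck_on_cong by blast

lemma Ck_on_Suc_D: "Ck_on (Suc k) S f \<Longrightarrow> Ck_on k S f"
proof (induction k arbitrary: f)
  case 0
  then show ?case by (auto intro: differentiable_imp_continuous_on)
next
  case (Suc k)
  then show ?case by auto
qed

lemma Ck_on_Int_open: "open T \<Longrightarrow> Ck_on k S f \<Longrightarrow> Ck_on k (S \<inter> T) f"
proof (induction k arbitrary: f)
  case 0
  then show ?case by (auto intro: continuous_on_subset)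
next
  case (Suc k)
  have eq: "at x within S \<inter> T = at x within S" if "x \<in> S \<inter> T" for x
    by (rule at_within_nhd[of _ T]) (use that Suc.prems in auto)
  have "f differentiable_on S \<inter> T"
    using Suc.prems by (auto simp: differentiable_on_def eq)
  moreover have "Ck_on k (S \<inter> T) (\<lambda>x. frechet_derivative f (at x within S \<inter> T) v)" for v
    using Suc eq by (subst Ck_on_cong[where g="\<lambda>x. frechet_derivative f (at x within S) v"]) auto
  ultimately show ?case by simp
qed

lemma smooth_on_Int_open: "open T \<Longrightarrow> smooth_on S f \<Longrightarrow> smooth_on (S \<inter> T) f"
  unfolding smooth_on_def using Ck_on_Int_open by blast

lemma smooth_on_open_subset: "open T \<Longrightarrow> T \<subseteq> S \<Longrightarrow> smooth_on S f \<Longrightarrow> smooth_on T f"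
  using smooth_on_Int_open[of T S f] by (simp add: Int_absorb1)

text \<open>An open \<open>T\<close> around \<open>x\<close> leaves the filter
  \<open>at x within S\<close> unchanged, so derivatives within \<open>S\<close> and within
  \<open>S \<inter> T\<close> agree at every level of the recursion.\<close>

lemma Ck_on_local:
  "(\<And>x. x \<in> S \<Longrightarrow> \<exists>T. open T \<and> x \<in> T \<and> Ck_on k (S \<inter> T) f) \<Longrightarrow> Ck_on k S f"
proof (induction k arbitrary: f)
  case 0
  show ?case unfolding Ck_on.simps continuous_on_eq_continuous_within
  proof
    fix x assume x: "x \<in> S"
    from 0[OF x] obtain T where T: "open T" "x \<in> T" "continuous_on (S \<inter> T) f" by auto
    have "at x within S \<inter> T = at x within S"
      by (rule at_within_nhd[of _ T]) (use T in auto)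
    then show "continuous (at x within S) f"
      using T x by (metis IntI continuous_on_eq_continuous_within)
  qed
next
  case (Suc k)
  have eq: "at x within S \<inter> T = at x within S" if "open T" "x \<in> T" for x T
    by (rule at_within_nhd[of _ T]) (use that in auto)
  have "f differentiable_on S"
    unfolding differentiable_on_def
  proof
    fix x assume x: "x \<in> S"
    from Suc.prems[OF x] obtain T where T: "open T" "x \<in> T" "f differentiable_on (S \<inter> T)" by auto
    then show "f differentiable (at x within S)"
      using x eq[OF T(1,2)] by (metis IntI differentiable_on_def)
  qed
  moreover have "Ck_on k S (\<lambda>x. frechet_derivative f (at x within S) v)" for v
  proof (rule Suc.IH)
    fix x assume x: "x \<in> S"
    from Suc.prems[OF x] obtain T where T: "open T" "x \<in> T"
      and c: "Ck_on k (S \<inter> T) (\<lambda>x. frechet_derivative f (at x within S \<inter> T) v)" by auto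
    have "Ck_on k (S \<inter> T) (\<lambda>x. frechet_derivative f (at x within S) v)"
      using c by (subst (asm) Ck_on_cong[where g="\<lambda>x. frechet_derivative f (at x within S) v"])
        (use eq T in auto)
    with T show "\<exists>T. open T \<and> x \<in> T \<and> Ck_on k (S \<inter> T) (\<lambda>x. frechet_derivative f (at x within S) v)"
      by blast
  qed
  ultimately show ?case by simp
qed

lemma smooth_on_local:
  assumes "\<And>x. x \<in> S \<Longrightarrow> \<exists>T. open T \<and> x \<in> T \<and> smooth_on (S \<inter> T) f"
  shows "smooth_on S f"
  unfolding smooth_on_def
proof
  fix k show "Ck_on k S f" by (rule Ck_on_local) (use assms smooth_on_def in blast)
qed

lemma Ck_on_has_derivative:
  "Ck_on (Suc k) S f \<Longrightarrow> x \<in> S \<Longrightarrow>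
   (f has_derivative frechet_derivative f (at x within S)) (at x within S)"
  by (simp add: differentiable_on_def frechet_derivative_works)

text \<open>\<open>frechet_derivative\<close> is a choice. Uniqueness of derivatives within
  \<open>S\<close> identifies any derivative found by a rule with the chosen one; all closure
  properties below go through this step.\<close>

lemma Ck_on_SucI:
  fixes f :: "'a::real_normed_vector \<Rightarrow> 'b::real_inner"
  assumes "uniq_diff S" "\<And>x. x \<in> S \<Longrightarrow> (f has_derivative D x) (at x within S)"
    "\<And>v. Ck_on k S (\<lambda>x. D x v)"
  shows "Ck_on (Suc k) S f"
proof -
  have "f differentiable_on S" using assms(2) by (auto simp: differentiable_on_def differentiable_def)
  moreover have "Ck_on k S (\<lambda>x. frechet_derivative f (at x within S) v)" for v
    using assms(3)[of v] uniq_diff_fd[OF assms(1) _ assms(2)]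
    by (subst Ck_on_cong[where g="\<lambda>x. D x v"]) auto
  ultimately show ?thesis by simp
qed

lemma Ck_on_const:
  fixes c :: "'b::real_inner"
  shows "uniq_diff S \<Longrightarrow> Ck_on k S (\<lambda>_. c)"
proof (induction k arbitrary: c)
  case (Suc k)
  then show ?case by (intro Ck_on_SucI[where D="\<lambda>_ _. 0"]) auto
qed simp

lemma Ck_on_linear:
  fixes f :: "'a::real_normed_vector \<Rightarrow> 'b::real_inner" and A :: "'b \<Rightarrow> 'c::real_inner"
  assumes "uniq_diff S" "bounded_linear A"
  shows "Ck_on k S f \<Longrightarrow> Ck_on k S (\<lambda>x. A (f x))"
proof (induction k arbitrary: f)
  case 0
  then show ?case using assms by (simp add: bounded_linear.continuous_on)
next
  case (Suc k)
  show ?case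
    by (rule Ck_on_SucI[OF assms(1) bounded_linear.has_derivative[OF assms(2)
          Ck_on_has_derivative[OF Suc.prems]]]) (use Suc in auto)
qed

lemma Ck_on_add:
  fixes f g :: "'a::real_normed_vector \<Rightarrow> 'b::real_inner"
  assumes "uniq_diff S"
  shows "Ck_on k S f \<Longrightarrow> Ck_on k S g \<Longrightarrow> Ck_on k S (\<lambda>x. f x + g x)"
proof (induction k arbitrary: f g)
  case 0
  then show ?case by (simp add: continuous_on_add)
next
  case (Suc k)
  show ?case
    by (rule Ck_on_SucI[OF assms has_derivative_add[OF Ck_on_has_derivative[OF Suc.prems(1)]
            Ck_on_has_derivative[OF Suc.prems(2)]]]) (use Suc in auto)
qed

lemma Ck_on_sum:
  fixes f :: "'i \<Rightarrow> 'a::real_normed_vector \<Rightarrow> 'b::real_inner"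
  assumes "uniq_diff S" "\<And>i. i \<in> I \<Longrightarrow> Ck_on k S (f i)"
  shows "Ck_on k S (\<lambda>x. \<Sum>i\<in>I. f i x)"
  using assms(2) by (induction I rule: infinite_finite_induct) (auto intro: Ck_on_const Ck_on_add assms(1))

lemma Ck_on_bilinear:
  fixes f :: "'a::real_normed_vector \<Rightarrow> 'b::real_normed_vector"
    and g :: "'a \<Rightarrow> 'c::real_normed_vector" and pr :: "'b \<Rightarrow> 'c \<Rightarrow> 'd::real_inner"
  assumes "uniq_diff S" "bounded_bilinear pr"
  shows "Ck_on k S f \<Longrightarrow> Ck_on k S g \<Longrightarrow> Ck_on k S (\<lambda>x. pr (f x) (g x))"
proof (induction k arbitrary: f g)
  case 0
  then show ?case using assms by (simp add: bounded_bilinear.continuous_on)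
next
  case (Suc k)
  have "Ck_on k S f" "Ck_on k S g" using Suc.prems Ck_on_Suc_D by blast+
  then show ?case
    using Suc
    by (intro Ck_on_SucI[OF assms(1) bounded_bilinear.FDERIV[OF assms(2)
            Ck_on_has_derivative[OF Suc.prems(1)] Ck_on_has_derivative[OF Suc.prems(2)]]]
          Ck_on_add assms) auto
qed

text \<open>\<open>Ck_on\<close> controls derivatives in constant directions, whereas the chain rule
  evaluates the derivative of \<open>f\<close> in the moving direction given by the derivative of
  \<open>g\<close>. Expanding that direction in \<open>onb\<close> leaves constant directions with
  differentiable coefficients; hence the finite-dimensional intermediate space.\<close>

lemma Ck_on_compose:
  fixes g :: "'a::real_normed_vector \<Rightarrow> 'b::finite_dim_inner" and f :: "'b \<Rightarrow> 'c::real_inner"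
  assumes "uniq_diff S" "uniq_diff T" "g ` S \<subseteq> T"
  shows "Ck_on k T f \<Longrightarrow> Ck_on k S g \<Longrightarrow> Ck_on k S (\<lambda>x. f (g x))"
proof (induction k arbitrary: f)
  case 0
  then show ?case using assms by (auto intro: continuous_on_compose2)
next
  case (Suc k)
  let ?Df = "\<lambda>y. frechet_derivative f (at y within T)"
  let ?Dg = "\<lambda>x. frechet_derivative g (at x within S)"
  have D: "((\<lambda>x. f (g x)) has_derivative (\<lambda>v. \<Sum>b\<in>onb. (?Dg x v \<bullet> b) *\<^sub>R ?Df (g x) b)) (at x within S)"
    if x: "x \<in> S" for x
  proof -
    have "((\<lambda>x. f (g x)) has_derivative (\<lambda>v. ?Df (g x) (?Dg x v))) (at x within S)"
      by (rule has_derivative_in_compose2[OF Ck_on_has_derivative[OF Suc.prems(1)] assms(3) x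
            Ck_on_has_derivative[OF Suc.prems(2) x]])
    moreover have lin: "?Df (g x) w = (\<Sum>b\<in>onb. (w \<bullet> b) *\<^sub>R ?Df (g x) b)" for w
    proof (rule linear_onb)
      have "g x \<in> T" using x assms by auto
      then show "linear (?Df (g x))"
        using Ck_on_has_derivative[OF Suc.prems(1)] has_derivative_linear by blast
    qed
    ultimately show ?thesis by (rule has_derivative_eq_rhs[OF _ ext])
  qed
  have "Ck_on k S (\<lambda>x. ?Df (g x) b)" for b
    using Suc.prems by (intro Suc.IH Ck_on_Suc_D[OF Suc.prems(2)]) auto
  moreover have "Ck_on k S (\<lambda>x. ?Dg x v \<bullet> b)" for v b
    by (rule Ck_on_linear[OF assms(1) bounded_linear_inner_left]) (use Suc.prems in auto)
  ultimately have "Ck_on k S (\<lambda>x. \<Sum>b\<in>onb. (?Dg x v \<bullet> b) *\<^sub>R ?Df (g x) b)" for v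
    by (intro Ck_on_sum[OF assms(1)] Ck_on_bilinear[OF assms(1) bounded_bilinear_scaleR])
  then show ?case by (rule Ck_on_SucI[OF assms(1), rotated]) (rule D)
qed

lemma smooth_on_const: "uniq_diff S \<Longrightarrow> smooth_on S (\<lambda>_. c::'b::real_inner)"
  by (simp add: smooth_on_def Ck_on_const)

lemma smooth_on_linear:
  fixes A :: "'b::real_inner \<Rightarrow> 'c::real_inner"
  shows "uniq_diff S \<Longrightarrow> bounded_linear A \<Longrightarrow> smooth_on S f \<Longrightarrow> smooth_on S (\<lambda>x. A (f x))"
  by (simp add: smooth_on_def Ck_on_linear)

lemma smooth_on_add:
  fixes f g :: "_ \<Rightarrow> 'b::real_inner"
  shows "uniq_diff S \<Longrightarrow> smooth_on S f \<Longrightarrow> smooth_on S g \<Longrightarrow> smooth_on S (\<lambda>x. f x + g x)"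
  by (simp add: smooth_on_def Ck_on_add)

lemma smooth_on_sum:
  fixes f :: "'i \<Rightarrow> 'a::real_normed_vector \<Rightarrow> 'b::real_inner"
  shows "uniq_diff S \<Longrightarrow> (\<And>i. i \<in> I \<Longrightarrow> smooth_on S (f i)) \<Longrightarrow> smooth_on S (\<lambda>x. \<Sum>i\<in>I. f i x)"
  by (simp add: smooth_on_def Ck_on_sum)

lemma smooth_on_bilinear:
  fixes pr :: "'b::real_normed_vector \<Rightarrow> 'c::real_normed_vector \<Rightarrow> 'd::real_inner"
  shows "uniq_diff S \<Longrightarrow> bounded_bilinear pr \<Longrightarrow> smooth_on S f \<Longrightarrow> smooth_on S g
    \<Longrightarrow> smooth_on S (\<lambda>x. pr (f x) (g x))"
  by (simp add: smooth_on_def Ck_on_bilinear)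

lemmas smooth_on_scaleR = smooth_on_bilinear[OF _ bounded_bilinear_scaleR]
lemmas smooth_on_inner = smooth_on_bilinear[OF _ bounded_bilinear_inner]
lemma smooth_on_mult:
  fixes f g :: "'a::real_normed_vector \<Rightarrow> real"
  shows "uniq_diff S \<Longrightarrow> smooth_on S f \<Longrightarrow> smooth_on S g \<Longrightarrow> smooth_on S (\<lambda>x. f x * g x)"
  by (rule smooth_on_bilinear[OF _ bounded_bilinear_mult])

lemma smooth_on_compose:
  fixes g :: "'a::real_normed_vector \<Rightarrow> 'b::finite_dim_inner" and f :: "'b \<Rightarrow> 'c::real_inner"
  shows "uniq_diff S \<Longrightarrow> uniq_diff T \<Longrightarrow> smooth_on T f \<Longrightarrow> smooth_on S g \<Longrightarrow> g ` S \<subseteq> T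
     \<Longrightarrow> smooth_on S (\<lambda>x. f (g x))"
  by (simp add: smooth_on_def Ck_on_compose)

lemma Ck_on_ident: "uniq_diff S \<Longrightarrow> Ck_on k S (\<lambda>x::'a::real_inner. x)"
proof (cases k)
  case (Suc j)
  assume "uniq_diff S"
  then show ?thesis unfolding Suc
    by (intro Ck_on_SucI[where D="\<lambda>_ v. v"] Ck_on_const has_derivative_ident)
qed auto

lemma smooth_on_ident: "uniq_diff S \<Longrightarrow> smooth_on S (\<lambda>x::'a::real_inner. x)"
  by (simp add: smooth_on_def Ck_on_ident)

lemma smooth_on_Pair:
  fixes f :: "'a::real_normed_vector \<Rightarrow> 'b::real_inner" and g :: "'a \<Rightarrow> 'c::real_inner"
  assumes "uniq_diff S" "smooth_on S f" "smooth_on S g"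
  shows "smooth_on S (\<lambda>x. (f x, g x))"
proof -
  have "smooth_on S (\<lambda>x. (f x, 0) + (0, g x))"
    by (intro smooth_on_add smooth_on_linear[OF _ _ assms(2), where A="\<lambda>y. (y, 0)"]
        smooth_on_linear[OF _ _ assms(3), where A="\<lambda>y. (0, y)"] assms(1)
        bounded_linear_Pair bounded_linear_ident bounded_linear_zero)
  then show ?thesis by simp
qed

lemma smooth_on_fst:
  fixes f :: "'a::real_normed_vector \<Rightarrow> 'b::real_inner \<times> 'c::real_inner"
  shows "uniq_diff S \<Longrightarrow> smooth_on S f \<Longrightarrow> smooth_on S (\<lambda>x. fst (f x))"
  by (rule smooth_on_linear[OF _ bounded_linear_fst])

lemma smooth_on_snd:
  fixes f :: "'a::real_normed_vector \<Rightarrow> 'b::real_inner \<times> 'c::real_inner"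
  shows "uniq_diff S \<Longrightarrow> smooth_on S f \<Longrightarrow> smooth_on S (\<lambda>x. snd (f x))"
  by (rule smooth_on_linear[OF _ bounded_linear_snd])

lemma smooth_on_Suc: "smooth_on S f \<Longrightarrow> smooth_on S (\<lambda>x. frechet_derivative f (at x within S) v)"
  unfolding smooth_on_def using Ck_on.simps(2) by blast

lemma smooth_on_has_derivative:
  "smooth_on S f \<Longrightarrow> x \<in> S \<Longrightarrow> (f has_derivative frechet_derivative f (at x within S)) (at x within S)"
  unfolding smooth_on_def using Ck_on_has_derivative by blast

lemma smooth_on_has_derivative_at:
  "open S \<Longrightarrow> smooth_on S f \<Longrightarrow> x \<in> S \<Longrightarrow> (f has_derivative FD f x) (at x)"
  using smooth_on_has_derivative[of S f x] by (simp add: at_within_open_NO_MATCH)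

lemma smooth_on_continuous: "smooth_on S f \<Longrightarrow> continuous_on S f"
  unfolding smooth_on_def using Ck_on.simps(1) by blast

text \<open>The expansion in \<open>onb\<close> again, now with point and direction both moving. In
  this form \<open>d\<^sub>T L\<close>, lifted sections and the variation of the momentum are seen
  to be smooth.\<close>

lemma smooth_on_deriv_apply:
  fixes g :: "'a::real_normed_vector \<Rightarrow> 'b::finite_dim_inner" and f :: "'b \<Rightarrow> 'c::real_inner"
  assumes "uniq_diff S" "open T" "smooth_on T f" "smooth_on S g" "smooth_on S h" "g ` S \<subseteq> T"
  shows "smooth_on S (\<lambda>x. FD f (g x) (h x))"
proof -
  have "smooth_on T (\<lambda>y. FD f y b)" for b
    using smooth_on_Suc[OF assms(3), of b] assms(2)
    by (subst smooth_on_cong[where g="\<lambda>y. frechet_derivative f (at y within T) b"]) (auto simp: at_within_open_NO_MATCH)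
  then have "smooth_on S (\<lambda>x. \<Sum>b\<in>onb. (h x \<bullet> b) *\<^sub>R FD f (g x) b)"
    using assms uniq_diff_open
    by (intro smooth_on_sum smooth_on_scaleR smooth_on_linear[OF _ bounded_linear_inner_left]
        smooth_on_compose[where f="\<lambda>y. FD f y _" and T=T and g=g]) auto
  moreover have "FD f (g x) (h x) =
      (\<Sum>b\<in>onb. (h x \<bullet> b) *\<^sub>R FD f (g x) b)" if x: "x \<in> S" for x
  proof (rule linear_onb)
    have "g x \<in> T" using x assms(6) by auto
    from smooth_on_has_derivative_at[OF assms(2,3) this]
    show "linear (FD f (g x))" by (rule has_derivative_linear)
  qed
  ultimately show ?thesis by (subst smooth_on_cong) auto
qed

section \<open>Smooth bump functions on the model space\<close>

lemma Ck_on_inverse: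
  fixes f :: "'a::real_normed_vector \<Rightarrow> real"
  assumes "uniq_diff S" "\<And>x. x \<in> S \<Longrightarrow> f x \<noteq> 0"
  shows "Ck_on k S f \<Longrightarrow> Ck_on k S (\<lambda>x. inverse (f x))"
proof (induction k)
  case 0
  then show ?case using assms(2) by (auto intro: continuous_on_inverse)
next
  case (Suc k)
  let ?D = "\<lambda>x. frechet_derivative f (at x within S)"
  have "Ck_on k S (\<lambda>x. inverse (f x))" using Suc Ck_on_Suc_D by blast
  moreover have "Ck_on k S (\<lambda>x. ?D x v)" for v using Suc.prems by simp
  ultimately have "Ck_on k S (\<lambda>x. - (inverse (f x) * ?D x v * inverse (f x)))" for v
    by (intro Ck_on_linear[OF assms(1) bounded_linear_minus[OF bounded_linear_ident]]
        Ck_on_bilinear[OF assms(1) bounded_bilinear_mult])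
  then show ?case
    by (intro Ck_on_SucI[OF assms(1) Deriv.has_derivative_inverse[OF assms(2)
          Ck_on_has_derivative[OF Suc.prems]]])
qed

text \<open>The powers of \<open>1/x\<close> make this family of flat functions closed under differentiation.\<close>

definition flat :: "nat \<Rightarrow> real \<Rightarrow> real" where
  "flat n x = (if x \<le> 0 then 0 else inverse x ^ n * exp (- inverse x))"

lemma flat_has_derivative:
  "(flat n has_real_derivative (flat (n + 2) x - n * flat (n + 1) x)) (at x)"
proof -
  consider "x < 0" | "x = 0" | "x > 0" by linarith
  then show ?thesis
  proof cases
    case 1
    have "(flat n has_real_derivative 0) (at x)"
      by (rule has_field_derivative_transform_within_open[OF _ open_lessThan[of 0], where f="\<lambda>_. 0"])
        (use 1 in \<open>auto simp: flat_def\<close>)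
    then show ?thesis using 1 by (simp add: flat_def)
  next
    case 2
    have "((\<lambda>y. (flat n y - flat n 0) / (y - 0)) \<longlongrightarrow> 0) (at_left 0)"
      by (rule tendsto_eventually) (auto simp: eventually_at_filter flat_def)
    moreover have "((\<lambda>y. (flat n y - flat n 0) / (y - 0)) \<longlongrightarrow> 0) (at_right 0)"
    proof -
      \<comment> \<open>This is the right difference quotient at 0. With
        \<open>u = inverse y\<close> it becomes a power of \<open>u\<close> over
        \<open>exp u\<close>, for \<open>u\<close> tending to infinity.\<close>
      have "((\<lambda>y. inverse y ^ Suc n / exp (inverse y)) \<longlongrightarrow> 0) (at_right (0::real))"
        unfolding filterlim_at_right_to_top using tendsto_power_div_exp_0[of "Suc n"] by simp
      then show ?thesis
        by (rule Lim_transform_eventually)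
          (auto simp: eventually_at_filter flat_def exp_minus divide_inverse)
    qed
    ultimately have "((\<lambda>y. (flat n y - flat n 0) / (y - 0)) \<longlongrightarrow> 0) (at 0)"
      by (rule filterlim_split_at)
    then show ?thesis using 2 by (simp add: has_field_derivative_iff flat_def)
  next
    case 3
    have "((\<lambda>x. inverse x ^ n * exp (- inverse x)) has_real_derivative
       (inverse x ^ (n + 2) * exp (- inverse x) - n * (inverse x ^ (n + 1) * exp (- inverse x)))) (at x)"
    proof -
      have m1: "((\<lambda>x. inverse x ^ n) has_real_derivative (- (n * inverse x ^ (n + 1)))) (at x)"
        using DERIV_power[OF DERIV_inverse[of x], of n] 3
        by (cases n) (auto simp: power2_eq_square algebra_simps)
      have m2: "((\<lambda>x. exp (- inverse x)) has_real_derivative (exp (- inverse x) * inverse x ^ 2)) (at x)"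
        using 3 by (auto intro!: derivative_eq_intros simp: power2_eq_square)
      show ?thesis
        by (rule DERIV_cong[OF DERIV_mult[OF m1 m2]]) (simp add: algebra_simps power2_eq_square)
    qed
    then have "(flat n has_real_derivative
       (inverse x ^ (n + 2) * exp (- inverse x) - n * (inverse x ^ (n + 1) * exp (- inverse x)))) (at x)"
      by (rule has_field_derivative_transform_within_open[OF _ open_greaterThan[of 0]])
        (use 3 in \<open>auto simp: flat_def\<close>)
    then show ?thesis using 3 by (simp add: flat_def)
  qed
qed

lemma Ck_on_flat: "Ck_on k UNIV (flat n)"
proof (induction k arbitrary: n)
  case 0
  show ?case
    using flat_has_derivative by (auto intro!: continuous_at_imp_continuous_on DERIV_isCont)
next
  case (Suc k)
  have D: "(flat n has_derivative (\<lambda>v. (flat (n + 2) x - n * flat (n + 1) x) * v)) (at x within UNIV)" for x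
    using flat_has_derivative[of n x] by (simp add: has_field_derivative_def)
  have "Ck_on k UNIV (\<lambda>x. v *\<^sub>R (flat (n + 2) x + (- real n) *\<^sub>R flat (n + 1) x))" for v :: real
    by (intro Ck_on_linear[OF uniq_diff_open bounded_linear_scaleR_right] Ck_on_add uniq_diff_open Suc open_UNIV)
  then have "Ck_on k UNIV (\<lambda>x. (flat (n + 2) x - n * flat (n + 1) x) * v)" for v
    by (simp add: mult.commute)
  then show ?case by (rule Ck_on_SucI[OF uniq_diff_open[OF open_UNIV] D, rotated])
qed

lemma bump_exists:
  fixes a :: "'a::real_inner"
  assumes "0 < r"
  shows "\<exists>f::'a \<Rightarrow> real. smooth_on UNIV f \<and> (\<forall>x\<in>ball a r. f x = 1) \<and> (\<forall>x. x \<notin> ball a (2 * r) \<longrightarrow> f x = 0)"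
proof -
  define s where "s x = ((x - a) \<bullet> (x - a)) / r\<^sup>2" for x
  have s: "s x = (dist a x / r)\<^sup>2" for x
    by (simp add: s_def power_divide dist_norm norm_minus_commute[of a] power2_norm_eq_inner)
  have U: "uniq_diff (UNIV :: 'b::real_normed_vector set)" by (simp add: uniq_diff_open)
  have "smooth_on UNIV (\<lambda>x. x + (- a))"
    by (intro smooth_on_add smooth_on_ident smooth_on_const U)
  then have "smooth_on UNIV (\<lambda>x. (x - a) \<bullet> (x - a))"
    by (intro smooth_on_inner U) simp_all
  then have sm: "smooth_on UNIV s"
    unfolding s_def by (rule smooth_on_linear[OF U bounded_linear_divide])
  have fl: "smooth_on UNIV (\<lambda>x. flat 0 (c + d * s x))" for c d
  proof (rule smooth_on_compose[where T=UNIV and f="flat 0", OF U U])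
    show "smooth_on UNIV (flat 0)" by (simp add: smooth_on_def Ck_on_flat)
    show "smooth_on UNIV (\<lambda>x. c + d * s x)"
      by (intro U smooth_on_add smooth_on_mult smooth_on_const sm)
  qed simp
  have pos: "flat 0 t > 0 \<longleftrightarrow> t > 0" "flat 0 t \<ge> 0" "flat 0 t = 0 \<longleftrightarrow> t \<le> 0" for t by (auto simp: flat_def)
  \<comment> \<open>\<open>s\<close> is the squared distance from \<open>a\<close> in units of
    \<open>r\<close>, hence smooth also at \<open>a\<close>. The numerator vanishes from
    \<open>s = 4\<close> on, that is outside the ball of radius \<open>2 * r\<close>; the other
    summand vanishes up to \<open>s = 1\<close>. They never vanish together. Both arguments have the
    shape \<open>c + d * s x\<close> required by \<open>fl\<close>.\<close>
  define f where "f x = flat 0 (4 + (-1) * s x) * inverse (flat 0 (4 + (-1) * s x) + flat 0 (-1 + 1 * s x))" for x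
  have nz: "flat 0 (4 + (-1) * s x) + flat 0 (-1 + 1 * s x) \<noteq> 0" for x
  proof (cases "s x < 4")
    case True
    then show ?thesis using pos(1)[of "4 + (-1) * s x"] pos(2)[of "-1 + 1 * s x"] by linarith
  next
    case False
    then show ?thesis using pos(2)[of "4 + (-1) * s x"] pos(1)[of "-1 + 1 * s x"] by linarith
  qed
  have "smooth_on UNIV (\<lambda>x. inverse (flat 0 (4 + (-1) * s x) + flat 0 (-1 + 1 * s x)))"
    using smooth_on_add[OF U fl fl] nz unfolding smooth_on_def by (intro allI Ck_on_inverse U) blast+
  then have "smooth_on UNIV f" unfolding f_def by (intro smooth_on_mult fl U)
  moreover have "f x = 1" if "x \<in> ball a r" for x
  proof -
    have "s x \<le> 1" unfolding s using that assms by (intro power_le_one) auto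
    then have "flat 0 (-1 + 1 * s x) = 0" by (simp add: flat_def)
    then show ?thesis using nz[of x] by (simp add: f_def)
  qed
  moreover have "f x = 0" if "x \<notin> ball a (2 * r)" for x
  proof -
    have "2 \<le> dist a x / r" using that assms by (simp add: field_simps)
    then have "2\<^sup>2 \<le> s x" unfolding s by (rule power_mono) simp
    then have "flat 0 (4 + (-1) * s x) = 0" by (simp add: flat_def)
    then show ?thesis by (simp add: f_def)
  qed
  ultimately show ?thesis by blast
qed

section \<open>Symmetry of second derivatives\<close>

lemma double_difference:
  fixes f :: "'a::finite_dim_inner \<Rightarrow> real"
  assumes S: "open S" "smooth_on S f" and h: "0 < h"
    and mem: "\<And>s t. 0 \<le> s \<Longrightarrow> s \<le> h \<Longrightarrow> 0 \<le> t \<Longrightarrow> t \<le> h \<Longrightarrow> x + s *\<^sub>R u + t *\<^sub>R v \<in> S"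
  shows "\<exists>s t. 0 \<le> s \<and> s \<le> h \<and> 0 \<le> t \<and> t \<le> h \<and>
    f (x + h *\<^sub>R u + h *\<^sub>R v) - f (x + h *\<^sub>R u) - f (x + h *\<^sub>R v) + f x =
      h * (h * FD (\<lambda>y. FD f y u) (x + s *\<^sub>R u + t *\<^sub>R v) v)"
proof -
  have line: "((\<lambda>s. F (a + s *\<^sub>R w)) has_real_derivative FD F (a + s *\<^sub>R w) w) (at s)"
    if "smooth_on S F" "a + s *\<^sub>R w \<in> S" for F :: "'a \<Rightarrow> real" and a w s
  proof -
    have D: "(F has_derivative FD F (a + s *\<^sub>R w)) (at (a + s *\<^sub>R w))"
      by (rule smooth_on_has_derivative_at[OF S(1) that])
    have "((\<lambda>s. a + s *\<^sub>R w) has_derivative (\<lambda>h. h *\<^sub>R w)) (at s)"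
      by (auto intro!: derivative_eq_intros)
    from has_derivative_compose[OF this D]
    have "((\<lambda>s. F (a + s *\<^sub>R w)) has_derivative (\<lambda>h. FD F (a + s *\<^sub>R w) (h *\<^sub>R w))) (at s)" .
    then show ?thesis
      unfolding has_field_derivative_def
      by (rule has_derivative_eq_rhs) (simp add: linear_scale[OF has_derivative_linear[OF D]] fun_eq_iff mult.commute)
  qed
  let ?F = "\<lambda>y. FD f y u"
  have F: "smooth_on S ?F"
    using smooth_on_Suc[OF S(2), of u] S(1)
    by (subst smooth_on_cong[where g="\<lambda>y. frechet_derivative f (at y within S) u"]) (auto simp: at_within_open_NO_MATCH)
  \<comment> \<open>The increment of \<open>?\<phi>\<close> is the second difference over the
    parallelogram with sides \<open>h u\<close> and \<open>h v\<close>. The mean value theorem is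
    applied along \<open>u\<close> here and then along \<open>v\<close>. Exchanging \<open>u\<close>
    and \<open>v\<close> does not change the second difference, but it exchanges the two mixed
    derivatives.\<close>
  let ?\<phi> = "\<lambda>s. f ((x + h *\<^sub>R v) + s *\<^sub>R u) - f (x + s *\<^sub>R u)"
  have "\<exists>s>0. s < h \<and> ?\<phi> h - ?\<phi> 0 = (h - 0) * (?F ((x + h *\<^sub>R v) + s *\<^sub>R u) - ?F (x + s *\<^sub>R u))"
  proof (rule MVT2[OF h])
    fix s assume s: "0 \<le> s" "s \<le> h"
    have "x + h *\<^sub>R v + s *\<^sub>R u \<in> S" "x + s *\<^sub>R u \<in> S"
      using mem[of s h] mem[of s 0] s h by (simp_all add: algebra_simps)
    then show "DERIV ?\<phi> s :> ?F ((x + h *\<^sub>R v) + s *\<^sub>R u) - ?F (x + s *\<^sub>R u)"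
      by (intro DERIV_diff line S(2))
  qed
  then obtain s where s: "0 < s" "s < h"
    and 1: "?\<phi> h - ?\<phi> 0 = h * (?F ((x + h *\<^sub>R v) + s *\<^sub>R u) - ?F (x + s *\<^sub>R u))" by auto
  have "\<exists>t>0. t < h \<and> ?F ((x + s *\<^sub>R u) + h *\<^sub>R v) - ?F ((x + s *\<^sub>R u) + 0 *\<^sub>R v)
      = (h - 0) * FD ?F ((x + s *\<^sub>R u) + t *\<^sub>R v) v"
  proof (rule MVT2[OF h])
    fix t assume "0 \<le> t" "t \<le> h"
    then have "x + s *\<^sub>R u + t *\<^sub>R v \<in> S" using mem s by simp
    then show "DERIV (\<lambda>t. ?F ((x + s *\<^sub>R u) + t *\<^sub>R v)) t :> FD ?F ((x + s *\<^sub>R u) + t *\<^sub>R v) v"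
      by (intro line F)
  qed
  then obtain t where t: "0 < t" "t < h"
    and 2: "?F ((x + s *\<^sub>R u) + h *\<^sub>R v) - ?F (x + s *\<^sub>R u)
      = h * FD ?F (x + s *\<^sub>R u + t *\<^sub>R v) v" by auto
  have "f (x + h *\<^sub>R u + h *\<^sub>R v) - f (x + h *\<^sub>R u) - f (x + h *\<^sub>R v) + f x = ?\<phi> h - ?\<phi> 0"
    by (simp add: algebra_simps)
  also have "\<dots> = h * (h * FD ?F (x + s *\<^sub>R u + t *\<^sub>R v) v)"
    unfolding 1 2[symmetric] by (simp add: algebra_simps)
  finally show ?thesis using s t by (intro exI[of _ s] exI[of _ t]) auto
qed

lemma second_derivative_symmetric:
  fixes f :: "'a::finite_dim_inner \<Rightarrow> real"
  assumes S: "open S" "smooth_on S f" and x: "x \<in> S"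
  shows "FD (\<lambda>y. FD f y u) x v =
    FD (\<lambda>y. FD f y v) x u"
proof -
  define G where "G u v y = FD (\<lambda>y. FD f y u) y v" for u v y
  have "smooth_on S (G u v)" for u v
    unfolding G_def
    by (intro smooth_on_deriv_apply[OF uniq_diff_open[OF S(1)] S(1)] smooth_on_const smooth_on_ident
        uniq_diff_open S) auto
  then have cont: "continuous_on S (G u v)" for u v by (rule smooth_on_continuous)
  show ?thesis
  proof (rule ccontr)
    assume "\<not> ?thesis"
    \<comment> \<open>Half the gap between the two mixed derivatives at \<open>x\<close>: a single
      number cannot be closer than this to both. The two intermediate points below produce such a
      number.\<close>
    then have "0 < dist (G u v x) (G v u x) / 2" (is "0 < ?e") by (simp add: G_def)
    have "\<exists>d>0. \<forall>y\<in>S. dist y x < d \<longrightarrow> dist (G a b y) (G a b x) < ?e" for a b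
      using cont[of a b] x \<open>0 < ?e\<close> unfolding continuous_on_iff by blast
    then obtain d1 d2 where d: "0 < d1" "0 < d2"
      "\<And>y. y \<in> S \<Longrightarrow> dist y x < d1 \<Longrightarrow> dist (G u v y) (G u v x) < ?e"
      "\<And>y. y \<in> S \<Longrightarrow> dist y x < d2 \<Longrightarrow> dist (G v u y) (G v u x) < ?e" by metis
    obtain d3 where d3: "0 < d3" "ball x d3 \<subseteq> S" using S(1) x open_contains_ball by blast
    define r where "r = min d3 (min d1 d2)"
    have r: "0 < r" using d d3 by (simp add: r_def)
    \<comment> \<open>Small enough to keep the whole parallelogram within distance \<open>r\<close>
      of \<open>x\<close>; the summand 1 keeps the denominator positive when \<open>u\<close> and
      \<open>v\<close> both vanish. The bound \<open>near\<close> is stated for \<open>a\<close>,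
      \<open>b\<close> so that it serves both orders of \<open>u\<close> and
      \<open>v\<close>.\<close>
    define h where "h = r / (2 * (norm u + norm v + 1))"
    have np: "0 < norm u + norm v + 1" by (smt (verit) norm_ge_zero)
    have h: "0 < h" using r np by (simp add: h_def)
    have near: "dist (x + s *\<^sub>R a + t *\<^sub>R b) x < r"
      if "0 \<le> s" "s \<le> h" "0 \<le> t" "t \<le> h" "norm a + norm b = norm u + norm v" for s t a b
    proof -
      have "dist (x + s *\<^sub>R a + t *\<^sub>R b) x \<le> norm (s *\<^sub>R a) + norm (t *\<^sub>R b)"
        using norm_triangle_ineq[of "s *\<^sub>R a" "t *\<^sub>R b"] by (simp add: dist_norm add.assoc)
      also have "\<dots> \<le> h * norm a + h * norm b"
        using that by (intro add_mono) (auto intro: mult_right_mono)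
      also have "\<dots> = h * (norm u + norm v)" using that(5) by (simp flip: distrib_left)
      also have "\<dots> < h * (2 * (norm u + norm v + 1))" using h np by (simp add: algebra_simps) (smt (verit) norm_ge_zero mult_nonneg_nonneg)
      also have "\<dots> = r" using np by (simp add: h_def)
      finally show ?thesis .
    qed
    have inS: "x + s *\<^sub>R a + t *\<^sub>R b \<in> S"
      if "0 \<le> s" "s \<le> h" "0 \<le> t" "t \<le> h" "norm a + norm b = norm u + norm v" for s t a b
      using near[OF that] d3 by (auto simp: r_def dist_commute)
    from double_difference[OF S h, of x u v] inS[of _ _ u v] obtain s t
      where st: "0 \<le> s" "s \<le> h" "0 \<le> t" "t \<le> h"
      and 1: "f (x + h *\<^sub>R u + h *\<^sub>R v) - f (x + h *\<^sub>R u) - f (x + h *\<^sub>R v) + f x =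
        h * (h * G u v (x + s *\<^sub>R u + t *\<^sub>R v))" unfolding G_def by blast
    from double_difference[OF S h, of x v u] inS[of _ _ v u] obtain s' t'
      where st': "0 \<le> s'" "s' \<le> h" "0 \<le> t'" "t' \<le> h"
      and 2: "f (x + h *\<^sub>R v + h *\<^sub>R u) - f (x + h *\<^sub>R v) - f (x + h *\<^sub>R u) + f x =
        h * (h * G v u (x + s' *\<^sub>R v + t' *\<^sub>R u))" unfolding G_def by (auto simp: add.commute)
    have "h * (h * G u v (x + s *\<^sub>R u + t *\<^sub>R v)) = h * (h * G v u (x + s' *\<^sub>R v + t' *\<^sub>R u))"
      using 1 2 by (simp add: algebra_simps)
    then have eq: "G u v (x + s *\<^sub>R u + t *\<^sub>R v) = G v u (x + s' *\<^sub>R v + t' *\<^sub>R u)" using h by simp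
    have "dist (G u v (x + s *\<^sub>R u + t *\<^sub>R v)) (G u v x) < ?e"
      using near[OF st, of u v] inS[OF st, of u v] by (intro d) (auto simp: r_def)
    moreover have "dist (G v u (x + s' *\<^sub>R v + t' *\<^sub>R u)) (G v u x) < ?e"
      using near[OF st', of v u] inS[OF st', of v u] by (intro d) (auto simp: r_def)
    ultimately show False unfolding eq dist_real_def by (auto simp: abs_if split: if_splits)
  qed
qed

lemma frechet_derivative_cong_open:
  assumes "open S" "x \<in> S" "\<And>y. y \<in> S \<Longrightarrow> f y = g y"
  shows "FD f x = FD g x"
proof -
  have "(f has_derivative D) (at x) \<longleftrightarrow> (g has_derivative D) (at x)" for D
    using has_derivative_transform_within_open[of f D x UNIV S g] has_derivative_transform_within_open[of g D x UNIV S f]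
      assms by auto
  then show ?thesis by (simp add: frechet_derivative_def)
qed

section \<open>Linear maps depending smoothly on a point\<close>

lemma smooth_on_linear_family:
  fixes G :: "'a::finite_dim_inner \<Rightarrow> 'k::finite_dim_inner \<Rightarrow> 'l::real_inner"
  assumes "uniq_diff T" "open S" "\<And>x. x \<in> S \<Longrightarrow> linear (G x)" "\<And>y. smooth_on S (\<lambda>x. G x y)"
    and "smooth_on T X" "smooth_on T Y" "X ` T \<subseteq> S"
  shows "smooth_on T (\<lambda>t. G (X t) (Y t))"
proof -
  have "smooth_on T (\<lambda>t. \<Sum>b\<in>onb. (Y t \<bullet> b) *\<^sub>R G (X t) b)"
    using assms(5,6,7)
    by (intro smooth_on_sum smooth_on_scaleR smooth_on_linear[OF _ bounded_linear_inner_left] assms(1)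
        smooth_on_compose[where f="\<lambda>x. G x _" and g=X, OF assms(1) uniq_diff_open[OF assms(2)] assms(4)])
  moreover have "G (X t) (Y t) = (\<Sum>b\<in>onb. (Y t \<bullet> b) *\<^sub>R G (X t) b)" if "t \<in> T" for t
    using that assms(3,7) by (intro linear_onb) auto
  ultimately show ?thesis by (subst smooth_on_cong) auto
qed

text \<open>Expansion in \<open>onb\<close> reduces joint differentiability to that of the finitely
  many functions \<open>\<lambda>x. G x b\<close>. The anchor, the structure functions, the
  transition functions and the differential of \<open>L\<close> are all families of this
  kind.\<close>

lemma linear_family_has_derivative:
  fixes G :: "'a::finite_dim_inner \<Rightarrow> 'k::finite_dim_inner \<Rightarrow> 'l::real_inner"
  assumes S: "open S" "x \<in> S" and lin: "\<And>x. x \<in> S \<Longrightarrow> linear (G x)" and sm: "\<And>y. smooth_on S (\<lambda>x. G x y)"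
  shows "((\<lambda>z. G (fst z) (snd z)) has_derivative
    (\<lambda>w. FD (\<lambda>x. G x y) x (fst w) + G x (snd w))) (at (x, y))"
proof -
  let ?D = "\<lambda>b. FD (\<lambda>x. G x b) x"
  have D: "((\<lambda>x. G x b) has_derivative ?D b) (at x)" for b
    by (rule smooth_on_has_derivative_at[OF S(1) sm S(2)])
  have D': "((\<lambda>z. G (fst z) b) has_derivative (\<lambda>w. ?D b (fst w))) (at (x, y))" for b
    by (rule has_derivative_compose[OF has_derivative_fst[OF has_derivative_ident]]) (simp add: D)
  have 1: "((\<lambda>z. \<Sum>b\<in>onb. (snd z \<bullet> b) *\<^sub>R G (fst z) b) has_derivative
      (\<lambda>w. \<Sum>b\<in>onb. (snd (x, y) \<bullet> b) *\<^sub>R ?D b (fst w) + (snd w \<bullet> b) *\<^sub>R G (fst (x, y)) b)) (at (x, y))"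
    by (intro has_derivative_sum has_derivative_scaleR D' has_derivative_inner_left has_derivative_snd has_derivative_ident)
  \<comment> \<open>The derivative in \<open>x\<close> inherits the linearity in \<open>y\<close>,
    which recombines the sum over \<open>onb\<close> into one term.\<close>
  have 2: "?D y = (\<lambda>u. \<Sum>b\<in>onb. (y \<bullet> b) *\<^sub>R ?D b u)"
  proof (rule frechet_derivative_at[symmetric], rule has_derivative_transform_within_open[OF _ S])
    show "((\<lambda>x. \<Sum>b\<in>onb. (y \<bullet> b) *\<^sub>R G x b) has_derivative (\<lambda>u. \<Sum>b\<in>onb. (y \<bullet> b) *\<^sub>R ?D b u)) (at x)"
      by (intro has_derivative_sum has_derivative_scaleR_right D)
  qed (rule linear_onb[OF lin, symmetric])
  have "((\<lambda>z. G (fst z) (snd z)) has_derivative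
      (\<lambda>w. \<Sum>b\<in>onb. (snd (x, y) \<bullet> b) *\<^sub>R ?D b (fst w) + (snd w \<bullet> b) *\<^sub>R G (fst (x, y)) b)) (at (x, y))"
    by (rule has_derivative_transform_within_open[OF 1 open_Times[OF S(1) open_UNIV]])
      (use S in \<open>auto intro!: linear_onb[OF lin, symmetric]\<close>)
  moreover have "(\<Sum>b\<in>onb. (snd (x, y) \<bullet> b) *\<^sub>R ?D b (fst w) + (snd w \<bullet> b) *\<^sub>R G (fst (x, y)) b) =
      ?D y (fst w) + G x (snd w)" for w
    unfolding 2 sum.distrib by (simp add: linear_onb[OF lin[OF S(2)], of "snd w", symmetric])
  ultimately show ?thesis by (rule has_derivative_eq_rhs[OF _ ext])
qed

lemma smooth_on_deriv_const:
  fixes f :: "'a::finite_dim_inner \<Rightarrow> 'c::real_inner"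
  assumes "open S" "smooth_on S f"
  shows "smooth_on S (\<lambda>z. FD f z v)"
  by (rule smooth_on_deriv_apply[OF uniq_diff_open[OF assms(1)] assms(1,2)])
    (auto intro!: smooth_on_const smooth_on_ident uniq_diff_open assms)


section \<open>Atlases, tangent vectors and bump functions\<close>

text \<open>\<open>smooth_manifold\<close> without its two topological conditions. In this form the
  total spaces of bundles are instances as well, and results on tangent vectors apply to them; the
  Hausdorff property is an explicit assumption where bump functions are built.\<close>

locale atlas =
  fixes M :: "('i, 'a, 'm::finite_dim_inner) manifold"
  assumes pts_eq: "pts M = (\<Union>i\<in>idx M. chart_dom M i)"
    and chart_inj: "i \<in> idx M \<Longrightarrow> inj_on (chart M i) (chart_dom M i)"
    and open_overlap: "i \<in> idx M \<Longrightarrow> j \<in> idx M \<Longrightarrow> open (chart M i ` (chart_dom M i \<inter> chart_dom M j))"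
    and smooth_transition: "i \<in> idx M \<Longrightarrow> j \<in> idx M \<Longrightarrow>
      smooth_on (chart M i ` (chart_dom M i \<inter> chart_dom M j)) (\<lambda>x. chart M j (chart_inv M i x))"
begin

abbreviation img :: "'i \<Rightarrow> 'm set" where
  "img i \<equiv> chart M i ` chart_dom M i"

lemma dom_pts: "i \<in> idx M \<Longrightarrow> p \<in> chart_dom M i \<Longrightarrow> p \<in> pts M"
  by (auto simp: pts_eq)

lemma chart_at_mem:
  assumes "p \<in> pts M" shows "chart_at M p \<in> idx M" "p \<in> chart_dom M (chart_at M p)"
proof -
  have "\<exists>i. i \<in> idx M \<and> p \<in> chart_dom M i" using assms by (auto simp: pts_eq)
  from someI_ex[OF this] show "chart_at M p \<in> idx M" "p \<in> chart_dom M (chart_at M p)"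
    by (auto simp: chart_at_def)
qed

lemma chart_inv_chart: "i \<in> idx M \<Longrightarrow> p \<in> chart_dom M i \<Longrightarrow> chart_inv M i (chart M i p) = p"
  unfolding chart_inv_def by (rule inv_into_f_f[OF chart_inj])

lemma chart_inv_mem: "x \<in> img i \<Longrightarrow> chart_inv M i x \<in> chart_dom M i"
  unfolding chart_inv_def by (rule inv_into_into)

lemma chart_chart_inv: "x \<in> img i \<Longrightarrow> chart M i (chart_inv M i x) = x"
  unfolding chart_inv_def by (rule f_inv_into_f)

lemma open_img: "i \<in> idx M \<Longrightarrow> open (img i)"
  using open_overlap[of i i] by simp

lemma overlap_eq:
  assumes "i \<in> idx M"
  shows "chart M i ` (chart_dom M i \<inter> A) = {x \<in> img i. chart_inv M i x \<in> A}"
  using assms by (auto simp: chart_inv_chart chart_chart_inv intro!: image_eqI[where f="chart M i"])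

lemma transition_has_derivative:
  assumes "i \<in> idx M" "j \<in> idx M" "p \<in> chart_dom M i" "p \<in> chart_dom M j"
  shows "((\<lambda>x. chart M j (chart_inv M i x)) has_derivative
     FD (\<lambda>x. chart M j (chart_inv M i x)) (chart M i p)) (at (chart M i p))"
  by (rule smooth_on_has_derivative_at[OF open_overlap smooth_transition]) (use assms in auto)

lemma has_derivative_change_chart:
  assumes "i \<in> idx M" "k \<in> idx M" "p \<in> chart_dom M i" "p \<in> chart_dom M k"
    and D: "((\<lambda>x. h (chart_inv M i x)) has_derivative D) (at (chart M i p))"
  shows "((\<lambda>x. h (chart_inv M k x)) has_derivative
    (\<lambda>v. D (FD (\<lambda>x. chart M i (chart_inv M k x)) (chart M k p) v))) (at (chart M k p))"
proof (rule has_derivative_transform_within_open)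
  show "((\<lambda>x. h (chart_inv M i (chart M i (chart_inv M k x)))) has_derivative
    (\<lambda>v. D (FD (\<lambda>x. chart M i (chart_inv M k x)) (chart M k p) v))) (at (chart M k p))"
    by (rule has_derivative_compose[OF transition_has_derivative[OF assms(2,1,4,3)]])
      (use D assms in \<open>simp add: chart_inv_chart\<close>)
  show "open (chart M k ` (chart_dom M k \<inter> chart_dom M i))" using assms by (intro open_overlap)
  show "chart M k p \<in> chart M k ` (chart_dom M k \<inter> chart_dom M i)" using assms by auto
qed (use assms in \<open>auto simp: chart_inv_chart\<close>)

lemma smooth_change_chart:
  fixes h :: "'a \<Rightarrow> 'b::real_inner"
  assumes "i \<in> idx M" "k \<in> idx M" and h: "smooth_on (img i) (\<lambda>x. h (chart_inv M i x))"
  shows "smooth_on (chart M k ` (chart_dom M k \<inter> chart_dom M i)) (\<lambda>x. h (chart_inv M k x))"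
proof -
  have "smooth_on (chart M k ` (chart_dom M k \<inter> chart_dom M i))
      (\<lambda>x. h (chart_inv M i (chart M i (chart_inv M k x))))"
    by (rule smooth_on_compose[OF uniq_diff_open uniq_diff_open h])
      (use assms in \<open>auto simp: chart_inv_chart open_img open_overlap smooth_transition\<close>)
  then show ?thesis
    by (subst smooth_on_cong) (use assms in \<open>auto simp: chart_inv_chart\<close>)
qed

section \<open>Tangent vectors and tangent maps in coordinates\<close>

lemma mem_tangent_bundle:
  "w \<in> tot (tangent_bundle M) \<longleftrightarrow> fst w \<in> pts M \<and>
    (\<forall>i\<in>idx M. \<forall>j\<in>idx M. fst w \<in> chart_dom M i \<inter> chart_dom M j \<longrightarrow>
      snd w j = FD (\<lambda>x. chart M j (chart_inv M i x)) (chart M i (fst w)) (snd w i)) \<and>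
    (\<forall>i. \<not> (i \<in> idx M \<and> fst w \<in> chart_dom M i) \<longrightarrow> snd w i = 0)"
  unfolding tangent_bundle_def by (simp only: vbundle.simps mem_Collect_eq case_prod_unfold)

lemma tangent_fst: "w \<in> tot (tangent_bundle M) \<Longrightarrow> fst w \<in> pts M"
  unfolding mem_tangent_bundle by (elim conjE)

lemma tangent_transition:
  assumes "w \<in> tot (tangent_bundle M)" "i \<in> idx M" "j \<in> idx M" "fst w \<in> chart_dom M i" "fst w \<in> chart_dom M j"
  shows "snd w j = FD (\<lambda>x. chart M j (chart_inv M i x)) (chart M i (fst w)) (snd w i)"
  using assms unfolding mem_tangent_bundle by blast

lemma tangent_zero:
  assumes "w \<in> tot (tangent_bundle M)" "\<not> (i \<in> idx M \<and> fst w \<in> chart_dom M i)"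
  shows "snd w i = 0"
  using assms unfolding mem_tangent_bundle by blast

text \<open>The other components are forced: by the transition law for charts around the base point
  and by the default 0 for the remaining indices.\<close>

lemma tangent_eqI:
  assumes w: "w \<in> tot (tangent_bundle M)" "w' \<in> tot (tangent_bundle M)" and "fst w = fst w'"
    and i: "i \<in> idx M" "fst w \<in> chart_dom M i" "snd w i = snd w' i"
  shows "w = w'"
proof -
  have "snd w j = snd w' j" for j
  proof (cases "j \<in> idx M \<and> fst w \<in> chart_dom M j")
    case True
    then show ?thesis
      using tangent_transition[OF w(1), of i j] tangent_transition[OF w(2), of i j] i assms(3) by metis
  next
    case False
    then show ?thesis using tangent_zero[OF w(1), of j] tangent_zero[OF w(2), of j] assms(3) by metis
  qed
  then show ?thesis using assms(3) by (simp add: prod_eq_iff fun_eq_iff)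
qed

text \<open>\<open>tangent_map\<close> and \<open>dT_fun\<close> are defined through the arbitrary
  chart \<open>chart_at\<close>. Because \<open>w\<close> obeys the transition law, the chain rule
  lets them be computed in whichever chart is convenient.\<close>

lemma tangent_derivative_indep:
  fixes h :: "'a \<Rightarrow> 'b::real_inner"
  assumes w: "w \<in> tot (tangent_bundle M)"
    and i: "i \<in> idx M" "fst w \<in> chart_dom M i" and k: "k \<in> idx M" "fst w \<in> chart_dom M k"
    and D: "((\<lambda>x. h (chart_inv M i x)) has_derivative D) (at (chart M i (fst w)))"
  shows "FD (\<lambda>x. h (chart_inv M k x)) (chart M k (fst w)) (snd w k) = D (snd w i)"
proof -
  have "FD (\<lambda>x. h (chart_inv M k x)) (chart M k (fst w)) =
    (\<lambda>v. D (FD (\<lambda>x. chart M i (chart_inv M k x)) (chart M k (fst w)) v))"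
    by (rule frechet_derivative_at[symmetric, OF has_derivative_change_chart[OF i(1) k(1) i(2) k(2) D]])
  then show ?thesis using tangent_transition[OF w k(1) i(1) k(2) i(2)] by simp
qed

lemma tangent_vector_exists:
  assumes "i \<in> idx M" "p \<in> chart_dom M i"
  shows "\<exists>w\<in>tot (tangent_bundle M). fst w = p \<and> snd w i = v"
proof -
  let ?D = "\<lambda>i j. FD (\<lambda>x. chart M j (chart_inv M i x)) (chart M i p)"
  define w where "w j = (if j \<in> idx M \<and> p \<in> chart_dom M j then ?D i j v else 0)" for j
  \<comment> \<open>The cocycle law, that is the chain rule for transition maps, makes the family
    spread from chart \<open>i\<close> consistent.\<close>
  have coc: "?D j k (?D i j v) = ?D i k v"
    if "j \<in> idx M" "k \<in> idx M" "p \<in> chart_dom M j" "p \<in> chart_dom M k" for j k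
    by (rule fun_cong[OF frechet_derivative_at[OF has_derivative_change_chart[OF that(1) assms(1) that(3) assms(2)
          transition_has_derivative[OF that]]], of v])
  have "((\<lambda>x. chart M i (chart_inv M i x)) has_derivative (\<lambda>v. v)) (at (chart M i p))"
    by (rule has_derivative_transform_within_open[OF has_derivative_ident open_img[of i]])
      (use assms in \<open>auto simp: chart_inv_chart\<close>)
  from frechet_derivative_at[OF this] have wi: "w i = v"
    unfolding w_def using assms by (metis (no_types, lifting))
  have "(p, w) \<in> tot (tangent_bundle M)"
    unfolding mem_tangent_bundle fst_conv snd_conv
    using dom_pts[OF assms] by (intro conjI ballI allI impI) (auto simp: w_def coc)
  then show ?thesis using wi by force
qed

lemma tangent_map_eq:
  fixes N :: "('j, 'b, 'n::finite_dim_inner) manifold"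
  assumes w: "w \<in> tot (tangent_bundle M)" and i: "i \<in> idx M" "fst w \<in> chart_dom M i"
    and j: "j \<in> idx N" "F (fst w) \<in> chart_dom N j"
    and D: "((\<lambda>x. chart N j (F (chart_inv M i x))) has_derivative D) (at (chart M i (fst w)))"
  shows "snd (tangent_map M N F w) j = D (snd w i)"
proof -
  have "snd (tangent_map M N F w) j = FD (\<lambda>x. chart N j (F (chart_inv M (chart_at M (fst w)) x))) (chart M (chart_at M (fst w)) (fst w)) (snd w (chart_at M (fst w)))"
    using j by (simp add: tangent_map_def case_prod_unfold Let_def)
  also have "\<dots> = D (snd w i)"
    by (rule tangent_derivative_indep[OF w i chart_at_mem[OF tangent_fst[OF w]] D])
  finally show ?thesis .
qed

lemma fst_tangent_map [simp]: "fst (tangent_map M N F w) = F (fst w)"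
  by (simp add: tangent_map_def case_prod_unfold Let_def)

lemma dT_fun_eq:
  assumes w: "w \<in> tot (tangent_bundle M)" and i: "i \<in> idx M" "fst w \<in> chart_dom M i"
    and D: "((\<lambda>x. f (chart_inv M i x)) has_derivative D) (at (chart M i (fst w)))"
  shows "dT_fun M f w = D (snd w i)"
  using tangent_derivative_indep[OF w i chart_at_mem[OF tangent_fst[OF w]], of f D] D
  by (simp add: dT_fun_def case_prod_unfold Let_def)

section \<open>The topology of a manifold and its bump functions\<close>

lemma topspace_manifold_topology: "topspace (manifold_topology M) = pts M"
proof -
  have "\<Union> {chart_dom M i \<inter> chart M i -` W | i W. i \<in> idx M \<and> open W} = (\<Union>i\<in>idx M. chart_dom M i)"
  proof (intro equalityI subsetI)
    fix x assume "x \<in> (\<Union>i\<in>idx M. chart_dom M i)"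
    then obtain i where "i \<in> idx M" "x \<in> chart_dom M i \<inter> chart M i -` UNIV" by auto
    then show "x \<in> \<Union> {chart_dom M i \<inter> chart M i -` W | i W. i \<in> idx M \<and> open W}"
      using open_UNIV by blast
  qed blast
  then show ?thesis unfolding manifold_topology_def topology_generated_by_topspace pts_eq .
qed

lemma openin_chart_preimage:
  "i \<in> idx M \<Longrightarrow> open W \<Longrightarrow> openin (manifold_topology M) (chart_dom M i \<inter> chart M i -` W)"
  unfolding manifold_topology_def by (rule topology_generated_by_Basis) blast

lemma openin_chart_dom: "i \<in> idx M \<Longrightarrow> openin (manifold_topology M) (chart_dom M i)"
  using openin_chart_preimage[of i UNIV] by simp

text \<open>It suffices to test generating sets of the topology; pulled back to chart
  \<open>i\<close>, such a set is an open preimage under a transition map.\<close>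

lemma continuous_map_chart_inv:
  assumes i: "i \<in> idx M"
  shows "continuous_map (top_of_set (img i)) (manifold_topology M) (chart_inv M i)"
  unfolding manifold_topology_def
proof (rule continuous_on_generated_topo)
  fix U assume "U \<in> {chart_dom M j \<inter> chart M j -` W | j W. j \<in> idx M \<and> open W}"
  then obtain j W where U: "U = chart_dom M j \<inter> chart M j -` W" and j: "j \<in> idx M" and W: "open W" by blast
  let ?O = "chart M i ` (chart_dom M i \<inter> chart_dom M j)"
  have "open (?O \<inter> (\<lambda>x. chart M j (chart_inv M i x)) -` W)"
    by (rule continuous_open_preimage[OF smooth_on_continuous[OF smooth_transition[OF i j]] open_overlap[OF i j] W])
  moreover have "chart_inv M i -` U \<inter> topspace (top_of_set (img i)) = ?O \<inter> (\<lambda>x. chart M j (chart_inv M i x)) -` W"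
    unfolding overlap_eq[OF i] U by auto
  ultimately show "openin (top_of_set (img i)) (chart_inv M i -` U \<inter> topspace (top_of_set (img i)))"
    by (metis open_openin_trans[OF open_img[OF i]] inf_le2 topspace_euclidean_subtopology)
next
  show "chart_inv M i ` topspace (top_of_set (img i)) \<subseteq> \<Union> {chart_dom M j \<inter> chart M j -` W | j W. j \<in> idx M \<and> open W}"
    unfolding topology_generated_by_topspace[symmetric] manifold_topology_def[symmetric]
      topspace_manifold_topology
    using dom_pts[OF i chart_inv_mem] by auto
qed

lemma open_in_chart:
  assumes "i \<in> idx M" "openin (manifold_topology M) U"
  shows "open {x \<in> img i. chart_inv M i x \<in> U}"
proof -
  have "openin (top_of_set (img i)) {x \<in> topspace (top_of_set (img i)). chart_inv M i x \<in> U}"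
    using openin_continuous_map_preimage[OF continuous_map_chart_inv assms(2)] assms(1) by blast
  then show ?thesis using openin_open_trans open_img[OF assms(1)] by fastforce
qed

text \<open>For objects cut off by a bump function and extended by zero: \<open>U\<close> is then
  the chart domain and \<open>U'\<close> the complement of the closed set outside which the bump
  function vanishes.\<close>

lemma smooth_on_patch:
  fixes h :: "'m \<Rightarrow> 'b::real_inner"
  assumes j: "j \<in> idx M"
    and U: "openin (manifold_topology M) U" "openin (manifold_topology M) U'" "pts M \<subseteq> U \<union> U'"
    and "smooth_on {x \<in> img j. chart_inv M j x \<in> U} h" "smooth_on {x \<in> img j. chart_inv M j x \<in> U'} h"
  shows "smooth_on (img j) h"
proof (rule smooth_on_local)
  fix x assume x: "x \<in> img j"
  then have "chart_inv M j x \<in> U \<or> chart_inv M j x \<in> U'"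
    using U(3) dom_pts[OF j chart_inv_mem[OF x]] by auto
  moreover have "img j \<inter> {x \<in> img j. chart_inv M j x \<in> A} = {x \<in> img j. chart_inv M j x \<in> A}" for A by auto
  ultimately show "\<exists>T. open T \<and> x \<in> T \<and> smooth_on (img j \<inter> T) h"
    using x assms(5,6) open_in_chart[OF j U(1)] open_in_chart[OF j U(2)] by (metis (mono_tags, lifting) mem_Collect_eq)
qed

text \<open>Here the Hausdorff property enters: it makes the chart preimage of a compact ball closed.\<close>

lemma manifold_bump_exists:
  assumes "Hausdorff_space (manifold_topology M)" "openin (manifold_topology M) U" "p \<in> U"
  shows "\<exists>f K W. smooth_fun M f \<and> closedin (manifold_topology M) K \<and> K \<subseteq> U \<and> (\<forall>q\<in>pts M - K. f q = 0)
    \<and> openin (manifold_topology M) W \<and> p \<in> W \<and> W \<subseteq> K \<and> (\<forall>q\<in>W. f q = 1)"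
proof -
  have "p \<in> pts M" using assms openin_subset topspace_manifold_topology by blast
  then obtain i where i: "i \<in> idx M" "p \<in> chart_dom M i" by (auto simp: pts_eq)
  let ?O = "{x \<in> img i. chart_inv M i x \<in> U}"
  have "open ?O" "chart M i p \<in> ?O" using i assms by (auto simp: open_in_chart chart_inv_chart)
  then obtain e where e: "0 < e" "ball (chart M i p) e \<subseteq> ?O" using open_contains_ball by blast
  \<comment> \<open>The bump function vanishes outside the ball of radius \<open>2 * r\<close>,
    whose closure must still fit into the ball of radius \<open>e\<close>.\<close>
  define r where "r = e / 3"
  have r: "0 < r" "2 * r < e" using e by (auto simp: r_def)
  let ?B = "cball (chart M i p) (2 * r)"
  have B: "?B \<subseteq> ?O" using e r by (auto intro!: subsetD[OF e(2)])
  obtain g :: "'m \<Rightarrow> real" where g: "smooth_on UNIV g" "\<And>x. x \<in> ball (chart M i p) r \<Longrightarrow> g x = 1"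
    "\<And>x. x \<notin> ball (chart M i p) (2 * r) \<Longrightarrow> g x = 0" using bump_exists[OF r(1)] by blast
  define K where "K = chart_inv M i ` ?B"
  define f where "f q = (if q \<in> chart_dom M i then g (chart M i q) else 0)" for q
  have K: "closedin (manifold_topology M) K"
    unfolding K_def
    by (rule compactin_imp_closedin[OF assms(1) image_compactin[OF _ continuous_map_chart_inv[OF i(1)]]])
      (use B in \<open>auto simp: compactin_subtopology compact_cball_fdi\<close>)
  have K0: "f q = 0" if "q \<notin> K" for q
  proof (cases "q \<in> chart_dom M i")
    case True
    then have "chart M i q \<notin> ?B" using that i(1) by (force simp: K_def image_iff chart_inv_chart)
    then have "chart M i q \<notin> ball (chart M i p) (2 * r)" by auto
    then show ?thesis using g(3) by (simp add: f_def)
  qed (simp add: f_def)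
  have "smooth_on (img j) (\<lambda>x. f (chart_inv M j x))" if j: "j \<in> idx M" for j
  proof (rule smooth_on_patch[OF j openin_chart_dom[OF i(1)] openin_diff[OF openin_topspace K]])
    have "K \<subseteq> chart_dom M i" using B chart_inv_mem by (auto simp: K_def)
    then show "pts M \<subseteq> chart_dom M i \<union> (topspace (manifold_topology M) - K)"
      by (auto simp: topspace_manifold_topology)
    have "smooth_on (img i) (\<lambda>x. f (chart_inv M i x))"
      using smooth_on_open_subset[OF open_img[OF i(1)] _ g(1)]
      by (subst smooth_on_cong[where g=g]) (auto simp: f_def chart_inv_chart i)
    from smooth_change_chart[OF i(1) j this]
    show "smooth_on {x \<in> img j. chart_inv M j x \<in> chart_dom M i} (\<lambda>x. f (chart_inv M j x))"
      by (simp add: overlap_eq[OF j])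
    show "smooth_on {x \<in> img j. chart_inv M j x \<in> topspace (manifold_topology M) - K} (\<lambda>x. f (chart_inv M j x))"
      using K0 open_in_chart[OF j openin_diff[OF openin_topspace K]]
      by (subst smooth_on_cong[where g="\<lambda>_. 0"]) (auto intro: smooth_on_const uniq_diff_open)
  qed
  then have "smooth_fun M f" by (simp add: smooth_fun_def)
  moreover have "K \<subseteq> U" using B by (auto simp: K_def)
  moreover have "openin (manifold_topology M) (chart_dom M i \<inter> chart M i -` ball (chart M i p) r)"
    by (rule openin_chart_preimage[OF i(1)]) simp
  moreover have "p \<in> chart_dom M i \<inter> chart M i -` ball (chart M i p) r" using i r by simp
  moreover have "chart_dom M i \<inter> chart M i -` ball (chart M i p) r \<subseteq> K"
  proof
    fix q assume q: "q \<in> chart_dom M i \<inter> chart M i -` ball (chart M i p) r"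
    then have "chart M i q \<in> ?B" using r by auto
    then show "q \<in> K" unfolding K_def
      by (rule rev_image_eqI) (use q i in \<open>simp add: chart_inv_chart\<close>)
  qed
  moreover have "\<forall>q\<in>chart_dom M i \<inter> chart M i -` ball (chart M i p) r. f q = 1"
    using g(2) by (simp add: f_def)
  ultimately show ?thesis using K K0 by blast
qed

end

text \<open>\<open>vadd\<close> adds coordinates in the single chart \<open>chart_at\<close>;
  linearity of the derivatives of transition maps carries the sum to every chart. This is the
  addition used in \<open>vertical_section\<close>.\<close>

lemma (in atlas) vadd_tangent:
  assumes w: "w \<in> tot (tangent_bundle M)" "w' \<in> tot (tangent_bundle M)" and eq: "fst w' = fst w"
  shows "vadd (tangent_bundle M) w w' \<in> tot (tangent_bundle M)"
    and "fst (vadd (tangent_bundle M) w w') = fst w"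
    and "i \<in> idx M \<Longrightarrow> fst w \<in> chart_dom M i \<Longrightarrow>
      snd (vadd (tangent_bundle M) w w') i = snd w i + snd w' i"
proof -
  define i0 where "i0 = chart_at M (fst w)"
  have i0: "i0 \<in> idx M" "fst w \<in> chart_dom M i0"
    using chart_at_mem[OF tangent_fst[OF w(1)]] by (auto simp: i0_def)
  let ?s = "snd w i0 + snd w' i0"
  let ?v = "vadd (tangent_bundle M) w w'"
  have v: "?v = inv_into (fibre (tangent_bundle M) (fst w)) (\<lambda>u. snd u i0) ?s"
    by (simp add: vadd_def from_triv_def tangent_bundle_def case_prod_unfold i0_def Let_def)
  obtain u where u: "u \<in> tot (tangent_bundle M)" "fst u = fst w" "snd u i0 = ?s"
    using tangent_vector_exists[OF i0] by blast
  have fib: "fibre (tangent_bundle M) p = {u \<in> tot (tangent_bundle M). fst u = p}" for p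
    by (auto simp: fibre_def tangent_bundle_def)
  have "?s \<in> (\<lambda>u. snd u i0) ` fibre (tangent_bundle M) (fst w)"
    using u by (auto simp: fib intro!: image_eqI[where x=u])
  from inv_into_into[OF this] f_inv_into_f[OF this]
  have m: "?v \<in> tot (tangent_bundle M)" "fst ?v = fst w" "snd ?v i0 = ?s"
    unfolding v by (auto simp: fib)
  then show "?v \<in> tot (tangent_bundle M)" "fst ?v = fst w" by auto
  assume i: "i \<in> idx M" "fst w \<in> chart_dom M i"
  have l: "linear (FD (\<lambda>x. chart M i (chart_inv M i0 x)) (chart M i0 (fst w)))"
    by (rule has_derivative_linear[OF transition_has_derivative[OF i0(1) i(1) i0(2) i(2)]])
  show "snd ?v i = snd w i + snd w' i"
    using tangent_transition[OF w(1) i0(1) i(1) i0(2) i(2)] tangent_transition[OF w(2) i0(1) i(1)]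
      tangent_transition[OF m(1) i0(1) i(1)] i0 i m(2,3) eq linear_add[OF l] by simp
qed


section \<open>Vector bundles\<close>

lemma total_space_simps [simp]:
  "pts (total_space V) = tot V" "idx (total_space V) = idx (base V)"
  "chart_dom (total_space V) i = {e \<in> tot V. proj V e \<in> chart_dom (base V) i}"
  "chart (total_space V) i e = (chart (base V) i (proj V e), triv V i e)"
  by (simp_all add: total_space_def)

lemma dual_bundle_simps [simp]:
  "base (dual_bundle V) = base V" "proj (dual_bundle V) = fst"
  by (simp_all add: dual_bundle_def)

lemma tangent_bundle_simps [simp]:
  "base (tangent_bundle M) = M" "proj (tangent_bundle M) = fst" "triv (tangent_bundle M) i w = snd w i"
  by (simp_all add: tangent_bundle_def case_prod_unfold)

lemma smooth_manifold_atlas: "smooth_manifold M \<Longrightarrow> atlas M"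
  unfolding smooth_manifold_def atlas_def by blast

locale vbun =
  fixes V :: "('i, 'a, 'm::finite_dim_inner, 'e, 'k::finite_dim_inner) vbundle"
  assumes vb: "vector_bundle V"
begin

abbreviation dom :: "'i \<Rightarrow> 'a set" where "dom \<equiv> chart_dom (base V)"
abbreviation ind :: "'i set" where "ind \<equiv> idx (base V)"
abbreviation phi :: "'i \<Rightarrow> 'a \<Rightarrow> 'm" where "phi \<equiv> chart (base V)"
abbreviation psi :: "'i \<Rightarrow> 'm \<Rightarrow> 'a" where "psi \<equiv> chart_inv (base V)"

sublocale B: atlas "base V"
  using vb smooth_manifold_atlas by (auto simp: vector_bundle_def)

lemma hausdorff: "Hausdorff_space (manifold_topology (base V))"
  using vb by (simp add: vector_bundle_def smooth_manifold_def)

lemma proj_pts: "e \<in> tot V \<Longrightarrow> proj V e \<in> pts (base V)"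
  using vb by (auto simp: vector_bundle_def)

lemma triv_bij: "i \<in> ind \<Longrightarrow> p \<in> dom i \<Longrightarrow> bij_betw (triv V i) (fibre V p) UNIV"
  using vb by (simp add: vector_bundle_def)

lemma from_triv_fibre:
  assumes "i \<in> ind" "p \<in> dom i" shows "from_triv V i p y \<in> fibre V p"
  using triv_bij[OF assms] unfolding from_triv_def bij_betw_def by (intro inv_into_into) auto

lemma from_triv [simp]:
  assumes "i \<in> ind" "p \<in> dom i"
  shows "from_triv V i p y \<in> tot V" "proj V (from_triv V i p y) = p" "triv V i (from_triv V i p y) = y"
proof -
  show "from_triv V i p y \<in> tot V" "proj V (from_triv V i p y) = p"
    using from_triv_fibre[OF assms] by (auto simp: fibre_def)
  show "triv V i (from_triv V i p y) = y"
    using triv_bij[OF assms] unfolding from_triv_def bij_betw_def by (intro f_inv_into_f) auto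
qed

lemma from_triv_triv:
  assumes "i \<in> ind" "e \<in> tot V" "proj V e \<in> dom i"
  shows "from_triv V i (proj V e) (triv V i e) = e"
  unfolding from_triv_def
  by (rule inv_into_f_f) (use triv_bij[OF assms(1,3)] assms in \<open>auto simp: bij_betw_def fibre_def\<close>)

lemma bundle_eqI:
  assumes "i \<in> ind" "e \<in> tot V" "e' \<in> tot V" "proj V e \<in> dom i" "proj V e' = proj V e" "triv V i e = triv V i e'"
  shows "e = e'"
proof -
  have "proj V e' \<in> dom i" using assms(4,5) by simp
  from from_triv_triv[OF assms(1,2,4)] from_triv_triv[OF assms(1,3) this]
  show ?thesis unfolding assms(5,6) by (rule trans[OF sym])
qed

lemma transition_linear:
  "i \<in> ind \<Longrightarrow> j \<in> ind \<Longrightarrow> p \<in> dom i \<Longrightarrow> p \<in> dom j \<Longrightarrow> linear (\<lambda>y. triv V j (from_triv V i p y))"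
  using vb by (simp add: vector_bundle_def)

lemma transition_smooth:
  "i \<in> ind \<Longrightarrow> j \<in> ind \<Longrightarrow> smooth_on (phi i ` (dom i \<inter> dom j)) (\<lambda>x. triv V j (from_triv V i (psi i x) y))"
  using vb by (simp add: vector_bundle_def)

lemma triv_transition:
  assumes "i \<in> ind" "e \<in> tot V" "proj V e \<in> dom i"
  shows "triv V j e = triv V j (from_triv V i (proj V e) (triv V i e))"
  by (simp add: from_triv_triv[OF assms])

lemma transition_smooth_family:
  fixes X :: "'t::real_normed_vector \<Rightarrow> 'm"
  assumes "i \<in> ind" "j \<in> ind" "uniq_diff T" "smooth_on T X" "smooth_on T Y" "X ` T \<subseteq> phi i ` (dom i \<inter> dom j)"
  shows "smooth_on T (\<lambda>t. triv V j (from_triv V i (psi i (X t)) (Y t)))"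
  by (rule smooth_on_linear_family[where G="\<lambda>x y. triv V j (from_triv V i (psi i x) y)",
        OF assms(3) B.open_overlap[OF assms(1,2)] _ transition_smooth[OF assms(1,2)] assms(4-6)])
    (use assms in \<open>auto simp: B.chart_inv_chart intro!: transition_linear\<close>)

lemma total_dom_img:
  assumes "i \<in> ind"
  shows "chart (total_space V) i ` {e \<in> tot V. proj V e \<in> dom i \<inter> A} = phi i ` (dom i \<inter> A) \<times> (UNIV :: 'k set)"
proof (intro equalityI subsetI)
  fix z assume "z \<in> phi i ` (dom i \<inter> A) \<times> (UNIV :: 'k set)"
  then obtain p y where p: "p \<in> dom i" "p \<in> A" and z: "z = (phi i p, y)" by auto
  show "z \<in> chart (total_space V) i ` {e \<in> tot V. proj V e \<in> dom i \<inter> A}"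
    by (rule rev_image_eqI[of "from_triv V i p y"]) (use assms p z in auto)
qed auto

lemma total_img:
  assumes "i \<in> ind" shows "chart (total_space V) i ` chart_dom (total_space V) i = B.img i \<times> (UNIV :: 'k set)"
  using total_dom_img[OF assms, of UNIV] by simp

lemma total_inj: "i \<in> ind \<Longrightarrow> inj_on (chart (total_space V) i) (chart_dom (total_space V) i)"
proof (rule inj_onI)
  fix e e' assume i: "i \<in> ind" and e: "e \<in> chart_dom (total_space V) i" "e' \<in> chart_dom (total_space V) i"
    and eq: "chart (total_space V) i e = chart (total_space V) i e'"
  then have "proj V e = proj V e'" using B.chart_inj[OF i] by (auto dest: inj_onD)
  then show "e = e'" using e eq by (intro bundle_eqI[OF i]) auto
qed

lemma total_chart_inv:
  assumes "i \<in> ind" "x \<in> B.img i"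
  shows "chart_inv (total_space V) i (x, y) = from_triv V i (psi i x) y"
proof -
  have "chart_inv (total_space V) i (chart (total_space V) i (from_triv V i (psi i x) y)) = from_triv V i (psi i x) y"
    unfolding chart_inv_def
    by (rule inv_into_f_f[OF total_inj[OF assms(1)]])
      (use assms B.chart_inv_mem in \<open>simp add: chart_inv_def\<close>)
  then show ?thesis using assms B.chart_inv_mem B.chart_chart_inv by simp
qed

text \<open>The chart images are products of an open set with the whole model fibre, and the
  transition maps are linear families over those of the base. Through this instance the theory of
  tangent vectors becomes available on \<open>E\<close>, and later on its dual and on the
  lift.\<close>

sublocale T: atlas "total_space V"
proof
  show "pts (total_space V) = (\<Union>i\<in>idx (total_space V). chart_dom (total_space V) i)"
    using proj_pts by (auto simp: B.pts_eq)
  fix i assume "i \<in> idx (total_space V)"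
  then have i: "i \<in> ind" by simp
  show "inj_on (chart (total_space V) i) (chart_dom (total_space V) i)" by (rule total_inj[OF i])
  fix j assume "j \<in> idx (total_space V)"
  then have j: "j \<in> ind" by simp
  have eq: "chart (total_space V) i ` (chart_dom (total_space V) i \<inter> chart_dom (total_space V) j) =
      phi i ` (dom i \<inter> dom j) \<times> (UNIV :: 'k set)"
    unfolding total_dom_img[OF i, symmetric] by (rule image_cong) auto
  show op: "open (chart (total_space V) i ` (chart_dom (total_space V) i \<inter> chart_dom (total_space V) j))"
    unfolding eq by (intro open_Times B.open_overlap i j open_UNIV)
  have u: "uniq_diff (phi i ` (dom i \<inter> dom j) \<times> (UNIV::'k set))"
    using op unfolding eq by (rule uniq_diff_open)
  have f: "smooth_on (phi i ` (dom i \<inter> dom j) \<times> (UNIV::'k set)) fst"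
    "smooth_on (phi i ` (dom i \<inter> dom j) \<times> (UNIV::'k set)) snd"
    using smooth_on_fst[OF u smooth_on_ident[OF u]] smooth_on_snd[OF u smooth_on_ident[OF u]] by simp_all
  have "smooth_on (phi i ` (dom i \<inter> dom j) \<times> (UNIV::'k set))
      (\<lambda>z. (phi j (psi i (fst z)), triv V j (from_triv V i (psi i (fst z)) (snd z))))"
    by (intro smooth_on_Pair u transition_smooth_family i j f
        smooth_on_compose[OF u uniq_diff_open[OF B.open_overlap[OF i j]] B.smooth_transition[OF i j]]) auto
  then show "smooth_on (chart (total_space V) i ` (chart_dom (total_space V) i \<inter> chart_dom (total_space V) j))
      (\<lambda>x. chart (total_space V) j (chart_inv (total_space V) i x))"
    unfolding eq
    by (subst smooth_on_cong[where g="\<lambda>z. (phi j (psi i (fst z)), triv V j (from_triv V i (psi i (fst z)) (snd z)))"])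
      (use i in \<open>auto simp: total_chart_inv B.chart_inv_mem B.chart_inv_chart\<close>)
qed

lemma vzero:
  assumes "p \<in> pts (base V)"
  shows "vzero V p \<in> tot V" "proj V (vzero V p) = p" "j \<in> ind \<Longrightarrow> p \<in> dom j \<Longrightarrow> triv V j (vzero V p) = 0"
proof -
  note c = B.chart_at_mem[OF assms]
  show "vzero V p \<in> tot V" "proj V (vzero V p) = p" using c by (simp_all add: vzero_def)
  show "triv V j (vzero V p) = 0" if "j \<in> ind" "p \<in> dom j"
    using linear_0[OF transition_linear[OF c(1) that(1) c(2) that(2)]] by (simp add: vzero_def)
qed

lemma vadd:
  assumes "e \<in> tot V" "e' \<in> tot V" "proj V e' = proj V e"
  shows "vadd V e e' \<in> tot V" "proj V (vadd V e e') = proj V e"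
    "j \<in> ind \<Longrightarrow> proj V e \<in> dom j \<Longrightarrow> triv V j (vadd V e e') = triv V j e + triv V j e'"
proof -
  note c = B.chart_at_mem[OF proj_pts[OF assms(1)]]
  show "vadd V e e' \<in> tot V" "proj V (vadd V e e') = proj V e" using c by (simp_all add: vadd_def Let_def)
  show "triv V j (vadd V e e') = triv V j e + triv V j e'" if "j \<in> ind" "proj V e \<in> dom j"
    using linear_add[OF transition_linear[OF c(1) that(1) c(2) that(2)]]
      from_triv_triv[OF c(1) assms(1) c(2)] from_triv_triv[OF c(1) assms(2), unfolded assms(3), OF c(2)]
    by (simp add: vadd_def Let_def)
qed

lemma vscale:
  assumes "e \<in> tot V"
  shows "vscale V r e \<in> tot V" "proj V (vscale V r e) = proj V e"
    "j \<in> ind \<Longrightarrow> proj V e \<in> dom j \<Longrightarrow> triv V j (vscale V r e) = r *\<^sub>R triv V j e"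
proof -
  note c = B.chart_at_mem[OF proj_pts[OF assms(1)]]
  show "vscale V r e \<in> tot V" "proj V (vscale V r e) = proj V e" using c by (simp_all add: vscale_def Let_def)
  show "triv V j (vscale V r e) = r *\<^sub>R triv V j e" if "j \<in> ind" "proj V e \<in> dom j"
    using linear_scale[OF transition_linear[OF c(1) that(1) c(2) that(2)]]
      from_triv_triv[OF c(1) assms(1) c(2)]
    by (simp add: vscale_def Let_def)
qed

subsection \<open>The dual bundle\<close>

lemma dual_triv_eq:
  assumes "i \<in> ind" "p \<in> dom i" "\<And>e. e \<in> fibre V p \<Longrightarrow> \<xi> e = z \<bullet> triv V i e"
  shows "triv (dual_bundle V) i (p, \<xi>) = z"
proof -
  have "(THE z. \<forall>e\<in>fibre V p. \<xi> e = z \<bullet> triv V i e) = z"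
  proof (rule the_equality)
    fix z' assume z': "\<forall>e\<in>fibre V p. \<xi> e = z' \<bullet> triv V i e"
    have "z' \<bullet> y = z \<bullet> y" for y
      using z' assms(3) from_triv_fibre[OF assms(1,2), of y] from_triv(3)[OF assms(1,2), of y] by metis
    then show "z' = z" by (simp add: vector_eq_rdot[of z' z, symmetric])
  qed (use assms in auto)
  then show ?thesis by (simp add: dual_bundle_def)
qed

lemma mem_dual:
  "(p, \<xi>) \<in> tot (dual_bundle V) \<longleftrightarrow> p \<in> pts (base V) \<and>
     (\<forall>i\<in>ind. p \<in> dom i \<longrightarrow> linear (\<lambda>y. \<xi> (from_triv V i p y))) \<and> (\<forall>e. e \<notin> fibre V p \<longrightarrow> \<xi> e = 0)"
  by (simp add: dual_bundle_def)

lemma mem_dualI: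
  assumes "i \<in> ind" "p \<in> dom i" "\<And>e. e \<in> fibre V p \<Longrightarrow> \<xi> e = z \<bullet> triv V i e" "\<And>e. e \<notin> fibre V p \<Longrightarrow> \<xi> e = 0"
  shows "(p, \<xi>) \<in> tot (dual_bundle V)"
  unfolding mem_dual
proof (intro conjI ballI impI allI)
  fix j assume j: "j \<in> ind" "p \<in> dom j"
  have "linear (\<lambda>y. z \<bullet> triv V i (from_triv V j p y))"
    using linear_compose[OF transition_linear[OF j(1) assms(1) j(2) assms(2)]
        bounded_linear.linear[OF bounded_linear_inner_right[of z]]] by (simp add: o_def)
  then show "linear (\<lambda>y. \<xi> (from_triv V j p y))"
    using assms(3)[OF from_triv_fibre[OF j]] by simp
qed (use assms B.dom_pts in auto)

lemma dual_pairing: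
  assumes "(p, \<xi>) \<in> tot (dual_bundle V)" "i \<in> ind" "p \<in> dom i" "e \<in> fibre V p"
  shows "\<xi> e = triv (dual_bundle V) i (p, \<xi>) \<bullet> triv V i e"
proof -
  have l: "linear (\<lambda>y. \<xi> (from_triv V i p y))" using assms by (simp add: mem_dual)
  let ?z = "\<Sum>b\<in>onb. \<xi> (from_triv V i p b) *\<^sub>R b"
  have eq: "\<xi> e = ?z \<bullet> triv V i e" if "e \<in> fibre V p" for e
  proof -
    have "from_triv V i p (triv V i e) = e"
      using from_triv_triv[OF assms(2), of e] that assms(3) by (auto simp: fibre_def)
    then show ?thesis by (simp add: riesz_onb[OF l])
  qed
  from dual_triv_eq[OF assms(2,3) eq] eq[OF assms(4)] show ?thesis by simp
qed

lemma dual_fibre: "fibre (dual_bundle V) p = {\<xi>' \<in> tot (dual_bundle V). fst \<xi>' = p}"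
  by (simp add: fibre_def)

text \<open>The transpose of the transition from \<open>j\<close> to \<open>i\<close>, written out
  in \<open>onb\<close>: dual coordinates transform against the fibre coordinates.\<close>

lemma dual_transition:
  assumes i: "i \<in> ind" "p \<in> dom i" and j: "j \<in> ind" "p \<in> dom j" and \<xi>: "(p, \<xi>) \<in> tot (dual_bundle V)"
  shows "triv (dual_bundle V) j (p, \<xi>) =
    (\<Sum>b\<in>onb. (triv (dual_bundle V) i (p, \<xi>) \<bullet> triv V i (from_triv V j p b)) *\<^sub>R b)"
proof (rule dual_triv_eq[OF j])
  let ?z = "triv (dual_bundle V) i (p, \<xi>)"
  fix e assume e: "e \<in> fibre V p"
  have l: "linear (\<lambda>y. ?z \<bullet> triv V i (from_triv V j p y))"
    using linear_compose[OF transition_linear[OF j(1) i(1) j(2) i(2)]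
        bounded_linear.linear[OF bounded_linear_inner_right[of ?z]]] by (simp add: o_def)
  have "triv V i e = triv V i (from_triv V j p (triv V j e))"
    using e triv_transition[OF j(1), of e i] j(2) by (auto simp: fibre_def)
  then show "\<xi> e = (\<Sum>b\<in>onb. (?z \<bullet> triv V i (from_triv V j p b)) *\<^sub>R b) \<bullet> triv V j e"
    using dual_pairing[OF \<xi> i e] by (simp add: riesz_onb[OF l])
qed

text \<open>Makes the total space of the dual bundle, where \<open>lambda V A L\<close> takes its
  values, an atlas.\<close>

lemma vector_bundle_dual: "vector_bundle (dual_bundle V)"
proof -
  have bij: "bij_betw (triv (dual_bundle V) i) (fibre (dual_bundle V) p) UNIV" if i: "i \<in> ind" "p \<in> dom i" for i p
    unfolding bij_betw_def
  proof
    show "inj_on (triv (dual_bundle V) i) (fibre (dual_bundle V) p)"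
    proof (rule inj_onI)
      fix a b assume a: "a \<in> fibre (dual_bundle V) p" "b \<in> fibre (dual_bundle V) p"
        and eq: "triv (dual_bundle V) i a = triv (dual_bundle V) i b"
      then obtain \<xi> \<zeta> where ab: "a = (p, \<xi>)" "b = (p, \<zeta>)" "(p, \<xi>) \<in> tot (dual_bundle V)" "(p, \<zeta>) \<in> tot (dual_bundle V)"
        by (cases a; cases b) (auto simp: dual_fibre)
      have "\<xi> e = \<zeta> e" for e
      proof (cases "e \<in> fibre V p")
        case True
        then show ?thesis using dual_pairing[OF ab(3) i True] dual_pairing[OF ab(4) i True] eq ab by simp
      next
        case False
        then show ?thesis using ab by (simp add: mem_dual)
      qed
      then show "a = b" using ab by auto
    qed
    have "z \<in> triv (dual_bundle V) i ` fibre (dual_bundle V) p" for z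
    proof -
      let ?\<xi> = "\<lambda>e. if e \<in> fibre V p then z \<bullet> triv V i e else 0"
      have "(p, ?\<xi>) \<in> tot (dual_bundle V)" by (rule mem_dualI[OF i, where z=z]) auto
      moreover have "triv (dual_bundle V) i (p, ?\<xi>) = z" by (rule dual_triv_eq[OF i]) auto
      ultimately show ?thesis by (auto simp: dual_fibre intro!: rev_image_eqI[of "(p, ?\<xi>)"])
    qed
    then show "triv (dual_bundle V) i ` fibre (dual_bundle V) p = UNIV" by auto
  qed
  have tr: "triv (dual_bundle V) j (from_triv (dual_bundle V) i p z) =
      (\<Sum>b\<in>onb. (z \<bullet> triv V i (from_triv V j p b)) *\<^sub>R b)"
    if i: "i \<in> ind" "p \<in> dom i" and j: "j \<in> ind" "p \<in> dom j" for i j p z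
  proof -
    have "z \<in> triv (dual_bundle V) i ` fibre (dual_bundle V) p" using bij[OF i] by (simp add: bij_betw_def)
    from inv_into_into[OF this] f_inv_into_f[OF this]
    have m: "from_triv (dual_bundle V) i p z \<in> tot (dual_bundle V)" "fst (from_triv (dual_bundle V) i p z) = p"
      "triv (dual_bundle V) i (from_triv (dual_bundle V) i p z) = z"
      by (auto simp: from_triv_def dual_fibre)
    obtain \<xi> where "from_triv (dual_bundle V) i p z = (p, \<xi>)" using m(2) by (metis prod.collapse)
    then show ?thesis using dual_transition[OF i j, of \<xi>] m by simp
  qed
  have lin: "linear (\<lambda>z. triv (dual_bundle V) j (from_triv (dual_bundle V) i p z))"
    if "i \<in> ind" "p \<in> dom i" "j \<in> ind" "p \<in> dom j" for i j p
    unfolding tr[OF that]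
    by (intro bounded_linear.linear bounded_linear_sum bounded_linear_scaleR_const bounded_linear_inner_left)
  have sm: "smooth_on (phi i ` (dom i \<inter> dom j)) (\<lambda>x. triv (dual_bundle V) j (from_triv (dual_bundle V) i (psi i x) z))"
    if i: "i \<in> ind" and j: "j \<in> ind" for i j z
  proof -
    let ?O = "phi i ` (dom i \<inter> dom j)"
    have u: "uniq_diff ?O" by (rule uniq_diff_open[OF B.open_overlap[OF i j]])
    \<comment> \<open>The transposed transition starts in chart \<open>j\<close>, so its smoothness
      is known in the coordinates of \<open>j\<close>; the detour through
      \<open>psi j (phi j (psi i x))\<close> brings it into that form.\<close>
    have "smooth_on ?O (\<lambda>x. \<Sum>b\<in>onb. (z \<bullet> triv V i (from_triv V j (psi j (phi j (psi i x))) b)) *\<^sub>R b)"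
      by (intro smooth_on_sum[OF u] smooth_on_scaleR[OF u] smooth_on_const[OF u]
          smooth_on_linear[OF u bounded_linear_inner_right] transition_smooth_family j i u
          B.smooth_transition)
        (use i j in \<open>auto simp: B.chart_inv_chart\<close>)
    then show ?thesis
      by (subst smooth_on_cong) (use i j in \<open>auto simp: B.chart_inv_chart tr\<close>)
  qed
  show ?thesis
    unfolding vector_bundle_def dual_bundle_simps
    using vb bij lin sm by (auto simp: vector_bundle_def mem_dual)
qed

subsection \<open>Sections\<close>

lemma section_mem:
  assumes "X \<in> sections V" "p \<in> pts (base V)"
  shows "X p \<in> tot V" "proj V (X p) = p" "X p \<in> fibre V p"
  using assms by (auto simp: sections_def fibre_def PiE_def Pi_def)

lemma section_smooth:
  "X \<in> sections V \<Longrightarrow> i \<in> ind \<Longrightarrow> smooth_on (B.img i) (\<lambda>x. triv V i (X (psi i x)))"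
  by (simp add: sections_def)

lemma sectionsI:
  assumes "\<And>p. p \<notin> pts (base V) \<Longrightarrow> X p = undefined"
    "\<And>p. p \<in> pts (base V) \<Longrightarrow> X p \<in> tot V" "\<And>p. p \<in> pts (base V) \<Longrightarrow> proj V (X p) = p"
    "\<And>i. i \<in> ind \<Longrightarrow> smooth_on (B.img i) (\<lambda>x. triv V i (X (psi i x)))"
  shows "X \<in> sections V"
  using assms by (auto simp: sections_def fibre_def PiE_def extensional_def)

lemma sec_add_mem:
  assumes "X \<in> sections V" "Y \<in> sections V" shows "sec_add V X Y \<in> sections V"
proof (rule sectionsI)
  fix i assume i: "i \<in> ind"
  have "smooth_on (B.img i) (\<lambda>x. triv V i (X (psi i x)) + triv V i (Y (psi i x)))"
    by (intro smooth_on_add section_smooth assms i uniq_diff_open B.open_img)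
  then show "smooth_on (B.img i) (\<lambda>x. triv V i (sec_add V X Y (psi i x)))"
    using i B.chart_inv_mem B.dom_pts[OF i] assms
    by (subst smooth_on_cong) (auto simp: sec_add_def vadd section_mem B.chart_inv_chart)
qed (use assms in \<open>auto simp: sec_add_def vadd section_mem\<close>)

lemma sec_scale_mem:
  assumes "X \<in> sections V" "smooth_fun (base V) f" shows "sec_scale V f X \<in> sections V"
proof (rule sectionsI)
  fix i assume i: "i \<in> ind"
  have "smooth_on (B.img i) (\<lambda>x. f (psi i x) *\<^sub>R triv V i (X (psi i x)))"
    using assms i by (intro smooth_on_scaleR section_smooth uniq_diff_open B.open_img) (auto simp: smooth_fun_def)
  then show "smooth_on (B.img i) (\<lambda>x. triv V i (sec_scale V f X (psi i x)))"
    using i B.dom_pts[OF i] assms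
    by (subst smooth_on_cong) (auto simp: sec_scale_def vscale section_mem B.chart_inv_chart)
qed (use assms in \<open>auto simp: sec_scale_def vscale section_mem\<close>)

lemma sec_add_triv:
  assumes "X \<in> sections V" "Y \<in> sections V" "i \<in> ind" "p \<in> dom i"
  shows "triv V i (sec_add V X Y p) = triv V i (X p) + triv V i (Y p)"
  using assms B.dom_pts[OF assms(3,4)] by (simp add: sec_add_def vadd section_mem)

lemma sec_scale_triv:
  assumes "X \<in> sections V" "i \<in> ind" "p \<in> dom i"
  shows "triv V i (sec_scale V f X p) = f p *\<^sub>R triv V i (X p)"
  using assms B.dom_pts[OF assms(2,3)] by (simp add: sec_scale_def vscale section_mem)

lemma smooth_fun_const: "smooth_fun (base V) (\<lambda>_. c)"
  unfolding smooth_fun_def by (intro ballI smooth_on_const uniq_diff_open B.open_img)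

text \<open>The coordinates \<open>g\<close> are multiplied by a bump function supported in the
  chart domain and continued by the zero section. The prescribed values survive only near
  \<open>p\<close>, which is all that the bracket at \<open>p\<close> can see.\<close>

lemma local_section_extends:
  assumes i: "i \<in> ind" "p \<in> dom i" and g: "smooth_on (B.img i) g"
  shows "\<exists>X\<in>sections V. \<exists>W. openin (manifold_topology (base V)) W \<and> p \<in> W \<and> W \<subseteq> dom i \<and>
    (\<forall>q\<in>W. triv V i (X q) = g (phi i q))"
proof -
  obtain f K W where f: "smooth_fun (base V) f" and K: "closedin (manifold_topology (base V)) K" "K \<subseteq> dom i"
    and K0: "\<And>q. q \<in> pts (base V) - K \<Longrightarrow> f q = 0"
    and W: "openin (manifold_topology (base V)) W" "p \<in> W" "W \<subseteq> K" "\<And>q. q \<in> W \<Longrightarrow> f q = 1"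
    using B.manifold_bump_exists[OF hausdorff B.openin_chart_dom[OF i(1)] i(2)] by metis
  define X where "X = (\<lambda>q\<in>pts (base V). if q \<in> dom i then from_triv V i q (f q *\<^sub>R g (phi i q)) else vzero V q)"
  have X: "X \<in> sections V"
  proof (rule sectionsI)
    fix j assume j: "j \<in> ind"
    let ?O = "phi j ` (dom j \<inter> dom i)"
    have u: "uniq_diff ?O" by (rule uniq_diff_open[OF B.open_overlap[OF j i(1)]])
    show "smooth_on (B.img j) (\<lambda>x. triv V j (X (psi j x)))"
    proof (rule B.smooth_on_patch[OF j B.openin_chart_dom[OF i(1)] openin_diff[OF openin_topspace K(1)]])
      show "pts (base V) \<subseteq> dom i \<union> (topspace (manifold_topology (base V)) - K)"
        using K(2) by (auto simp: B.topspace_manifold_topology)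
      have t: "smooth_on ?O (\<lambda>x. phi i (psi j x))" by (rule B.smooth_transition[OF j i(1)])
      have f': "smooth_on ?O (\<lambda>x. f (psi j x))"
        using f i(1) by (intro B.smooth_change_chart[OF i(1) j]) (simp add: smooth_fun_def)
      have g': "smooth_on ?O (\<lambda>x. g (phi i (psi j x)))"
        by (rule smooth_on_compose[OF u uniq_diff_open[OF B.open_img[OF i(1)]] g t])
          (use j in \<open>auto simp: B.chart_inv_chart\<close>)
      have "smooth_on ?O (\<lambda>x. triv V j (from_triv V i (psi i (phi i (psi j x))) (f (psi j x) *\<^sub>R g (phi i (psi j x)))))"
        by (intro transition_smooth_family i j u t smooth_on_scaleR f' g')
          (use j in \<open>auto simp: B.chart_inv_chart\<close>)
      then have "smooth_on ?O (\<lambda>x. triv V j (X (psi j x)))"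
        by (subst smooth_on_cong) (use i j B.dom_pts in \<open>auto simp: B.chart_inv_chart X_def\<close>)
      then show "smooth_on {x \<in> B.img j. psi j x \<in> dom i} (\<lambda>x. triv V j (X (psi j x)))"
        unfolding B.overlap_eq[OF j] .
      show "smooth_on {x \<in> B.img j. psi j x \<in> topspace (manifold_topology (base V)) - K} (\<lambda>x. triv V j (X (psi j x)))"
      proof (subst smooth_on_cong[where g="\<lambda>_. 0"])
        fix x assume x: "x \<in> {x \<in> B.img j. psi j x \<in> topspace (manifold_topology (base V)) - K}"
        then have q: "psi j x \<in> dom j" "psi j x \<in> pts (base V) - K" using B.chart_inv_mem by (auto simp: B.topspace_manifold_topology)
        have "linear (\<lambda>y. triv V j (from_triv V i (psi j x) y))" if "psi j x \<in> dom i"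
          using transition_linear i j q that by blast
        then show "triv V j (X (psi j x)) = 0"
          using q K0[OF q(2)] vzero(3)[OF _ j] linear_0 by (auto simp: X_def)
      qed (intro smooth_on_const uniq_diff_open B.open_in_chart[OF j openin_diff[OF openin_topspace K(1)]])
    qed
  qed (use i vzero in \<open>auto simp: X_def\<close>)
  have "triv V i (X q) = g (phi i q)" if "q \<in> W" for q
    using that W(3,4) K(2) B.dom_pts[OF i(1)] i(1) by (auto simp: X_def subset_iff)
  then show ?thesis using X W K by blast
qed

text \<open>The choice in the definition of \<open>const_section\<close> has a witness.\<close>

lemma const_section:
  assumes "i \<in> ind" "p \<in> dom i"
  shows "const_section V i p y \<in> sections V"
    and "\<exists>U. openin (manifold_topology (base V)) U \<and> p \<in> U \<and> U \<subseteq> dom i \<and>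
      (\<forall>q\<in>U. triv V i (const_section V i p y q) = y)"
proof -
  have "smooth_on (B.img i) (\<lambda>_. y)" by (intro smooth_on_const uniq_diff_open B.open_img assms)
  then have ex: "\<exists>X. X \<in> sections V \<and> (\<exists>U. openin (manifold_topology (base V)) U \<and> p \<in> U \<and> U \<subseteq> dom i \<and>
      (\<forall>q\<in>U. triv V i (X q) = y))"
    using local_section_extends[OF assms] by blast
  from someI_ex[OF ex] show "const_section V i p y \<in> sections V"
    "\<exists>U. openin (manifold_topology (base V)) U \<and> p \<in> U \<and> U \<subseteq> dom i \<and>
      (\<forall>q\<in>U. triv V i (const_section V i p y q) = y)"
    unfolding const_section_def[symmetric] by blast+
qed

end

text \<open>The Leibniz rule asks for global functions, whereas the coefficients of a section in a
  local basis exist in one chart only.\<close>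

lemma (in atlas) local_function_extends:
  assumes haus: "Hausdorff_space (manifold_topology M)" and i: "i \<in> idx M" "p \<in> chart_dom M i"
    and g: "smooth_on (img i) g"
  shows "\<exists>f. smooth_fun M f \<and> (\<exists>W. openin (manifold_topology M) W \<and> p \<in> W \<and> W \<subseteq> chart_dom M i \<and>
    (\<forall>q\<in>W. f q = g (chart M i q)))"
proof -
  obtain f K W where f: "smooth_fun M f" and K: "closedin (manifold_topology M) K" "K \<subseteq> chart_dom M i"
    and K0: "\<And>q. q \<in> pts M - K \<Longrightarrow> f q = 0"
    and W: "openin (manifold_topology M) W" "p \<in> W" "W \<subseteq> K" "\<And>q. q \<in> W \<Longrightarrow> f q = 1"
    using manifold_bump_exists[OF haus openin_chart_dom[OF i(1)] i(2)] by metis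
  define h where "h q = (if q \<in> chart_dom M i then f q * g (chart M i q) else 0)" for q
  have "smooth_on (img j) (\<lambda>x. h (chart_inv M j x))" if j: "j \<in> idx M" for j
  proof (rule smooth_on_patch[OF j openin_chart_dom[OF i(1)] openin_diff[OF openin_topspace K(1)]])
    show "pts M \<subseteq> chart_dom M i \<union> (topspace (manifold_topology M) - K)"
      using K(2) by (auto simp: topspace_manifold_topology)
    have "smooth_on (img i) (\<lambda>x. f (chart_inv M i x) * g x)"
      using f g i by (intro smooth_on_mult uniq_diff_open open_img) (auto simp: smooth_fun_def)
    then have "smooth_on (img i) (\<lambda>x. h (chart_inv M i x))"
      by (subst smooth_on_cong) (use i in \<open>auto simp: h_def chart_inv_chart\<close>)
    from smooth_change_chart[OF i(1) j this]
    show "smooth_on {x \<in> img j. chart_inv M j x \<in> chart_dom M i} (\<lambda>x. h (chart_inv M j x))"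
      by (simp add: overlap_eq[OF j])
    show "smooth_on {x \<in> img j. chart_inv M j x \<in> topspace (manifold_topology M) - K} (\<lambda>x. h (chart_inv M j x))"
      using K0 open_in_chart[OF j openin_diff[OF openin_topspace K(1)]]
      by (subst smooth_on_cong[where g="\<lambda>_. 0"])
        (auto intro: smooth_on_const uniq_diff_open simp: h_def topspace_manifold_topology)
  qed
  then have "smooth_fun M h" by (simp add: smooth_fun_def)
  moreover have "\<forall>q\<in>W. h q = g (chart M i q)" using W K by (auto simp: h_def)
  ultimately show ?thesis using W K by blast
qed


section \<open>Skew algebroids in local coordinates\<close>

locale algd =
  fixes V :: "('i, 'a, 'm::finite_dim_inner, 'e, 'k::finite_dim_inner) vbundle"
    and A :: "('i, 'a, 'm, 'e) algebroid"
  assumes sk: "skew_algebroid V A"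
begin

sublocale vbun V
  using sk by (simp add: vbun_def skew_algebroid_def)

abbreviation br where "br \<equiv> bracket A"
abbreviation rho where "rho \<equiv> anchor_coord V A"
abbreviation str where "str \<equiv> structure_coord V A"

lemma br_mem: "X \<in> sections V \<Longrightarrow> Y \<in> sections V \<Longrightarrow> br X Y \<in> sections V"
  using sk unfolding skew_algebroid_def by blast

lemma br_skew:
  assumes "X \<in> sections V" "Y \<in> sections V" "i \<in> ind" "p \<in> dom i"
  shows "triv V i (br X Y p) = - triv V i (br Y X p)"
proof -
  have "br X Y = sec_scale V (\<lambda>_. - 1) (br Y X)"
    using sk assms(1,2) unfolding skew_algebroid_def by blast
  then have "triv V i (br X Y p) = triv V i (sec_scale V (\<lambda>_. - 1) (br Y X) p)" by (rule arg_cong)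
  also have "\<dots> = - triv V i (br Y X p)"
    using sec_scale_triv[OF br_mem[OF assms(2,1)] assms(3,4)] by simp
  finally show ?thesis .
qed

lemma br_add:
  assumes "X \<in> sections V" "Y \<in> sections V" "Z \<in> sections V" "i \<in> ind" "p \<in> dom i"
  shows "triv V i (br Z (sec_add V X Y) p) = triv V i (br Z X p) + triv V i (br Z Y p)"
proof -
  have "br Z (sec_add V X Y) = sec_add V (br Z X) (br Z Y)"
    using sk assms(1-3) unfolding skew_algebroid_def by blast
  then show ?thesis using sec_add_triv[OF br_mem[OF assms(3,1)] br_mem[OF assms(3,2)] assms(4,5)] by simp
qed

lemma br_scale_const:
  assumes "X \<in> sections V" "Z \<in> sections V" "i \<in> ind" "p \<in> dom i"
  shows "triv V i (br Z (sec_scale V (\<lambda>_. r) X) p) = r *\<^sub>R triv V i (br Z X p)"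
proof -
  have "br Z (sec_scale V (\<lambda>_. r) X) = sec_scale V (\<lambda>_. r) (br Z X)"
    using sk assms(1-2) unfolding skew_algebroid_def by blast
  then show ?thesis using sec_scale_triv[OF br_mem[OF assms(2,1)] assms(3,4)] by simp
qed

lemma anchor_tangent:
  assumes "e \<in> tot V"
  shows "anchor A e \<in> tot (tangent_bundle (base V))" "fst (anchor A e) = proj V e"
  using sk assms unfolding skew_algebroid_def vb_morphism_def smooth_map_def by (auto simp: Pi_def)

lemma anchor_coord_eq:
  assumes "i \<in> ind" "e \<in> tot V" "proj V e \<in> dom i"
  shows "snd (anchor A e) i = rho i (proj V e) (triv V i e)"
  by (simp add: anchor_coord_def from_triv_triv[OF assms])

lemma rho_linear:
  assumes "i \<in> ind" "p \<in> dom i" shows "linear (rho i p)"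
  using sk assms unfolding skew_algebroid_def vb_morphism_def by (auto simp: anchor_coord_def[abs_def])

lemma rho_smooth:
  assumes i: "i \<in> ind"
  shows "smooth_on (B.img i \<times> UNIV) (\<lambda>z. rho i (psi i (fst z)) (snd z))"
proof -
  let ?N = "total_space (tangent_bundle (base V))"
  have "chart_dom (total_space V) i \<inter> anchor A -` chart_dom ?N i = chart_dom (total_space V) i"
    using anchor_tangent by auto
  moreover have "smooth_on (chart (total_space V) i ` (chart_dom (total_space V) i \<inter> anchor A -` chart_dom ?N i))
      (\<lambda>x. chart ?N i (anchor A (chart_inv (total_space V) i x)))"
    using sk i unfolding skew_algebroid_def vb_morphism_def smooth_map_def by simp
  ultimately have s: "smooth_on (B.img i \<times> UNIV) (\<lambda>x. chart ?N i (anchor A (chart_inv (total_space V) i x)))"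
    using total_img[OF i] by (simp del: total_space_simps)
  have u: "uniq_diff (B.img i \<times> (UNIV::'k set))"
    by (intro uniq_diff_open open_Times B.open_img i open_UNIV)
  have "smooth_on (B.img i \<times> UNIV) (\<lambda>x. snd (chart ?N i (anchor A (chart_inv (total_space V) i x))))"
    by (rule smooth_on_snd[OF u s])
  then show ?thesis
    by (subst smooth_on_cong) (use i in \<open>auto simp: total_chart_inv anchor_coord_def\<close>)
qed

section \<open>Locality of the bracket and its coordinate expression\<close>

lemma br_leibniz:
  assumes "X \<in> sections V" "Y \<in> sections V" "smooth_fun (base V) f" and i: "i \<in> ind" "p \<in> dom i"
  shows "triv V i (br X (sec_scale V f Y) p) = f p *\<^sub>R triv V i (br X Y p) +
    FD (\<lambda>x. f (psi i x)) (phi i p) (rho i p (triv V i (X p))) *\<^sub>R triv V i (Y p)"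
proof -
  let ?g = "\<lambda>p. dT_fun (base V) f (anchor A (X p))"
  have p: "p \<in> pts (base V)" using B.dom_pts[OF i] .
  have "br X (sec_scale V f Y) = sec_add V (sec_scale V f (br X Y)) (sec_scale V ?g Y)"
    using sk assms(1-3) unfolding skew_algebroid_def by blast
  then have "br X (sec_scale V f Y) p = vadd V (vscale V (f p) (br X Y p)) (vscale V (?g p) (Y p))"
    using p by (simp add: sec_add_def sec_scale_def)
  then have "triv V i (br X (sec_scale V f Y) p) = f p *\<^sub>R triv V i (br X Y p) + ?g p *\<^sub>R triv V i (Y p)"
    using section_mem[OF br_mem[OF assms(1,2)] p] section_mem[OF assms(2) p] i by (simp add: vadd vscale)
  moreover have "?g p = FD (\<lambda>x. f (psi i x)) (phi i p) (rho i p (triv V i (X p)))"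
  proof -
    note X = section_mem[OF assms(1) p]
    have "((\<lambda>x. f (psi i x)) has_derivative FD (\<lambda>x. f (psi i x)) (phi i p)) (at (phi i p))"
      by (rule smooth_on_has_derivative_at[OF B.open_img[OF i(1)]]) (use assms(3) i in \<open>auto simp: smooth_fun_def\<close>)
    from B.dT_fun_eq[OF anchor_tangent(1)[OF X(1)] i(1), of f] this show ?thesis
      using i X anchor_tangent(2)[OF X(1)] anchor_coord_eq[OF i(1) X(1)] by simp
  qed
  ultimately show ?thesis by simp
qed

text \<open>Take a bump function \<open>f\<close> with \<open>f p = 1\<close> that vanishes outside
  a subset \<open>K\<close> of \<open>U\<close>. Then \<open>f X\<close> is the zero section, since
  \<open>X\<close> vanishes on \<open>K\<close> and \<open>f\<close> off \<open>K\<close>. In the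
  Leibniz rule for \<open>[Z, f X]\<close> at \<open>p\<close> the derivative term carries the
  factor \<open>X p\<close>, which is zero, and \<open>[Z, X]\<close> is left.\<close>

lemma br_zero_local:
  assumes X: "X \<in> sections V" and Z: "Z \<in> sections V" and i: "i \<in> ind" "p \<in> dom i"
    and U: "openin (manifold_topology (base V)) U" "p \<in> U" "U \<subseteq> dom i" "\<And>q. q \<in> U \<Longrightarrow> triv V i (X q) = 0"
  shows "triv V i (br Z X p) = 0"
proof -
  obtain f K W where f: "smooth_fun (base V) f" and K: "closedin (manifold_topology (base V)) K" "K \<subseteq> U"
    and K0: "\<And>q. q \<in> pts (base V) - K \<Longrightarrow> f q = 0"
    and W: "openin (manifold_topology (base V)) W" "p \<in> W" "W \<subseteq> K" "\<And>q. q \<in> W \<Longrightarrow> f q = 1"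
    using B.manifold_bump_exists[OF hausdorff U(1,2)] by metis
  have "sec_scale V f X = sec_scale V (\<lambda>_. 0) X"
    unfolding sec_scale_def
  proof (rule restrict_ext)
    fix q assume q: "q \<in> pts (base V)"
    note m = section_mem[OF X q]
    show "vscale V (f q) (X q) = vscale V 0 (X q)"
    proof (cases "q \<in> K")
      case True
      then have "q \<in> U" using K by auto
      then show ?thesis
        using m U i by (intro bundle_eqI[OF i(1)]) (auto simp: vscale)
    qed (use q K0 in simp)
  qed
  then have "triv V i (br Z (sec_scale V f X) p) = triv V i (br Z (sec_scale V (\<lambda>_. 0) X) p)" by simp
  also have "\<dots> = 0" using br_scale_const[OF X Z i] by simp
  finally show ?thesis using br_leibniz[OF Z X f i] W U by simp
qed

lemma br_cong_local:
  assumes X: "X \<in> sections V" and Y: "Y \<in> sections V" and Z: "Z \<in> sections V" and i: "i \<in> ind" "p \<in> dom i"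
    and U: "openin (manifold_topology (base V)) U" "p \<in> U" "U \<subseteq> dom i" "\<And>q. q \<in> U \<Longrightarrow> triv V i (X q) = triv V i (Y q)"
  shows "triv V i (br Z X p) = triv V i (br Z Y p)"
proof -
  let ?Y = "sec_scale V (\<lambda>_. - 1) Y"
  have Y': "?Y \<in> sections V" by (rule sec_scale_mem[OF Y smooth_fun_const])
  have "triv V i (sec_add V X ?Y q) = 0" if "q \<in> U" for q
    using that U i sec_add_triv[OF X Y' i(1), of q] sec_scale_triv[OF Y i(1), of q "\<lambda>_. - 1"] by auto
  from br_zero_local[OF sec_add_mem[OF X Y'] Z i U(1-3) this]
  show ?thesis using br_add[OF X Y' Z i] br_scale_const[OF Y Z i] by simp
qed

lemma section_has_derivative:
  assumes "X \<in> sections V" "i \<in> ind" "p \<in> dom i"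
  shows "((\<lambda>x. triv V i (X (psi i x))) has_derivative
    FD (\<lambda>x. triv V i (X (psi i x))) (phi i p)) (at (phi i p))"
  by (rule smooth_on_has_derivative_at[OF B.open_img section_smooth]) (use assms in auto)

text \<open>Induction over the basis vectors: one term is subtracted from \<open>X\<close> as a
  global section, and near \<open>p\<close> the remainder has the shorter expansion. The
  neighbourhood shrinks in every step, because the section chosen for \<open>b\<close> is constant
  only near \<open>p\<close>.\<close>

lemma br_finite_expansion:
  assumes Z: "Z \<in> sections V" and i: "i \<in> ind" "p \<in> dom i" and "finite B"
  shows "X \<in> sections V \<Longrightarrow> (\<And>b. b \<in> B \<Longrightarrow> smooth_fun (base V) (h b)) \<Longrightarrow>
    openin (manifold_topology (base V)) U \<Longrightarrow> p \<in> U \<Longrightarrow> U \<subseteq> dom i \<Longrightarrow>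
    (\<And>q. q \<in> U \<Longrightarrow> triv V i (X q) = (\<Sum>b\<in>B. h b q *\<^sub>R b)) \<Longrightarrow>
    triv V i (br Z X p) = (\<Sum>b\<in>B. h b p *\<^sub>R triv V i (br Z (const_section V i p b) p) +
      FD (\<lambda>x. h b (psi i x)) (phi i p) (rho i p (triv V i (Z p))) *\<^sub>R b)"
  using \<open>finite B\<close>
proof (induction B arbitrary: X U rule: finite_induct)
  case empty
  then show ?case using br_zero_local[OF _ Z i, of X U] by simp
next
  case (insert b B)
  let ?E = "const_section V i p b"
  let ?S = "sec_scale V (h b) ?E"
  let ?S' = "sec_scale V (\<lambda>_. - 1) ?S"
  note E = const_section(1)[OF i, of b]
  have hb: "smooth_fun (base V) (h b)" using insert.prems(2) by blast
  have S: "?S \<in> sections V" by (rule sec_scale_mem[OF E hb])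
  have S': "?S' \<in> sections V" by (rule sec_scale_mem[OF S smooth_fun_const])
  obtain U' where U': "openin (manifold_topology (base V)) U'" "p \<in> U'" "U' \<subseteq> dom i"
    "\<And>q. q \<in> U' \<Longrightarrow> triv V i (?E q) = b" using const_section(2)[OF i, of b] by blast
  have X': "sec_add V X ?S' \<in> sections V" by (rule sec_add_mem[OF insert.prems(1) S'])
  have co: "triv V i (sec_add V X ?S' q) = (\<Sum>b\<in>B. h b q *\<^sub>R b)" if q: "q \<in> U \<inter> U'" for q
  proof -
    have q': "q \<in> dom i" using q U' by auto
    show ?thesis
      using q U'(4)[of q] insert.prems(6)[of q] insert.hyps
      by (simp add: sec_add_triv[OF insert.prems(1) S' i(1) q'] sec_scale_triv[OF S i(1) q'] sec_scale_triv[OF E i(1) q'])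
  qed
  have IH: "triv V i (br Z (sec_add V X ?S') p) = (\<Sum>b\<in>B. h b p *\<^sub>R triv V i (br Z (const_section V i p b) p) +
      FD (\<lambda>x. h b (psi i x)) (phi i p) (rho i p (triv V i (Z p))) *\<^sub>R b)"
    by (rule insert.IH[where U="U \<inter> U'", OF X' _ _ _ _ co]) (use insert.prems U' in auto)
  have "triv V i (br Z (sec_add V X ?S') p) = triv V i (br Z X p) - triv V i (br Z ?S p)"
    using br_add[OF insert.prems(1) S' Z i] br_scale_const[OF S Z i] by simp
  moreover have "triv V i (br Z ?S p) = h b p *\<^sub>R triv V i (br Z ?E p) +
      FD (\<lambda>x. h b (psi i x)) (phi i p) (rho i p (triv V i (Z p))) *\<^sub>R b"
    using br_leibniz[OF Z E hb i] U'(2,4) by simp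
  ultimately show ?case using IH insert.hyps by (simp add: algebra_simps)
qed

lemma br_expansion:
  assumes Z: "Z \<in> sections V" and X: "X \<in> sections V" and i: "i \<in> ind" "p \<in> dom i"
  shows "triv V i (br Z X p) = (\<Sum>b\<in>onb. (triv V i (X p) \<bullet> b) *\<^sub>R triv V i (br Z (const_section V i p b) p)) +
      FD (\<lambda>x. triv V i (X (psi i x))) (phi i p) (rho i p (triv V i (Z p)))"
proof -
  let ?g = "\<lambda>b x. triv V i (X (psi i x)) \<bullet> b"
  have "\<exists>f. smooth_fun (base V) f \<and> (\<exists>W. openin (manifold_topology (base V)) W \<and> p \<in> W \<and> W \<subseteq> dom i \<and>
    (\<forall>q\<in>W. f q = ?g b (phi i q)))" for b
    by (intro B.local_function_extends hausdorff i smooth_on_linear[OF _ bounded_linear_inner_left]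
        section_smooth X uniq_diff_open B.open_img)
  then obtain h W where h: "\<And>b. smooth_fun (base V) (h b)"
    and W: "\<And>b. openin (manifold_topology (base V)) (W b)" "\<And>b. p \<in> W b" "\<And>b. W b \<subseteq> dom i"
      "\<And>b q. q \<in> W b \<Longrightarrow> h b q = ?g b (phi i q)" by metis
  have hX: "h b q = triv V i (X q) \<bullet> b" if "q \<in> W b" for b q
    using W(4)[OF that] W(3)[of b] that i(1) by (auto simp: B.chart_inv_chart subset_iff)
  \<comment> \<open>The factor \<open>dom i\<close> keeps this set inside the chart when
    \<open>onb\<close> is empty, that is for fibres of dimension 0.\<close>
  let ?U = "dom i \<inter> (\<Inter>b\<in>onb. W b)"
  have 1: "openin (manifold_topology (base V)) ?U"
    using W(1) by (cases "(onb :: 'k set) = {}") (auto intro!: openin_Int B.openin_chart_dom[OF i(1)] openin_Inter)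
  have "triv V i (br Z X p) = (\<Sum>b\<in>onb. h b p *\<^sub>R triv V i (br Z (const_section V i p b) p) +
      FD (\<lambda>x. h b (psi i x)) (phi i p) (rho i p (triv V i (Z p))) *\<^sub>R b)"
  proof (rule br_finite_expansion[OF Z i finite_onb X h 1])
    fix q assume "q \<in> ?U"
    then have "(\<Sum>b\<in>onb. h b q *\<^sub>R b) = (\<Sum>b\<in>onb. (triv V i (X q) \<bullet> b) *\<^sub>R b)"
      by (intro sum.cong) (auto simp: hX)
    then show "triv V i (X q) = (\<Sum>b\<in>onb. h b q *\<^sub>R b)" by (simp add: onb_expand)
  qed (use i W in auto)
  also have "\<dots> = (\<Sum>b\<in>onb. (triv V i (X p) \<bullet> b) *\<^sub>R triv V i (br Z (const_section V i p b) p) +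
      (FD (\<lambda>x. triv V i (X (psi i x))) (phi i p) (rho i p (triv V i (Z p))) \<bullet> b) *\<^sub>R b)"
  proof (rule sum.cong[OF refl])
    fix b :: 'k assume b: "b \<in> onb"
    have "FD (\<lambda>x. h b (psi i x)) (phi i p) = FD (?g b) (phi i p)"
    proof (rule frechet_derivative_cong_open[OF B.open_in_chart[OF i(1) W(1)[of b]]])
      show "h b (psi i y) = ?g b y" if "y \<in> {x \<in> B.img i. psi i x \<in> W b}" for y
        using that hX by auto
    qed (use i W in \<open>auto simp: B.chart_inv_chart\<close>)
    moreover have "FD (?g b) (phi i p) =
        (\<lambda>v. FD (\<lambda>x. triv V i (X (psi i x))) (phi i p) v \<bullet> b)"
      by (rule frechet_derivative_at[symmetric])
        (rule has_derivative_inner_left[OF section_has_derivative[OF X i]])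
    ultimately show "h b p *\<^sub>R triv V i (br Z (const_section V i p b) p) +
      FD (\<lambda>x. h b (psi i x)) (phi i p) (rho i p (triv V i (Z p))) *\<^sub>R b =
      (triv V i (X p) \<bullet> b) *\<^sub>R triv V i (br Z (const_section V i p b) p) +
      (FD (\<lambda>x. triv V i (X (psi i x))) (phi i p) (rho i p (triv V i (Z p))) \<bullet> b) *\<^sub>R b"
      using hX[OF W(2)] by simp
  qed
  finally show ?thesis by (simp add: sum.distrib onb_expand)
qed

lemma const_near_has_derivative:
  assumes i: "i \<in> ind" and U: "openin (manifold_topology (base V)) U" "p \<in> U" "U \<subseteq> dom i"
    "\<And>q. q \<in> U \<Longrightarrow> triv V i (X q) = c"
  shows "FD (\<lambda>x. triv V i (X (psi i x))) (phi i p) = (\<lambda>_. 0)"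
proof -
  have "FD (\<lambda>x. triv V i (X (psi i x))) (phi i p) = FD (\<lambda>_. c) (phi i p)"
    by (rule frechet_derivative_cong_open[OF B.open_in_chart[OF i U(1)]])
      (use i U in \<open>auto simp: B.chart_inv_chart subset_iff\<close>)
  then show ?thesis by simp
qed

lemma const_section_at:
  assumes "i \<in> ind" "p \<in> dom i"
  shows "triv V i (const_section V i p y p) = y"
    "FD (\<lambda>x. triv V i (const_section V i p y (psi i x))) (phi i p) = (\<lambda>_. 0)"
proof -
  obtain U where U: "openin (manifold_topology (base V)) U" "p \<in> U" "U \<subseteq> dom i"
    "\<And>q. q \<in> U \<Longrightarrow> triv V i (const_section V i p y q) = y" using const_section(2)[OF assms, of y] by blast
  show "triv V i (const_section V i p y p) = y" using U by blast
  show "FD (\<lambda>x. triv V i (const_section V i p y (psi i x))) (phi i p) = (\<lambda>_. 0)"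
    by (rule const_near_has_derivative[OF assms(1) U])
qed

lemma str_skew: "i \<in> ind \<Longrightarrow> p \<in> dom i \<Longrightarrow> str i p y f = - str i p f y"
  unfolding structure_coord_def by (intro br_skew const_section)

lemma br_coord_aux:
  assumes Z: "Z \<in> sections V" and X: "X \<in> sections V" and i: "i \<in> ind" "p \<in> dom i"
  shows "triv V i (br Z X p) =
     (\<Sum>b\<in>onb. \<Sum>a\<in>onb. ((triv V i (X p) \<bullet> b) * (triv V i (Z p) \<bullet> a)) *\<^sub>R str i p a b) +
      FD (\<lambda>x. triv V i (X (psi i x))) (phi i p) (rho i p (triv V i (Z p))) -
      FD (\<lambda>x. triv V i (Z (psi i x))) (phi i p) (rho i p (triv V i (X p)))"
proof -
  let ?E = "const_section V i p"
  let ?DZ = "FD (\<lambda>x. triv V i (Z (psi i x))) (phi i p)"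
  have "triv V i (br Z (?E b) p) = (\<Sum>a\<in>onb. (triv V i (Z p) \<bullet> a) *\<^sub>R str i p a b) - ?DZ (rho i p b)" for b
  proof -
    \<comment> \<open>The Leibniz rule concerns the right argument; skew symmetry moves
      \<open>Z\<close> there, so that it can be expanded as well.\<close>
    have "triv V i (br Z (?E b) p) = - triv V i (br (?E b) Z p)"
      by (rule br_skew[OF Z const_section(1)[OF i] i])
    also have "triv V i (br (?E b) Z p) = (\<Sum>a\<in>onb. (triv V i (Z p) \<bullet> a) *\<^sub>R str i p b a) + ?DZ (rho i p b)"
      using br_expansion[OF const_section(1)[OF i] Z i] by (simp add: structure_coord_def const_section_at[OF i])
    also have "(\<Sum>a\<in>onb. (triv V i (Z p) \<bullet> a) *\<^sub>R str i p b a) = - (\<Sum>a\<in>onb. (triv V i (Z p) \<bullet> a) *\<^sub>R str i p a b)"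
      unfolding sum_negf[symmetric] by (rule sum.cong[OF refl]) (simp add: str_skew[OF i, of b])
    finally show ?thesis by simp
  qed
  moreover have "?DZ (rho i p (triv V i (X p))) = (\<Sum>b\<in>onb. (triv V i (X p) \<bullet> b) *\<^sub>R ?DZ (rho i p b))"
    by (rule linear_onb)
      (use linear_compose[OF rho_linear[OF i] has_derivative_linear[OF section_has_derivative[OF Z i]]] in \<open>simp add: o_def\<close>)
  ultimately show ?thesis
    unfolding br_expansion[OF Z X i]
    by (simp add: scaleR_diff_right sum_subtractf scaleR_sum_right)
qed

text \<open>\<open>const_section\<close> chooses a section separately for every vector, so
  bilinearity of \<open>str\<close> does not come directly from that of the bracket. It comes from
  the coordinate formula, whose derivative terms vanish on sections that are constant near
  \<open>p\<close>.\<close>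

lemma str_expansion:
  assumes i: "i \<in> ind" "p \<in> dom i"
  shows "str i p y f = (\<Sum>b\<in>onb. \<Sum>a\<in>onb. ((f \<bullet> b) * (y \<bullet> a)) *\<^sub>R str i p a b)"
  using br_coord_aux[OF const_section(1)[OF i] const_section(1)[OF i] i, of y f]
  by (simp add: structure_coord_def[symmetric] const_section_at[OF i])

lemma str_linear_right:
  assumes i: "i \<in> ind" "p \<in> dom i" shows "linear (str i p y)"
proof -
  have "linear (\<lambda>f. \<Sum>b\<in>onb. (f \<bullet> b) *\<^sub>R (\<Sum>a\<in>onb. (y \<bullet> a) *\<^sub>R str i p a b))"
    by (intro bounded_linear.linear bounded_linear_sum bounded_linear_scaleR_const bounded_linear_inner_left)
  moreover have "str i p y = (\<lambda>f. \<Sum>b\<in>onb. (f \<bullet> b) *\<^sub>R (\<Sum>a\<in>onb. (y \<bullet> a) *\<^sub>R str i p a b))"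
    by (rule ext, subst str_expansion[OF i]) (simp add: scaleR_sum_right)
  ultimately show ?thesis by (simp only:)
qed

lemma str_linear_left: "i \<in> ind \<Longrightarrow> p \<in> dom i \<Longrightarrow> linear (\<lambda>y. str i p y f)"
  using linear_compose_neg[OF str_linear_right[of i p f]] by (simp only: str_skew[of i p _ f] o_def)

lemma br_coord:
  assumes "Z \<in> sections V" "X \<in> sections V" "i \<in> ind" "p \<in> dom i"
  shows "triv V i (br Z X p) = str i p (triv V i (Z p)) (triv V i (X p)) +
      FD (\<lambda>x. triv V i (X (psi i x))) (phi i p) (rho i p (triv V i (Z p))) -
      FD (\<lambda>x. triv V i (Z (psi i x))) (phi i p) (rho i p (triv V i (X p)))"
  unfolding br_coord_aux[OF assms] str_expansion[OF assms(3,4), symmetric] ..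

lemma br_const_near:
  assumes Z: "Z \<in> sections V" and X: "X \<in> sections V" and i: "i \<in> ind"
    and U: "openin (manifold_topology (base V)) U" "q \<in> U" "U \<subseteq> dom i"
    "\<And>q. q \<in> U \<Longrightarrow> triv V i (Z q) = y" "\<And>q. q \<in> U \<Longrightarrow> triv V i (X q) = f"
  shows "triv V i (br Z X q) = str i q y f"
proof -
  have q: "q \<in> dom i" using U by blast
  show ?thesis
    using br_coord[OF Z X i q] const_near_has_derivative[OF i U(1-3), of Z y] const_near_has_derivative[OF i U(1-3), of X f] U
    by simp
qed

lemma const_sections_near:
  assumes i: "i \<in> ind" "p \<in> dom i"
  obtains U where "openin (manifold_topology (base V)) U" "p \<in> U" "U \<subseteq> dom i"
    "\<And>q. q \<in> U \<Longrightarrow> triv V i (const_section V i p y q) = y" "\<And>q. q \<in> U \<Longrightarrow> triv V i (const_section V i p f q) = f"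
    "\<And>q. q \<in> U \<Longrightarrow> triv V i (br (const_section V i p y) (const_section V i p f) q) = str i q y f"
proof -
  obtain U1 where U1: "openin (manifold_topology (base V)) U1" "p \<in> U1" "U1 \<subseteq> dom i"
    "\<And>q. q \<in> U1 \<Longrightarrow> triv V i (const_section V i p y q) = y" using const_section(2)[OF i, of y] by blast
  obtain U2 where U2: "openin (manifold_topology (base V)) U2" "p \<in> U2" "U2 \<subseteq> dom i"
    "\<And>q. q \<in> U2 \<Longrightarrow> triv V i (const_section V i p f q) = f" using const_section(2)[OF i, of f] by blast
  show ?thesis
  proof (rule that[of "U1 \<inter> U2"])
    show U: "openin (manifold_topology (base V)) (U1 \<inter> U2)" by (rule openin_Int[OF U1(1) U2(1)])
    show "triv V i (br (const_section V i p y) (const_section V i p f) q) = str i q y f" if "q \<in> U1 \<inter> U2" for q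
      by (rule br_const_near[OF const_section(1)[OF i] const_section(1)[OF i] i(1) U that])
        (use U1 U2 in auto)
  qed (use U1 U2 in auto)
qed

text \<open>The definition of \<open>structure_coord\<close> picks new sections at every point. But
  the pair picked at \<open>p\<close> computes the structure functions at all points near
  \<open>p\<close>, where they are thus the coordinates of one smooth section.\<close>

lemma str_smooth_coeff:
  assumes i: "i \<in> ind" shows "smooth_on (B.img i) (\<lambda>x. str i (psi i x) y f)"
proof (rule smooth_on_local)
  fix x assume x: "x \<in> B.img i"
  define p where "p = psi i x"
  have p: "p \<in> dom i" unfolding p_def by (rule B.chart_inv_mem[OF x])
  obtain U where U: "openin (manifold_topology (base V)) U" "p \<in> U" "U \<subseteq> dom i"
    "\<And>q. q \<in> U \<Longrightarrow> triv V i (br (const_section V i p y) (const_section V i p f) q) = str i q y f"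
    by (rule const_sections_near[OF i p, of y f]) blast
  let ?T = "{x \<in> B.img i. psi i x \<in> U}"
  have T: "open ?T" by (rule B.open_in_chart[OF i U(1)])
  have "smooth_on (B.img i \<inter> ?T) (\<lambda>x. triv V i (br (const_section V i p y) (const_section V i p f) (psi i x)))"
    by (intro smooth_on_Int_open[OF T] section_smooth br_mem const_section i p)
  then have "smooth_on (B.img i \<inter> ?T) (\<lambda>x. str i (psi i x) y f)"
    by (subst smooth_on_cong) (auto simp: U(4))
  with T x U(2) show "\<exists>T. open T \<and> x \<in> T \<and> smooth_on (B.img i \<inter> T) (\<lambda>x. str i (psi i x) y f)"
    unfolding p_def by blast
qed

lemma str_smooth:
  fixes X :: "'t::real_normed_vector \<Rightarrow> 'm"
  assumes i: "i \<in> ind" and u: "uniq_diff T" and "smooth_on T X" "smooth_on T Y" "smooth_on T F" "X ` T \<subseteq> B.img i"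
  shows "smooth_on T (\<lambda>t. str i (psi i (X t)) (Y t) (F t))"
proof -
  have "smooth_on T (\<lambda>t. \<Sum>b\<in>onb. \<Sum>a\<in>onb. ((F t \<bullet> b) * (Y t \<bullet> a)) *\<^sub>R str i (psi i (X t)) a b)"
    by (intro smooth_on_sum smooth_on_scaleR smooth_on_mult u smooth_on_linear[OF u bounded_linear_inner_left] assms
       smooth_on_compose[OF u uniq_diff_open[OF B.open_img[OF i]] str_smooth_coeff[OF i] assms(3,6)])
  then show ?thesis
    by (subst smooth_on_cong[OF str_expansion[OF i]]) (use assms B.chart_inv_mem in blast)+
qed

text \<open>A section that is constant in chart \<open>i\<close> has the coordinates
  \<open>G x y\<close> in chart \<open>j\<close>; differentiating these along the anchor produces
  the two correction terms. This is the non-tensorial law behind the invariance of the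
  variation.\<close>

lemma str_change_chart:
  assumes i: "i \<in> ind" "p \<in> dom i" and j: "j \<in> ind" "p \<in> dom j"
  defines "G \<equiv> \<lambda>x y. triv V j (from_triv V i (psi i x) y)"
  shows "G (phi i p) (str i p y f) = str j p (G (phi i p) y) (G (phi i p) f) +
    FD (\<lambda>x. G x f) (phi i p) (rho i p y) -
    FD (\<lambda>x. G x y) (phi i p) (rho i p f)"
proof -
  let ?E = "const_section V i p"
  have p: "p \<in> pts (base V)" by (rule B.dom_pts[OF i])
  note E = const_section(1)[OF i]
  have G: "triv V j (?E y q) = G (phi i q) (triv V i (?E y q))" if "q \<in> dom i" for q y
    unfolding G_def using section_mem[OF E B.dom_pts[OF i(1) that]] that i(1) triv_transition[OF i(1), of "?E y q" j]
    by (simp add: B.chart_inv_chart)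
  have Gp: "triv V j (?E y p) = G (phi i p) y" for y using G[OF i(2)] const_section_at[OF i] by simp
  \<comment> \<open>The anchor gives one tangent vector, which differentiates the function
    \<open>\<lambda>q. triv V j (?E z q)\<close> with the same result in both charts; in chart
    \<open>i\<close> this function is \<open>\<lambda>x. G x z\<close> near
    \<open>p\<close>.\<close>
  have tr: "FD (\<lambda>x. triv V j (?E z (psi j x))) (phi j p) (rho j p (triv V j (?E u p))) =
      FD (\<lambda>x. G x z) (phi i p) (rho i p u)" for z u
  proof -
    obtain U where U: "openin (manifold_topology (base V)) U" "p \<in> U" "U \<subseteq> dom i"
      "\<And>q. q \<in> U \<Longrightarrow> triv V i (?E z q) = z" using const_section(2)[OF i, of z] by blast
    have "smooth_on (phi i ` (dom i \<inter> dom j)) (\<lambda>x. G x z)" unfolding G_def by (rule transition_smooth[OF i(1) j(1)])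
    then have D: "((\<lambda>x. G x z) has_derivative FD (\<lambda>x. G x z) (phi i p)) (at (phi i p))"
      using i j by (intro smooth_on_has_derivative_at[OF B.open_overlap[OF i(1) j(1)]]) auto
    have "((\<lambda>x. triv V j (?E z (psi i x))) has_derivative FD (\<lambda>x. G x z) (phi i p)) (at (phi i p))"
      by (rule has_derivative_transform_within_open[OF D B.open_in_chart[OF i(1) U(1)]])
        (use U i G in \<open>auto simp: B.chart_inv_chart subset_iff\<close>)
    note * = B.tangent_derivative_indep[OF anchor_tangent(1)[OF section_mem(1)[OF E p]], where i=i and k=j and h="\<lambda>q. triv V j (?E z q)",
        unfolded anchor_tangent(2)[OF section_mem(1)[OF E p]] section_mem(2)[OF E p], OF i j this]
    then show ?thesis
      using anchor_coord_eq[OF i(1) section_mem(1)[OF E p]] anchor_coord_eq[OF j(1) section_mem(1)[OF E p]]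
        section_mem(2)[OF E p] i j const_section_at[OF i] by simp
  qed
  have b: "br (?E y) (?E f) \<in> sections V" by (rule br_mem[OF E E])
  have "G (phi i p) (str i p y f) = triv V j (br (?E y) (?E f) p)"
    using triv_transition[OF i(1) section_mem(1)[OF b p], of j] section_mem(2)[OF b p] i
    by (simp add: G_def structure_coord_def B.chart_inv_chart)
  also have "\<dots> = str j p (triv V j (?E y p)) (triv V j (?E f p)) +
      FD (\<lambda>x. triv V j (?E f (psi j x))) (phi j p) (rho j p (triv V j (?E y p))) -
      FD (\<lambda>x. triv V j (?E y (psi j x))) (phi j p) (rho j p (triv V j (?E f p)))"
    by (rule br_coord[OF E E j])
  finally show ?thesis unfolding tr unfolding Gp .
qed

end

section \<open>Derivatives along curves\<close>

lemma interval_limpt: "t0 < t1 \<Longrightarrow> t \<in> {t0..t1::real} \<Longrightarrow> at t within {t0..t1} \<noteq> bot"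
  by (auto simp: trivial_limit_within intro!: islimpt_closure_open[where s="{t0 <..< t1}"])

lemma within_window:
  "open W \<Longrightarrow> t \<in> W \<Longrightarrow> at t within {t0..t1} \<inter> W = at t within {t0..t1::real}"
  by (rule at_within_nhd[of _ W]) auto

lemma vector_derivative_cong_window:
  assumes "open W" "t \<in> W" "t \<in> {t0..t1::real}" "\<And>s. s \<in> {t0..t1} \<inter> W \<Longrightarrow> f s = g s"
  shows "vector_derivative f (at t within {t0..t1}) = vector_derivative g (at t within {t0..t1})"
proof -
  have "(f has_vector_derivative d) (at t within {t0..t1} \<inter> W) = (g has_vector_derivative d) (at t within {t0..t1} \<inter> W)" for d
    using assms has_derivative_transform[of t "{t0..t1} \<inter> W"] unfolding has_vector_derivative_def by (metis IntI)
  then show ?thesis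
    unfolding vector_derivative_def within_window[OF assms(1,2)] by simp
qed

lemma smooth_on_has_vector_derivative:
  assumes "smooth_on ({t0..t1} \<inter> W) f" "open W" "t \<in> W" "t \<in> {t0..t1::real}"
  shows "(f has_vector_derivative vector_derivative f (at t within {t0..t1})) (at t within {t0..t1})"
  using smooth_on_has_derivative[OF assms(1), of t] assms(3,4)
  unfolding within_window[OF assms(2,3)] vector_derivative_works[symmetric]
  by (auto simp: differentiable_def)

lemma smooth_on_vector_derivative:
  fixes f :: "real \<Rightarrow> 'b::real_inner"
  assumes f: "smooth_on ({t0..t1} \<inter> W) f" and t: "t0 < t1" and W: "open W"
  shows "smooth_on ({t0..t1} \<inter> W) (\<lambda>s. vector_derivative f (at s within {t0..t1}))"
proof (rule smooth_on_cong[THEN iffD1, OF _ smooth_on_Suc[OF f, of 1]])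
  fix s assume s: "s \<in> {t0..t1} \<inter> W"
  have "(f has_derivative (\<lambda>h. h *\<^sub>R vector_derivative f (at s within {t0..t1}))) (at s within {t0..t1} \<inter> W)"
    using smooth_on_has_vector_derivative[OF f W, of s] s within_window[OF W, of s t0 t1]
    by (simp add: has_vector_derivative_def)
  from uniq_diff_fd[OF uniq_diff_interval[OF t W] s this]
  show "frechet_derivative f (at s within {t0..t1} \<inter> W) 1 = vector_derivative f (at s within {t0..t1})" by simp
qed

lemma vector_derivative_Pair_within:
  assumes "t0 < t1" "t \<in> {t0..t1::real}"
    "(f has_vector_derivative a) (at t within {t0..t1})" "(g has_vector_derivative b) (at t within {t0..t1})"
  shows "vector_derivative (\<lambda>s. (f s, g s)) (at t within {t0..t1}) = (a, b)"
  by (rule vector_derivative_within[OF interval_limpt[OF assms(1,2)] has_vector_derivative_Pair[OF assms(3,4)]])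

lemma has_vector_derivative_compose_within:
  assumes "(F has_derivative D) (at (c t))" "(c has_vector_derivative v) (at t within S)"
  shows "((\<lambda>s. F (c s)) has_vector_derivative D v) (at t within S)"
proof -
  have "((\<lambda>s. F (c s)) has_derivative (\<lambda>h. D (h *\<^sub>R v))) (at t within S)"
    using has_derivative_compose[of c _ t S F D] assms unfolding has_vector_derivative_def by blast
  then show ?thesis
    unfolding has_vector_derivative_def by (simp add: linear_scale[OF has_derivative_linear[OF assms(1)]])
qed

text \<open>By continuity the times at which the curve lies in a chart domain are relatively open in
  the interval; \<open>W\<close> is an open set of reals cutting them out. All calculus along curves
  is done on such windows.\<close>

lemma smooth_curve_window:
  assumes "atlas M" "smooth_curve M t0 t1 c" "i \<in> idx M"
  obtains W where "open W" "{s \<in> {t0..t1}. c s \<in> chart_dom M i} = {t0..t1} \<inter> W"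
    "smooth_on ({t0..t1} \<inter> W) (\<lambda>s. chart M i (c s))"
proof -
  have "continuous_map (top_of_set {t0..t1}) (manifold_topology M) c"
    using assms(2) by (simp add: smooth_curve_def)
  from openin_continuous_map_preimage[OF this atlas.openin_chart_dom[OF assms(1,3)]]
  obtain W where W: "open W" "{s \<in> {t0..t1}. c s \<in> chart_dom M i} = {t0..t1} \<inter> W"
    by (auto simp: openin_open)
  have "smooth_on {s \<in> {t0..t1}. c s \<in> chart_dom M i} (\<lambda>s. chart M i (c s))"
    using assms(2,3) unfolding smooth_curve_def by blast
  with W show ?thesis by (intro that[of W]) simp_all
qed

text \<open>Continuity into the manifold follows from the windows: the preimage of a generating set
  is open within the window of its chart, where the curve is continuous in coordinates.\<close>

lemma (in atlas) smooth_curveI: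
  assumes "\<And>t. t \<in> {t0..t1} \<Longrightarrow> c t \<in> pts M"
    and "\<And>i. i \<in> idx M \<Longrightarrow> \<exists>W. open W \<and> {s \<in> {t0..t1}. c s \<in> chart_dom M i} = {t0..t1} \<inter> W \<and>
      smooth_on ({t0..t1} \<inter> W) (\<lambda>s. chart M i (c s))"
  shows "smooth_curve M t0 t1 c"
  unfolding smooth_curve_def
proof (intro conjI ballI)
  show "c \<in> {t0..t1} \<rightarrow> pts M" using assms(1) by auto
  show "smooth_on {t \<in> {t0..t1}. c t \<in> chart_dom M i} (\<lambda>t. chart M i (c t))" if "i \<in> idx M" for i
    using assms(2)[OF that] by metis
  show "continuous_map (top_of_set {t0..t1}) (manifold_topology M) c"
    unfolding manifold_topology_def
  proof (rule continuous_on_generated_topo)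
    fix U assume "U \<in> {chart_dom M i \<inter> chart M i -` W | i W. i \<in> idx M \<and> open W}"
    then obtain i W where U: "U = chart_dom M i \<inter> chart M i -` W" and i: "i \<in> idx M" and W: "open W" by blast
    obtain W' where W': "open W'" "{s \<in> {t0..t1}. c s \<in> chart_dom M i} = {t0..t1} \<inter> W'"
      "smooth_on ({t0..t1} \<inter> W') (\<lambda>s. chart M i (c s))" using assms(2)[OF i] by blast
    have "continuous_on ({t0..t1} \<inter> W') (\<lambda>s. chart M i (c s))" by (rule smooth_on_continuous[OF W'(3)])
    then obtain Q where Q: "open Q" "Q \<inter> ({t0..t1} \<inter> W') = (\<lambda>s. chart M i (c s)) -` W \<inter> ({t0..t1} \<inter> W')"
      using W unfolding continuous_on_open_invariant by blast
    have "c -` U \<inter> {t0..t1} = {s \<in> {t0..t1}. c s \<in> chart_dom M i} \<inter> (\<lambda>s. chart M i (c s)) -` W"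
      unfolding U by auto
    also have "\<dots> = {t0..t1} \<inter> (Q \<inter> W')" using W'(2) Q(2) by auto
    finally show "openin (top_of_set {t0..t1}) (c -` U \<inter> topspace (top_of_set {t0..t1}))"
      using Q(1) W'(1) by (auto simp: openin_open)
  next
    show "c ` topspace (top_of_set {t0..t1}) \<subseteq> \<Union> {chart_dom M i \<inter> chart M i -` W | i W. i \<in> idx M \<and> open W}"
      unfolding topology_generated_by_topspace[symmetric] manifold_topology_def[symmetric] topspace_manifold_topology
      using assms(1) by auto
  qed
qed

text \<open>The chain rule holds for derivatives within the interval, one-sided ones included, so
  velocities obey the transition law. The sets \<open>W\<close> ensure that the two coordinate
  expressions are compared only where both charts are defined.\<close>

lemma (in atlas) velocity_tangent:
  assumes t: "t0 < t1" "t \<in> {t0..t1}" and c: "c t \<in> pts M"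
    and W: "\<And>i. i \<in> idx M \<Longrightarrow> c t \<in> chart_dom M i \<Longrightarrow> \<exists>W. open W \<and> t \<in> W \<and> (\<forall>s\<in>{t0..t1} \<inter> W. c s \<in> chart_dom M i)"
    and D: "\<And>i. i \<in> idx M \<Longrightarrow> c t \<in> chart_dom M i \<Longrightarrow>
      ((\<lambda>s. chart M i (c s)) has_vector_derivative d i) (at t within {t0..t1})"
  shows "velocity M t0 t1 c t \<in> tot (tangent_bundle M)"
  unfolding mem_tangent_bundle
proof (intro conjI ballI allI impI)
  show "fst (velocity M t0 t1 c t) \<in> pts M" using c by (simp add: velocity_def)
  fix i j assume i: "i \<in> idx M" and j: "j \<in> idx M" and "fst (velocity M t0 t1 c t) \<in> chart_dom M i \<inter> chart_dom M j"
  then have ij: "c t \<in> chart_dom M i" "c t \<in> chart_dom M j" by (auto simp: velocity_def)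
  obtain W1 W2 where W12: "open W1" "t \<in> W1" "\<And>s. s \<in> {t0..t1} \<inter> W1 \<Longrightarrow> c s \<in> chart_dom M i"
     "open W2" "t \<in> W2" "\<And>s. s \<in> {t0..t1} \<inter> W2 \<Longrightarrow> c s \<in> chart_dom M j" using W i j ij by metis
  let ?\<tau> = "\<lambda>x. chart M j (chart_inv M i x)"
  have "((\<lambda>s. ?\<tau> (chart M i (c s))) has_vector_derivative FD ?\<tau> (chart M i (c t)) (d i)) (at t within {t0..t1})"
    by (rule has_vector_derivative_compose_within[OF transition_has_derivative[OF i j ij] D[OF i ij(1)]])
  from vector_derivative_within[OF interval_limpt[OF t] this]
  have "vector_derivative (\<lambda>s. ?\<tau> (chart M i (c s))) (at t within {t0..t1}) = FD ?\<tau> (chart M i (c t)) (d i)" .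
  moreover have "vector_derivative (\<lambda>s. ?\<tau> (chart M i (c s))) (at t within {t0..t1}) = vector_derivative (\<lambda>s. chart M j (c s)) (at t within {t0..t1})"
    by (rule vector_derivative_cong_window[of "W1 \<inter> W2"]) (use W12 t i in \<open>auto simp: chart_inv_chart\<close>)
  moreover have "vector_derivative (\<lambda>s. chart M i (c s)) (at t within {t0..t1}) = d i"
    by (rule vector_derivative_within[OF interval_limpt[OF t] D[OF i ij(1)]])
  ultimately show "snd (velocity M t0 t1 c t) j =
      FD ?\<tau> (chart M i (fst (velocity M t0 t1 c t))) (snd (velocity M t0 t1 c t) i)"
    using i j ij by (simp add: velocity_def)
qed (auto simp: velocity_def)

text \<open>The hypotheses concern \<open>F\<close> near a single point and in one source chart, so
  the lemma applies to sections and to \<open>lambda V A L\<close> directly from their coordinate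
  expressions.\<close>

lemma (in atlas) tangent_map_tangent:
  fixes N :: "('j, 'b, 'n::finite_dim_inner) manifold"
  assumes N: "atlas N" and w: "w \<in> tot (tangent_bundle M)" and i: "i \<in> idx M" "fst w \<in> chart_dom M i"
    and F: "F (fst w) \<in> pts N"
    and Q: "\<And>k. k \<in> idx N \<Longrightarrow> F (fst w) \<in> chart_dom N k \<Longrightarrow>
      \<exists>Q. open Q \<and> chart M i (fst w) \<in> Q \<and> (\<forall>x\<in>Q. F (chart_inv M i x) \<in> chart_dom N k)"
    and D: "\<And>k. k \<in> idx N \<Longrightarrow> F (fst w) \<in> chart_dom N k \<Longrightarrow>
      ((\<lambda>x. chart N k (F (chart_inv M i x))) has_derivative D k) (at (chart M i (fst w)))"
  shows "tangent_map M N F w \<in> tot (tangent_bundle N)"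
  unfolding atlas.mem_tangent_bundle[OF N] fst_tangent_map
proof (intro conjI ballI allI impI)
  interpret N: atlas N by fact
  fix j k assume j: "j \<in> idx N" and k: "k \<in> idx N" and "F (fst w) \<in> chart_dom N j \<inter> chart_dom N k"
  then have jk: "F (fst w) \<in> chart_dom N j" "F (fst w) \<in> chart_dom N k" by auto
  obtain Q1 where Q1: "open Q1" "chart M i (fst w) \<in> Q1" "\<And>x. x \<in> Q1 \<Longrightarrow> F (chart_inv M i x) \<in> chart_dom N j"
    using Q[OF j jk(1)] by blast
  let ?\<tau> = "\<lambda>x. chart N k (chart_inv N j x)"
  have eq: "chart_inv M i (chart M i (fst w)) = fst w" by (rule chart_inv_chart[OF i])
  have "((\<lambda>x. ?\<tau> (chart N j (F (chart_inv M i x)))) has_derivative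
      (\<lambda>u. FD ?\<tau> (chart N j (F (fst w))) (D j u))) (at (chart M i (fst w)))"
    by (rule has_derivative_compose[OF D[OF j jk(1)]]) (simp add: eq N.transition_has_derivative[OF j k jk])
  then have Dk: "((\<lambda>x. chart N k (F (chart_inv M i x))) has_derivative
      (\<lambda>u. FD ?\<tau> (chart N j (F (fst w))) (D j u))) (at (chart M i (fst w)))"
    by (rule has_derivative_transform_within_open[OF _ Q1(1,2)]) (use Q1 j in \<open>simp add: N.chart_inv_chart\<close>)
  show "snd (tangent_map M N F w) k = FD ?\<tau> (chart N j (F (fst w))) (snd (tangent_map M N F w) j)"
    unfolding tangent_map_eq[where N=N, OF w i j jk(1) D[OF j jk(1)]] by (rule tangent_map_eq[OF w i k jk(2) Dk])
next
  show "F (fst w) \<in> pts N" by fact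
qed (auto simp: tangent_map_def case_prod_unfold Let_def)


section \<open>The Euler-Lagrange equation in coordinates\<close>

context vbun
begin

abbreviation Z :: "'i \<Rightarrow> ('m \<times> 'k) set" where "Z i \<equiv> B.img i \<times> UNIV"

lemma open_Z: "i \<in> ind \<Longrightarrow> open (Z i)"
  by (intro open_Times B.open_img open_UNIV)

lemma uniq_Z: "i \<in> ind \<Longrightarrow> uniq_diff (Z i)"
  by (rule uniq_diff_open[OF open_Z])

lemma smooth_fst_Z: "i \<in> ind \<Longrightarrow> smooth_on (Z i) fst"
  using smooth_on_fst[OF uniq_Z smooth_on_ident[OF uniq_Z]] by simp

lemma smooth_snd_Z: "i \<in> ind \<Longrightarrow> smooth_on (Z i) snd"
  using smooth_on_snd[OF uniq_Z smooth_on_ident[OF uniq_Z]] by simp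

text \<open>The fibre component of a tangent vector of \<open>E\<close> mixes with its base velocity
  through the \<open>x\<close>-derivative of the transition. For vertical vectors the mixed term
  drops out; for variations it must be matched.\<close>

lemma total_transition_has_derivative:
  assumes i: "i \<in> ind" "p \<in> dom i" and j: "j \<in> ind" "p \<in> dom j"
  defines "G \<equiv> \<lambda>x y. triv V j (from_triv V i (psi i x) y)"
  shows "((\<lambda>z. chart (total_space V) j (chart_inv (total_space V) i z)) has_derivative
    (\<lambda>w. (FD (\<lambda>x. phi j (psi i x)) (phi i p) (fst w),
      FD (\<lambda>x. G x y) (phi i p) (fst w) + G (phi i p) (snd w)))) (at (phi i p, y))"
proof -
  let ?S = "phi i ` (dom i \<inter> dom j)"
  have S: "open ?S" "phi i p \<in> ?S" using B.open_overlap[OF i(1) j(1)] i j by auto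
  have 1: "((\<lambda>z. G (fst z) (snd z)) has_derivative (\<lambda>w. FD (\<lambda>x. G x y) (phi i p) (fst w) + G (phi i p) (snd w)))
    (at (phi i p, y))"
    unfolding G_def
    by (rule linear_family_has_derivative[OF S _ transition_smooth[OF i(1) j(1)]])
      (use i j in \<open>auto simp: B.chart_inv_chart intro!: transition_linear\<close>)
  have 2: "((\<lambda>z. phi j (psi i (fst z))) has_derivative (\<lambda>w. FD (\<lambda>x. phi j (psi i x)) (phi i p) (fst w)))
    (at (phi i p, y))"
    by (rule has_derivative_compose[OF has_derivative_fst[OF has_derivative_ident]])
      (simp add: B.transition_has_derivative[OF i(1) j(1) i(2) j(2)])
  show ?thesis
    by (rule has_derivative_transform_within_open[OF has_derivative_Pair[OF 2 1] open_Times[OF S(1) open_UNIV]])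
      (use S i j in \<open>auto simp: total_chart_inv B.chart_inv_chart G_def\<close>)
qed

lemma vertical_tangent:
  assumes e: "e \<in> tot V" and e': "e' \<in> fibre V (proj V e)"
  shows "vertical V e e' \<in> tot (tangent_bundle (total_space V))"
  unfolding T.mem_tangent_bundle
proof (intro conjI ballI allI impI)
  show "fst (vertical V e e') \<in> pts (total_space V)" using e by (simp add: vertical_def)
  fix i j assume "i \<in> idx (total_space V)" "j \<in> idx (total_space V)"
    and "fst (vertical V e e') \<in> chart_dom (total_space V) i \<inter> chart_dom (total_space V) j"
  then have i: "i \<in> ind" "proj V e \<in> dom i" and j: "j \<in> ind" "proj V e \<in> dom j" by (auto simp: vertical_def)
  have l: "linear (FD (\<lambda>x. phi j (psi i x)) (phi i (proj V e)))"
    by (rule has_derivative_linear[OF B.transition_has_derivative[OF i(1) j(1) i(2) j(2)]])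
  have "smooth_on (phi i ` (dom i \<inter> dom j)) (\<lambda>x. triv V j (from_triv V i (psi i x) (triv V i e)))"
    by (rule transition_smooth[OF i(1) j(1)])
  from smooth_on_has_derivative_at[OF B.open_overlap[OF i(1) j(1)] this, of "phi i (proj V e)"] i j
  have l': "linear (FD (\<lambda>x. triv V j (from_triv V i (psi i x) (triv V i e))) (phi i (proj V e)))"
    by (intro has_derivative_linear) auto
  show "snd (vertical V e e') j = FD (\<lambda>x. chart (total_space V) j (chart_inv (total_space V) i x)) (chart (total_space V) i (fst (vertical V e e'))) (snd (vertical V e e') i)"
    using frechet_derivative_at[OF total_transition_has_derivative[OF i j, of "triv V i e"], symmetric]
      i j e' from_triv_triv[OF i(1), of e'] linear_0[OF l] linear_0[OF l']
    by (simp add: vertical_def fibre_def B.chart_inv_chart)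
qed (use e in \<open>auto simp: vertical_def\<close>)

end

context algd
begin

text \<open>
  \<open>mom\<close> is \<open>\<partial>L/\<partial>y\<close> and \<open>force\<close> the right-hand side of the Euler--Lagrange equation, in the chart \<open>i\<close>
  at \<open>z = (x, y)\<close>.
\<close>

definition ell :: "('e \<Rightarrow> real) \<Rightarrow> 'i \<Rightarrow> 'm \<times> 'k \<Rightarrow> real" where
  "ell L i z = L (chart_inv (total_space V) i z)"

definition dell :: "('e \<Rightarrow> real) \<Rightarrow> 'i \<Rightarrow> 'm \<times> 'k \<Rightarrow> 'm \<times> 'k \<Rightarrow> real" where
  "dell L i z = FD (ell L i) z"

definition mom :: "('e \<Rightarrow> real) \<Rightarrow> 'i \<Rightarrow> 'm \<times> 'k \<Rightarrow> 'k" where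
  "mom L i z = (\<Sum>b\<in>onb. dell L i z (0, b) *\<^sub>R b)"

definition force :: "('e \<Rightarrow> real) \<Rightarrow> 'i \<Rightarrow> 'm \<times> 'k \<Rightarrow> 'k" where
  "force L i z = (\<Sum>b\<in>onb. (mom L i z \<bullet> str i (psi i (fst z)) (snd z) b + dell L i z (rho i (psi i (fst z)) b, 0)) *\<^sub>R b)"

definition rhoc :: "'i \<Rightarrow> 'm \<times> 'k \<Rightarrow> 'm" where
  "rhoc i z = rho i (psi i (fst z)) (snd z)"

lemma rhoc_smooth: "i \<in> ind \<Longrightarrow> smooth_on (Z i) (rhoc i)"
  using rho_smooth by (simp add: rhoc_def[abs_def])

lemma rho_smooth_coeff:
  assumes "i \<in> ind" shows "smooth_on (B.img i) (\<lambda>x. rho i (psi i x) y)"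
proof -
  have u: "uniq_diff (B.img i)" by (rule uniq_diff_open[OF B.open_img[OF assms]])
  have "smooth_on (B.img i) (\<lambda>x. rhoc i (x, y))"
    by (rule smooth_on_compose[OF u uniq_Z[OF assms] rhoc_smooth[OF assms]])
      (auto intro!: smooth_on_Pair smooth_on_ident smooth_on_const u)
  then show ?thesis by (simp add: rhoc_def)
qed

lemma rhoc_has_derivative:
  assumes "i \<in> ind" "x \<in> B.img i"
  shows "(rhoc i has_derivative (\<lambda>w. FD (\<lambda>x. rho i (psi i x) y) x (fst w) + rho i (psi i x) (snd w))) (at (x, y))"
  unfolding rhoc_def[abs_def]
  by (rule linear_family_has_derivative[OF B.open_img[OF assms(1)] assms(2) _ rho_smooth_coeff[OF assms(1)]])
    (use assms B.chart_inv_mem in \<open>auto intro!: rho_linear\<close>)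

context
  fixes L :: "'e \<Rightarrow> real"
  assumes smL: "smooth_fun (total_space V) L"
begin

lemma ell_smooth: "i \<in> ind \<Longrightarrow> smooth_on (Z i) (ell L i)"
  using smL unfolding smooth_fun_def ell_def[abs_def] by (metis total_img total_space_simps(2))

lemma ell_has_derivative: "i \<in> ind \<Longrightarrow> z \<in> Z i \<Longrightarrow> (ell L i has_derivative dell L i z) (at z)"
  unfolding dell_def by (rule smooth_on_has_derivative_at[OF open_Z ell_smooth])

lemma dell_linear: "i \<in> ind \<Longrightarrow> z \<in> Z i \<Longrightarrow> linear (dell L i z)"
  by (rule has_derivative_linear[OF ell_has_derivative])

lemma dell_smooth: "i \<in> ind \<Longrightarrow> smooth_on (Z i) (\<lambda>z. dell L i z w)"
  unfolding dell_def by (rule smooth_on_deriv_const[OF open_Z ell_smooth])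

lemma mom_inner:
  assumes "i \<in> ind" "z \<in> Z i" shows "mom L i z \<bullet> f = dell L i z (0, f)"
  unfolding mom_def
  by (rule riesz_onb) (use linear_compose[OF _ dell_linear[OF assms], of "\<lambda>f. (0, f)"] in
      \<open>simp add: o_def bounded_linear.linear bounded_linear_Pair bounded_linear_ident bounded_linear_zero\<close>)

lemma force_linear:
  assumes "i \<in> ind" "z \<in> Z i"
  shows "linear (\<lambda>f. mom L i z \<bullet> str i (psi i (fst z)) (snd z) f + dell L i z (rho i (psi i (fst z)) f, 0))"
proof (rule linear_compose_add)
  have q: "psi i (fst z) \<in> dom i" using assms B.chart_inv_mem by auto
  show "linear (\<lambda>f. mom L i z \<bullet> str i (psi i (fst z)) (snd z) f)"
    using linear_compose[OF str_linear_right[OF assms(1) q] bounded_linear.linear[OF bounded_linear_inner_right]]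
    by (simp add: o_def)
  have "linear (\<lambda>u. (u, 0) :: 'm \<times> 'k)"
    by (intro bounded_linear.linear bounded_linear_Pair bounded_linear_ident bounded_linear_zero)
  from linear_compose[OF linear_compose[OF rho_linear[OF assms(1) q] this] dell_linear[OF assms]]
  show "linear (\<lambda>f. dell L i z (rho i (psi i (fst z)) f, 0))" by (simp add: o_def)
qed

lemma force_inner:
  assumes "i \<in> ind" "z \<in> Z i"
  shows "force L i z \<bullet> f = mom L i z \<bullet> str i (psi i (fst z)) (snd z) f + dell L i z (rho i (psi i (fst z)) f, 0)"
  unfolding force_def by (rule riesz_onb[OF force_linear[OF assms]])

lemma mom_smooth: "i \<in> ind \<Longrightarrow> smooth_on (Z i) (mom L i)"
  unfolding mom_def[abs_def]
  by (intro smooth_on_sum smooth_on_scaleR smooth_on_const uniq_Z dell_smooth)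

lemma force_smooth:
  assumes i: "i \<in> ind" shows "smooth_on (Z i) (force L i)"
proof -
  note u = uniq_Z[OF i]
  have "smooth_on (Z i) (\<lambda>z. rho i (psi i (fst z)) b)" for b
    by (rule smooth_on_compose[OF u uniq_diff_open[OF B.open_img[OF i]] rho_smooth_coeff[OF i] smooth_fst_Z[OF i]]) auto
  then have "smooth_on (Z i) (\<lambda>z. dell L i z (rho i (psi i (fst z)) b, 0))" for b
    unfolding dell_def
    by (intro smooth_on_deriv_apply[OF u open_Z[OF i] ell_smooth[OF i]] smooth_on_ident smooth_on_Pair smooth_on_const u) auto
  then show ?thesis
    unfolding force_def[abs_def]
    by (intro smooth_on_sum smooth_on_scaleR smooth_on_add smooth_on_inner smooth_on_const u mom_smooth i
        str_smooth smooth_fst_Z smooth_snd_Z) auto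
qed

section \<open>The fibre derivative of \<open>L\<close> and \<open>Lambda\<close> in
  coordinates\<close>

lemma total_chart_mem: "i \<in> ind \<Longrightarrow> e \<in> tot V \<Longrightarrow> proj V e \<in> dom i \<Longrightarrow> (phi i (proj V e), triv V i e) \<in> Z i"
  by auto

lemma dT_fun_coord:
  assumes "w \<in> tot (tangent_bundle (total_space V))" "i \<in> ind" "proj V (fst w) \<in> dom i"
  shows "dT_fun (total_space V) L w = dell L i (phi i (proj V (fst w)), triv V i (fst w)) (snd w i)"
proof -
  have "fst w \<in> tot V" using T.tangent_fst[OF assms(1)] by simp
  then show ?thesis
    using T.dT_fun_eq[OF assms(1), of i L] ell_has_derivative[OF assms(2) total_chart_mem[OF assms(2) _ assms(3)]] assms
    by (simp add: ell_def[abs_def])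
qed

text \<open>\<open>differential\<close> is 0 by default off the tangent space at \<open>e\<close>;
  vertical vectors at \<open>e\<close> lie in that space, so this default is not met.\<close>

lemma lambda_eq:
  assumes e: "e \<in> tot V"
  shows "lambda V A L e = (proj V e, \<lambda>e'. if e' \<in> fibre V (proj V e) then dT_fun (total_space V) L (vertical V e e') else 0)"
proof -
  have "vertical V e e' \<in> fibre (tangent_bundle (total_space V)) e" if "e' \<in> fibre V (proj V e)" for e'
    using vertical_tangent[OF e that] by (simp add: fibre_def vertical_def)
  then show ?thesis by (auto simp: lambda_def Lambda_def eps_def differential_def Let_def)
qed

lemma lambda_coord:
  assumes e: "e \<in> tot V" and i: "i \<in> ind" "proj V e \<in> dom i"
  shows "lambda V A L e \<in> tot (dual_bundle V)" "fst (lambda V A L e) = proj V e"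
    "triv (dual_bundle V) i (lambda V A L e) = mom L i (phi i (proj V e), triv V i e)"
proof -
  have eq: "dT_fun (total_space V) L (vertical V e e') = mom L i (phi i (proj V e), triv V i e) \<bullet> triv V i e'"
    if "e' \<in> fibre V (proj V e)" for e'
    unfolding mom_inner[OF i(1) total_chart_mem[OF i(1) e i(2)]]
    using dT_fun_coord[OF vertical_tangent[OF e that] i(1)] i by (simp add: vertical_def)
  show "lambda V A L e \<in> tot (dual_bundle V)" unfolding lambda_eq[OF e]
    by (rule mem_dualI[OF i, where z="mom L i (phi i (proj V e), triv V i e)"]) (simp_all add: eq)
  show "triv (dual_bundle V) i (lambda V A L e) = mom L i (phi i (proj V e), triv V i e)" unfolding lambda_eq[OF e]
    by (rule dual_triv_eq[OF i]) (simp add: eq)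
  show "fst (lambda V A L e) = proj V e" by (simp add: lambda_eq[OF e])
qed

lemma fst_Lambda: "fst (Lambda V A L e) = lambda V A L e"
  by (simp add: lambda_def)

lemma Lambda_coord:
  assumes e: "e \<in> tot V" and i: "i \<in> ind" "proj V e \<in> dom i"
  shows "snd (Lambda V A L e) i = (rho i (proj V e) (triv V i e), force L i (phi i (proj V e), triv V i e))"
proof -
  let ?z = "(phi i (proj V e), triv V i e)"
  have z: "?z \<in> Z i" by (rule total_chart_mem[OF i(1) e i(2)])
  let ?TT = "tangent_bundle (total_space V)"
  let ?\<omega> = "\<lambda>w. if w \<in> fibre ?TT e then dT_fun (total_space V) L w else 0"
  let ?g = "\<Sum>b\<in>onb. dell L i ?z b *\<^sub>R b"
  have g: "?g \<bullet> w = dell L i ?z w" for w by (rule riesz_onb[OF dell_linear[OF i(1) z]])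
  have w: "?\<omega> w = dell L i ?z (snd w i)" if "w \<in> fibre ?TT e" for w
    using that dT_fun_coord[of w i] i by (auto simp: fibre_def)
  \<comment> \<open>The cotangent coordinates of \<open>dL\<close> are its gradient in the chart.
    Uniqueness holds because every coordinate vector \<open>u\<close> comes from some tangent vector
    at \<open>e\<close>.\<close>
  have "(THE g. \<forall>w\<in>fibre ?TT e. ?\<omega> w = g \<bullet> triv ?TT i w) = ?g"
  proof (rule the_equality)
    fix g' assume g': "\<forall>w\<in>fibre ?TT e. ?\<omega> w = g' \<bullet> triv ?TT i w"
    have "g' \<bullet> u = ?g \<bullet> u" for u
    proof -
      obtain w' where w': "w' \<in> tot ?TT" "fst w' = e" "snd w' i = u"
        using T.tangent_vector_exists[of i e u] i e by auto
      then have f: "w' \<in> fibre ?TT e" by (simp add: fibre_def)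
      have "?\<omega> w' = g' \<bullet> triv ?TT i w'" using g' f by blast
      then show ?thesis using w[OF f] w'(3) g[of u] by simp
    qed
    then have "\<forall>u. g' \<bullet> u = ?g \<bullet> u" by blast
    then show "g' = ?g" by (simp only: vector_eq_rdot)
  qed (use w g in auto)
  then have tr: "triv (cotangent_bundle (total_space V)) i (e, ?\<omega>) = ?g"
    by (simp add: dual_bundle_def)
  \<comment> \<open>The two components of \<open>?g\<close> are the partial derivatives of
    \<open>L\<close> along base and fibre, the \<open>p\<close> and \<open>\<pi>\<close> in the
    definition of \<open>eps\<close>.\<close>
  have fg: "fst ?g \<bullet> u = dell L i ?z (u, 0)" for u using g[of "(u, 0)"] by (simp add: inner_prod_def)
  have sg: "snd ?g = mom L i ?z"
  proof -
    have "snd ?g \<bullet> u = mom L i ?z \<bullet> u" for u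
      using g[of "(0, u)"] mom_inner[OF i(1) z, of u] by (simp add: inner_prod_def)
    then have "\<forall>u. snd ?g \<bullet> u = mom L i ?z \<bullet> u" by blast
    then show ?thesis by (simp only: vector_eq_rdot)
  qed
  have p: "psi i (phi i (proj V e)) = proj V e" by (rule B.chart_inv_chart[OF i])
  have "(THE z. \<forall>f. z \<bullet> f = snd ?g \<bullet> str i (proj V e) (triv V i e) f + fst ?g \<bullet> rho i (proj V e) f) = force L i ?z"
    unfolding fg sg using riesz_the[OF force_linear[OF i(1) z]] by (simp add: force_def p)
  then show ?thesis
    using i tr by (simp add: Lambda_def eps_def differential_def Let_def case_prod_unfold)
qed

lemma Lambda_outside:
  "e \<in> tot V \<Longrightarrow> \<not> (i \<in> ind \<and> proj V e \<in> dom i) \<Longrightarrow> snd (Lambda V A L e) i = 0"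
  by (auto simp: Lambda_def eps_def differential_def Let_def)

text \<open>The equation compares families over all indices. Where there is no chart around the base
  point both sides are 0; elsewhere the pair splits into admissibility and the momentum
  equation.\<close>

lemma EL_solution_coord:
  assumes t: "t0 < t1" and \<gamma>: "smooth_curve (total_space V) t0 t1 \<gamma>"
  shows "EL_solution V A L t0 t1 \<gamma> \<longleftrightarrow> (\<forall>t\<in>{t0..t1}. \<forall>i\<in>ind. proj V (\<gamma> t) \<in> dom i \<longrightarrow>
     vector_derivative (\<lambda>s. phi i (proj V (\<gamma> s))) (at t within {t0..t1}) = rhoc i (phi i (proj V (\<gamma> t)), triv V i (\<gamma> t)) \<and>
     vector_derivative (\<lambda>s. mom L i (phi i (proj V (\<gamma> s)), triv V i (\<gamma> s))) (at t within {t0..t1}) =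
       force L i (phi i (proj V (\<gamma> t)), triv V i (\<gamma> t)))"
  (is "_ \<longleftrightarrow> (\<forall>t\<in>_. \<forall>i\<in>_. _ \<longrightarrow> ?P t i)")
proof -
  have tot: "\<gamma> t \<in> tot V" if "t \<in> {t0..t1}" for t using \<gamma> that by (auto simp: smooth_curve_def)
  let ?N = "total_space (dual_bundle V)"
  have co: "vector_derivative (\<lambda>s. chart ?N i (lambda V A L (\<gamma> s))) (at t within {t0..t1}) =
      (vector_derivative (\<lambda>s. phi i (proj V (\<gamma> s))) (at t within {t0..t1}),
       vector_derivative (\<lambda>s. mom L i (phi i (proj V (\<gamma> s)), triv V i (\<gamma> s))) (at t within {t0..t1}))"
    if s: "t \<in> {t0..t1}" and i: "i \<in> ind" "proj V (\<gamma> t) \<in> dom i" for t i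
  proof -
    obtain W where W: "open W" "{s \<in> {t0..t1}. \<gamma> s \<in> chart_dom (total_space V) i} = {t0..t1} \<inter> W"
      "smooth_on ({t0..t1} \<inter> W) (\<lambda>s. chart (total_space V) i (\<gamma> s))"
      using smooth_curve_window[OF T.atlas_axioms \<gamma>, of i] i by auto
    have W': "proj V (\<gamma> s) \<in> dom i" if "s \<in> {t0..t1} \<inter> W" for s
      using that unfolding W(2)[symmetric] by simp
    have "t \<in> {s \<in> {t0..t1}. \<gamma> s \<in> chart_dom (total_space V) i}" using s i tot[OF s] by simp
    then have tW: "t \<in> W" unfolding W(2) by blast
    have u: "uniq_diff ({t0..t1} \<inter> W)" by (rule uniq_diff_interval[OF t W(1)])
    have "smooth_on ({t0..t1} \<inter> W) (\<lambda>s. mom L i (chart (total_space V) i (\<gamma> s)))"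
      by (rule smooth_on_compose[OF u uniq_Z[OF i(1)] mom_smooth[OF i(1)] W(3)]) (use W' in auto)
    moreover have "smooth_on ({t0..t1} \<inter> W) (\<lambda>s. phi i (proj V (\<gamma> s)))"
      using smooth_on_fst[OF u W(3)] by simp
    ultimately have "vector_derivative (\<lambda>s. (phi i (proj V (\<gamma> s)), mom L i (phi i (proj V (\<gamma> s)), triv V i (\<gamma> s)))) (at t within {t0..t1}) =
      (vector_derivative (\<lambda>s. phi i (proj V (\<gamma> s))) (at t within {t0..t1}),
       vector_derivative (\<lambda>s. mom L i (phi i (proj V (\<gamma> s)), triv V i (\<gamma> s))) (at t within {t0..t1}))"
      using W(1) tW s by (intro vector_derivative_Pair_within t s smooth_on_has_vector_derivative) auto
    moreover have "vector_derivative (\<lambda>s. chart ?N i (lambda V A L (\<gamma> s))) (at t within {t0..t1}) =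
      vector_derivative (\<lambda>s. (phi i (proj V (\<gamma> s)), mom L i (phi i (proj V (\<gamma> s)), triv V i (\<gamma> s)))) (at t within {t0..t1})"
      by (rule vector_derivative_cong_window[OF W(1) tW s]) (use W' tot i lambda_coord in auto)
    ultimately show ?thesis by simp
  qed
  have "velocity ?N t0 t1 (\<lambda>s. lambda V A L (\<gamma> s)) t = Lambda V A L (\<gamma> t) \<longleftrightarrow> (\<forall>i\<in>ind. proj V (\<gamma> t) \<in> dom i \<longrightarrow>
     ?P t i)" if s: "t \<in> {t0..t1}" for t
  proof -
    have "velocity ?N t0 t1 (\<lambda>s. lambda V A L (\<gamma> s)) t = Lambda V A L (\<gamma> t) \<longleftrightarrow>
      (\<forall>i. snd (velocity ?N t0 t1 (\<lambda>s. lambda V A L (\<gamma> s)) t) i = snd (Lambda V A L (\<gamma> t)) i)"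
    proof -
      have "fst (velocity ?N t0 t1 (\<lambda>s. lambda V A L (\<gamma> s)) t) = fst (Lambda V A L (\<gamma> t))"
        by (simp add: fst_Lambda velocity_def)
      then show ?thesis by (subst prod_eq_iff) (simp only: fun_eq_iff simp_thms)
    qed
    also have "\<dots> \<longleftrightarrow> (\<forall>i. i \<in> ind \<and> proj V (\<gamma> t) \<in> dom i \<longrightarrow>
       snd (velocity ?N t0 t1 (\<lambda>s. lambda V A L (\<gamma> s)) t) i = snd (Lambda V A L (\<gamma> t)) i)"
    proof -
      have "snd (velocity ?N t0 t1 (\<lambda>s. lambda V A L (\<gamma> s)) t) i = 0"
        if "\<not> (i \<in> ind \<and> proj V (\<gamma> t) \<in> dom i)" for i
        using that lambda_eq[OF tot[OF s]] by (auto simp: velocity_def)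
      then show ?thesis using Lambda_outside[OF tot[OF s]] by metis
    qed
    also have "\<dots> \<longleftrightarrow> (\<forall>i. i \<in> ind \<and> proj V (\<gamma> t) \<in> dom i \<longrightarrow>
     ?P t i)"
    proof (intro all_cong1 imp_cong refl)
      fix i assume i: "i \<in> ind \<and> proj V (\<gamma> t) \<in> dom i"
      then have "snd (velocity ?N t0 t1 (\<lambda>s. lambda V A L (\<gamma> s)) t) i =
          vector_derivative (\<lambda>s. chart ?N i (lambda V A L (\<gamma> s))) (at t within {t0..t1})"
        using lambda_coord(1,2)[OF tot[OF s], of i] by (auto simp: velocity_def)
      then show "(snd (velocity ?N t0 t1 (\<lambda>s. lambda V A L (\<gamma> s)) t) i = snd (Lambda V A L (\<gamma> t)) i) =
        ?P t i"
        using co[OF s, of i] Lambda_coord[OF tot[OF s], of i] i by (simp add: rhoc_def B.chart_inv_chart)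
    qed
    finally show ?thesis by blast
  qed
  then show ?thesis using \<gamma> by (auto simp: EL_solution_def)
qed

end

end

section \<open>The tangent lift in coordinates\<close>

lemma tangent_lift_simps [simp]:
  "base (tangent_lift_bundle V) = tangent (base V)"
  "tot (tangent_lift_bundle V) = tot (tangent_bundle (total_space V))"
  "proj (tangent_lift_bundle V) = tangent_map (total_space V) (base V) (proj V)"
  "triv (tangent_lift_bundle V) i e = (triv V i (fst e), snd (snd e i))"
  by (simp_all add: tangent_lift_bundle_def case_prod_unfold)

lemma (in vbun) section_tangent_map:
  assumes F: "\<And>p. p \<in> pts (base V) \<Longrightarrow> F p \<in> tot V" "\<And>p. p \<in> pts (base V) \<Longrightarrow> proj V (F p) = p"
    and sm: "\<And>i. i \<in> ind \<Longrightarrow> smooth_on (B.img i) (\<lambda>x. triv V i (F (psi i x)))"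
    and w: "w \<in> tot (tangent_bundle (base V))"
  shows "tangent_map (base V) (total_space V) F w \<in> tot (tangent_bundle (total_space V))"
    and "i \<in> ind \<Longrightarrow> fst w \<in> dom i \<Longrightarrow> snd (tangent_map (base V) (total_space V) F w) i =
      (snd w i, FD (\<lambda>x. triv V i (F (psi i x))) (phi i (fst w)) (snd w i))"
proof -
  have D: "((\<lambda>x. chart (total_space V) k (F (psi k x))) has_derivative
      (\<lambda>v. (v, FD (\<lambda>x. triv V k (F (psi k x))) (phi k p) v))) (at (phi k p))"
    if k: "k \<in> ind" "p \<in> dom k" for k p
  proof -
    have "((\<lambda>x. (x, triv V k (F (psi k x)))) has_derivative
      (\<lambda>v. (v, FD (\<lambda>x. triv V k (F (psi k x))) (phi k p) v))) (at (phi k p))"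
      by (intro has_derivative_Pair has_derivative_ident smooth_on_has_derivative_at[OF B.open_img sm]) (use k in auto)
    then show ?thesis
      by (rule has_derivative_transform_within_open[OF _ B.open_img[OF k(1)]])
        (use k F B.dom_pts[OF k(1)] in \<open>auto simp: B.chart_inv_chart\<close>)
  qed
  note p = B.tangent_fst[OF w]
  define i0 where "i0 = chart_at (base V) (fst w)"
  have i0: "i0 \<in> ind" "fst w \<in> dom i0" using B.chart_at_mem[OF p] by (auto simp: i0_def)
  show "tangent_map (base V) (total_space V) F w \<in> tot (tangent_bundle (total_space V))"
  proof (rule B.tangent_map_tangent[OF T.atlas_axioms w i0])
    show "F (fst w) \<in> pts (total_space V)" using F p by simp
    fix k assume "k \<in> idx (total_space V)" "F (fst w) \<in> chart_dom (total_space V) k"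
    then have k: "k \<in> ind" "fst w \<in> dom k" using F p by auto
    show "\<exists>Q. open Q \<and> phi i0 (fst w) \<in> Q \<and> (\<forall>x\<in>Q. F (psi i0 x) \<in> chart_dom (total_space V) k)"
    proof (intro exI conjI ballI)
      show "open (phi i0 ` (dom i0 \<inter> dom k))" by (rule B.open_overlap[OF i0(1) k(1)])
      show "phi i0 (fst w) \<in> phi i0 ` (dom i0 \<inter> dom k)" using i0 k by auto
      show "F (psi i0 x) \<in> chart_dom (total_space V) k" if "x \<in> phi i0 ` (dom i0 \<inter> dom k)" for x
        using that i0 k F B.dom_pts[OF k(1)] by (auto simp: B.chart_inv_chart)
    qed
    show "((\<lambda>x. chart (total_space V) k (F (psi i0 x))) has_derivative
        (\<lambda>v. (\<lambda>v. (v, FD (\<lambda>x. triv V k (F (psi k x))) (phi k (fst w)) v))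
          (FD (\<lambda>x. phi k (psi i0 x)) (phi i0 (fst w)) v))) (at (phi i0 (fst w)))"
      by (rule B.has_derivative_change_chart[OF k(1) i0(1) k(2) i0(2) D[OF k]])
  qed
  assume i: "i \<in> ind" "fst w \<in> dom i"
  show "snd (tangent_map (base V) (total_space V) F w) i =
      (snd w i, FD (\<lambda>x. triv V i (F (psi i x))) (phi i (fst w)) (snd w i))"
    by (rule B.tangent_map_eq[OF w i _ _ D[OF i]]) (use i F p in auto)
qed

locale lift = algd V A
  for V :: "('i, 'a, 'm::finite_dim_inner, 'e, 'k::finite_dim_inner) vbundle"
    and A :: "('i, 'a, 'm, 'e) algebroid" +
  fixes A' :: "('i, ('i, 'a, 'm) tvec, 'm \<times> 'm, ('i, 'e, 'm \<times> 'k) tvec) algebroid"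
  assumes tl: "is_tangent_lift V A A'"
begin

abbreviation TV where "TV \<equiv> tangent_lift_bundle V"
abbreviation TE where "TE \<equiv> tangent_bundle (total_space V)"
abbreviation TM where "TM \<equiv> tangent_bundle (base V)"

sublocale TA: algd "tangent_lift_bundle V" A'
  using tl by (simp add: algd_def is_tangent_lift_def)

lemma lift_proj:
  assumes "e \<in> tot TE"
  shows "tangent_map (total_space V) (base V) (proj V) e \<in> tot TM" "fst e \<in> tot V" "proj V (fst e) \<in> pts (base V)"
    and "i \<in> ind \<Longrightarrow> proj V (fst e) \<in> dom i \<Longrightarrow>
      snd (tangent_map (total_space V) (base V) (proj V) e) i = fst (snd e i)"
proof -
  show "tangent_map (total_space V) (base V) (proj V) e \<in> tot TM" using TA.proj_pts[of e] assms by simp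
  show e: "fst e \<in> tot V" using T.tangent_fst[OF assms] by simp
  then show "proj V (fst e) \<in> pts (base V)" by (rule proj_pts)
  assume i: "i \<in> ind" "proj V (fst e) \<in> dom i"
  have "((\<lambda>z. phi i (proj V (chart_inv (total_space V) i z))) has_derivative fst) (at (chart (total_space V) i (fst e)))"
    by (rule has_derivative_transform_within_open[OF has_derivative_fst[OF has_derivative_ident] open_Z[OF i(1)]])
      (use i B.chart_inv_mem in \<open>auto simp: total_chart_inv B.chart_chart_inv\<close>)
  from T.tangent_map_eq[OF assms _ _ _ _ this] i e
  show "snd (tangent_map (total_space V) (base V) (proj V) e) i = fst (snd e i)" by simp
qed

lemma lift_img:
  assumes "i \<in> ind" shows "TA.B.img i = B.img i \<times> UNIV"
proof (intro equalityI subsetI)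
  fix z assume "z \<in> B.img i \<times> (UNIV :: 'm set)"
  then obtain p v where p: "p \<in> dom i" and z: "z = (phi i p, v)" by auto
  obtain w where "w \<in> tot TM" "fst w = p" "snd w i = v" using B.tangent_vector_exists[OF assms p] by blast
  then show "z \<in> TA.B.img i" using p z by (auto intro!: rev_image_eqI[of w])
qed auto

lemma lift_psi:
  assumes "i \<in> ind" "x \<in> B.img i"
  shows "TA.psi i (x, v) \<in> tot TM" "fst (TA.psi i (x, v)) = psi i x" "snd (TA.psi i (x, v)) i = v"
    "TA.psi i (x, v) \<in> TA.dom i"
proof -
  have "(x, v) \<in> TA.B.img i" using lift_img[OF assms(1)] assms(2) by simp
  note m = TA.B.chart_inv_mem[OF this] TA.B.chart_chart_inv[OF this]
  then show "TA.psi i (x, v) \<in> tot TM" "TA.psi i (x, v) \<in> TA.dom i" "snd (TA.psi i (x, v)) i = v" by auto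
  have "phi i (fst (TA.psi i (x, v))) = x" "fst (TA.psi i (x, v)) \<in> dom i" using m by auto
  then show "fst (TA.psi i (x, v)) = psi i x" using B.chart_inv_chart[OF assms(1)] by metis
qed

lemma lift_from_triv:
  assumes i: "i \<in> ind" "w \<in> tot TM" "fst w \<in> dom i"
  shows "from_triv TV i w u \<in> tot TE" "fst (from_triv TV i w u) = from_triv V i (fst w) (fst u)"
    "snd (from_triv TV i w u) i = (snd w i, snd u)"
proof -
  let ?e = "from_triv TV i w u"
  have w: "w \<in> TA.dom i" using i by simp
  have ft: "?e \<in> tot TE" "tangent_map (total_space V) (base V) (proj V) ?e = w"
    "(triv V i (fst ?e), snd (snd ?e i)) = u"
    using TA.from_triv[of i w u] i w by simp_all
  have p: "proj V (fst ?e) = fst w" using arg_cong[OF ft(2), of fst] by (simp add: T.fst_tangent_map)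
  show "?e \<in> tot TE" by (rule ft)
  show "fst ?e = from_triv V i (fst w) (fst u)"
    using from_triv_triv[OF i(1) lift_proj(2)[OF ft(1)]] p i(3) ft(3) by (metis fst_conv)
  show "snd ?e i = (snd w i, snd u)"
    using lift_proj(4)[OF ft(1) i(1)] p i(3) ft(2,3) by (metis prod.collapse snd_conv)
qed

text \<open>In coordinates the anchor is \<open>z \<mapsto> (fst z, rhoc i z)\<close>, and its
  tangent map appends the derivatives of both components. The flip exchanges the value of
  \<open>rhoc i\<close> with the base velocity, so that the value becomes the first component of the
  new velocity.\<close>

lemma lift_anchor:
  assumes e: "e \<in> tot TE" and i: "i \<in> ind" "proj V (fst e) \<in> dom i"
  defines "z \<equiv> (phi i (proj V (fst e)), triv V i (fst e))"
  shows "snd (anchor A' e) i = (rhoc i z, FD (rhoc i) z (snd e i))"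
proof -
  have e1: "fst e \<in> tot V" by (rule lift_proj[OF e])
  have z: "z \<in> Z i" unfolding z_def using i by auto
  have a: "anchor A' e = flip (tangent_map (total_space V) (tangent (base V)) (anchor A) e)"
    using tl e unfolding is_tangent_lift_def by simp
  have R: "(rhoc i has_derivative FD (rhoc i) z) (at z)"
    by (rule smooth_on_has_derivative_at[OF open_Z[OF i(1)] rhoc_smooth[OF i(1)] z])
  have D: "((\<lambda>z. chart (tangent (base V)) i (anchor A (chart_inv (total_space V) i z))) has_derivative
      (\<lambda>w. (fst w, FD (rhoc i) z w))) (at z)"
    by (rule has_derivative_transform_within_open[OF has_derivative_Pair[OF has_derivative_fst[OF has_derivative_ident] R]
          open_Z[OF i(1)] z])
      (use i B.chart_inv_mem[of _ i] anchor_tangent in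
        \<open>auto simp: total_chart_inv B.chart_chart_inv rhoc_def anchor_coord_def\<close>)
  have "snd (tangent_map (total_space V) (tangent (base V)) (anchor A) e) i =
      (fst (snd e i), FD (rhoc i) z (snd e i))"
  proof (rule T.tangent_map_eq[OF e])
    have "z = chart (total_space V) i (fst e)" by (simp add: z_def)
    from D[unfolded this] show "((\<lambda>z. chart (tangent (base V)) i (anchor A (chart_inv (total_space V) i z))) has_derivative
      (\<lambda>w. (fst w, FD (rhoc i) z w))) (at (chart (total_space V) i (fst e)))"
      by (simp add: z_def)
  qed (use i e1 anchor_tangent[OF e1] in simp_all)
  then show ?thesis unfolding a flip_def
    using anchor_coord_eq[OF i(1) e1 i(2)] i
    by (simp add: case_prod_unfold rhoc_def z_def B.chart_inv_chart)
qed

lemma lift_rho: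
  assumes i: "i \<in> ind" "w \<in> tot TM" "fst w \<in> dom i"
  shows "TA.rho i w u = (rho i (fst w) (fst u),
    FD (\<lambda>x. rho i (psi i x) (fst u)) (phi i (fst w)) (snd w i) + rho i (fst w) (snd u))"
proof -
  have x: "phi i (fst w) \<in> B.img i" using i by auto
  show ?thesis
    using lift_anchor[OF lift_from_triv(1)[OF i, of u] i(1)] lift_from_triv[OF i, of u] i
      frechet_derivative_at[OF rhoc_has_derivative[OF i(1) x, of "fst u"], symmetric]
    by (simp add: anchor_coord_def rhoc_def B.chart_inv_chart)
qed

section \<open>Lifted sections and the structure functions of the lift\<close>

lemma tangent_section_mem:
  assumes X: "X \<in> sections V"
  shows "tangent_section V X \<in> sections TV"
    and "i \<in> ind \<Longrightarrow> w \<in> tot TM \<Longrightarrow> fst w \<in> dom i \<Longrightarrow> triv TV i (tangent_section V X w) =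
      (triv V i (X (fst w)), FD (\<lambda>x. triv V i (X (psi i x))) (phi i (fst w)) (snd w i))"
proof -
  have tm: "tangent_map (base V) (total_space V) X w \<in> tot TE"
    "i \<in> ind \<Longrightarrow> fst w \<in> dom i \<Longrightarrow> snd (tangent_map (base V) (total_space V) X w) i =
      (snd w i, FD (\<lambda>x. triv V i (X (psi i x))) (phi i (fst w)) (snd w i))"
    if "w \<in> tot TM" for w i
    using section_tangent_map(1)[of X w] section_tangent_map(2)[of X w i] section_mem[OF X] section_smooth[OF X] that by simp_all
  have ts: "tangent_section V X w = tangent_map (base V) (total_space V) X w" if "w \<in> tot TM" for w
    using that by (simp add: tangent_section_def)
  show co: "triv TV i (tangent_section V X w) =
      (triv V i (X (fst w)), FD (\<lambda>x. triv V i (X (psi i x))) (phi i (fst w)) (snd w i))"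
    if "i \<in> ind" "w \<in> tot TM" "fst w \<in> dom i" for i w
    using that tm(2)[OF that(2) that(1,3)] by (simp add: ts)
  show "tangent_section V X \<in> sections TV"
  proof (rule TA.sectionsI)
    fix w assume "w \<in> pts (base TV)"
    then have w: "w \<in> tot TM" by simp
    show t: "tangent_section V X w \<in> tot TV" using tm(1)[OF w] w by (simp add: ts)
    have p: "fst w \<in> pts (base V)" by (rule B.tangent_fst[OF w])
    define i where "i = chart_at (base V) (fst w)"
    have i: "i \<in> ind" "fst w \<in> dom i" using B.chart_at_mem[OF p] by (auto simp: i_def)
    show "proj TV (tangent_section V X w) = w"
    proof (rule B.tangent_eqI[OF _ w _ i(1)])
      show "proj TV (tangent_section V X w) \<in> tot TM" using lift_proj(1) t by simp
      show "snd (proj TV (tangent_section V X w)) i = snd w i"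
        using lift_proj(4)[OF t[simplified] i(1)] tm(2)[OF w i] section_mem(2)[OF X p] i w by (simp add: ts)
    qed (use i w section_mem(2)[OF X p] in \<open>simp_all add: ts\<close>)
  next
    fix i assume "i \<in> TA.ind"
    then have i: "i \<in> ind" by simp
    have u: "uniq_diff (B.img i \<times> (UNIV :: 'm set))" by (intro uniq_diff_open open_Times B.open_img i open_UNIV)
    have f: "smooth_on (B.img i \<times> (UNIV::'m set)) fst" "smooth_on (B.img i \<times> (UNIV::'m set)) snd"
      using smooth_on_fst[OF u smooth_on_ident[OF u]] smooth_on_snd[OF u smooth_on_ident[OF u]] by simp_all
    have "smooth_on (B.img i \<times> (UNIV::'m set))
      (\<lambda>z. (triv V i (X (psi i (fst z))), FD (\<lambda>x. triv V i (X (psi i x))) (fst z) (snd z)))"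
      by (intro smooth_on_Pair u smooth_on_compose[OF u uniq_diff_open[OF B.open_img[OF i]] section_smooth[OF X i] f(1)]
          smooth_on_deriv_apply[OF u B.open_img[OF i] section_smooth[OF X i]] f) auto
    then show "smooth_on (TA.B.img i) (\<lambda>x. triv TV i (tangent_section V X (TA.psi i x)))"
      unfolding lift_img[OF i]
    proof (rule smooth_on_cong[THEN iffD1, rotated])
      fix z assume "z \<in> B.img i \<times> (UNIV::'m set)"
      then obtain x v where z: "z = (x, v)" "x \<in> B.img i" by auto
      show "(triv V i (X (psi i (fst z))), FD (\<lambda>x. triv V i (X (psi i x))) (fst z) (snd z)) =
          triv TV i (tangent_section V X (TA.psi i z))"
        using co[OF i lift_psi(1)[OF i z(2)]] lift_psi[OF i z(2), of v] B.chart_inv_mem[OF z(2)] B.chart_chart_inv[OF z(2)] z(1) by simp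
    qed
  qed (simp add: tangent_section_def)
qed

lemma vertical_section_mem:
  assumes X: "X \<in> sections V"
  shows "vertical_section V X \<in> sections TV"
    and "i \<in> ind \<Longrightarrow> w \<in> tot TM \<Longrightarrow> fst w \<in> dom i \<Longrightarrow> triv TV i (vertical_section V X w) = (0, triv V i (X (fst w)))"
proof -
  have z0: "smooth_on (B.img i) (\<lambda>x. triv V i (vzero V (psi i x)))" if "i \<in> ind" for i
    using B.chart_inv_mem B.dom_pts[OF that] that
    by (subst smooth_on_cong[where g="\<lambda>_. 0"]) (auto intro!: smooth_on_const uniq_diff_open B.open_img vzero simp: B.chart_inv_chart)
  have D0: "FD (\<lambda>x. triv V i (vzero V (psi i x))) (phi i p) = (\<lambda>_. 0)" if "i \<in> ind" "p \<in> dom i" for i p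
    by (rule const_near_has_derivative[OF that(1) B.openin_chart_dom[OF that(1)] that(2)])
      (use that B.dom_pts vzero in auto)
  have tm: "tangent_map (base V) (total_space V) (vzero V) w \<in> tot TE"
    "i \<in> ind \<Longrightarrow> fst w \<in> dom i \<Longrightarrow> snd (tangent_map (base V) (total_space V) (vzero V) w) i = (snd w i, 0)"
    if "w \<in> tot TM" for w i
    using section_tangent_map(1)[of "vzero V" w] section_tangent_map(2)[of "vzero V" w i] vzero z0 D0 that by simp_all
  have vs: "vertical_section V X w \<in> tot TE \<and> fst (vertical_section V X w) = vzero V (fst w) \<and>
     (\<forall>i\<in>ind. fst w \<in> dom i \<longrightarrow> snd (vertical_section V X w) i = (snd w i, triv V i (X (fst w))))"
    if w: "w \<in> tot TM" for w
  proof -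
    have p: "fst w \<in> pts (base V)" by (rule B.tangent_fst[OF w])
    have eq: "vertical_section V X w = vadd TE (tangent_map (base V) (total_space V) (vzero V) w) (vertical V (vzero V (fst w)) (X (fst w)))"
      using w by (simp add: vertical_section_def Let_def)
    have vt: "vertical V (vzero V (fst w)) (X (fst w)) \<in> tot TE"
      by (rule vertical_tangent[OF vzero(1)[OF p]]) (use vzero(2)[OF p] section_mem(3)[OF X p] in simp)
    have f: "fst (vertical V (vzero V (fst w)) (X (fst w))) = fst (tangent_map (base V) (total_space V) (vzero V) w)"
      by (simp add: vertical_def)
    note va = T.vadd_tangent[OF tm(1)[OF w] vt f]
    show ?thesis
      unfolding eq using va(1,2) va(3) tm(2)[OF w] vzero[OF p] by (simp add: vertical_def)
  qed
  show co: "triv TV i (vertical_section V X w) = (0, triv V i (X (fst w)))"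
    if "i \<in> ind" "w \<in> tot TM" "fst w \<in> dom i" for i w
    using vs[OF that(2)] that vzero(3)[OF B.dom_pts[OF that(1,3)]] by simp
  show "vertical_section V X \<in> sections TV"
  proof (rule TA.sectionsI)
    fix w assume "w \<in> pts (base TV)"
    then have w: "w \<in> tot TM" by simp
    show t: "vertical_section V X w \<in> tot TV" using vs[OF w] by simp
    have p: "fst w \<in> pts (base V)" by (rule B.tangent_fst[OF w])
    define i where "i = chart_at (base V) (fst w)"
    have i: "i \<in> ind" "fst w \<in> dom i" using B.chart_at_mem[OF p] by (auto simp: i_def)
    show "proj TV (vertical_section V X w) = w"
    proof (rule B.tangent_eqI[OF _ w _ i(1)])
      show "proj TV (vertical_section V X w) \<in> tot TM" using lift_proj(1) t by simp
      show "snd (proj TV (vertical_section V X w)) i = snd w i"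
        using lift_proj(4)[OF t[simplified] i(1)] vs[OF w] vzero(2)[OF p] i by simp
    qed (use i vs[OF w] vzero(2)[OF p] in simp_all)
  next
    fix i assume "i \<in> TA.ind"
    then have i: "i \<in> ind" by simp
    have u: "uniq_diff (B.img i \<times> (UNIV :: 'm set))" by (intro uniq_diff_open open_Times B.open_img i open_UNIV)
    have f: "smooth_on (B.img i \<times> (UNIV::'m set)) fst"
      using smooth_on_fst[OF u smooth_on_ident[OF u]] by simp
    have "smooth_on (B.img i \<times> (UNIV::'m set)) (\<lambda>z. (0 :: 'k, triv V i (X (psi i (fst z)))))"
      by (intro smooth_on_Pair u smooth_on_const
          smooth_on_compose[OF u uniq_diff_open[OF B.open_img[OF i]] section_smooth[OF X i] f(1)]) auto
    then show "smooth_on (TA.B.img i) (\<lambda>x. triv TV i (vertical_section V X (TA.psi i x)))"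
      unfolding lift_img[OF i]
    proof (rule smooth_on_cong[THEN iffD1, rotated])
      fix z assume "z \<in> B.img i \<times> (UNIV::'m set)"
      then obtain x v where z: "z = (x, v)" "x \<in> B.img i" by auto
      show "(0, triv V i (X (psi i (fst z)))) = triv TV i (vertical_section V X (TA.psi i z))"
        using co[OF i lift_psi(1)[OF i z(2)]] lift_psi[OF i z(2), of v] B.chart_inv_mem[OF z(2)] z(1) by simp
    qed
  qed (simp add: vertical_section_def)
qed

text \<open>Local formulas near a base point thereby hold near every tangent vector over it.\<close>

lemma openin_lift:
  assumes i: "i \<in> ind" and U: "openin (manifold_topology (base V)) U" "U \<subseteq> dom i"
  shows "openin (manifold_topology (base TV)) {w \<in> tot TM. fst w \<in> U}"
proof -
  let ?W = "{x \<in> B.img i. psi i x \<in> U}"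
  have "openin (manifold_topology (base TV)) (TA.dom i \<inter> TA.phi i -` (?W \<times> UNIV))"
    by (rule TA.B.openin_chart_preimage) (use i U in \<open>auto intro!: open_Times B.open_in_chart\<close>)
  moreover have "TA.dom i \<inter> TA.phi i -` (?W \<times> UNIV) = {w \<in> tot TM. fst w \<in> U}"
    using i U(2) by (auto simp: B.chart_inv_chart dest: inj_onD[OF B.chart_inj[OF i]])
  ultimately show ?thesis by simp
qed

text \<open>
  The section of \<open>T\<tau>\<close> with constant coordinates \<open>(y, y')\<close> is \<open>TX + Y\<^sup>v\<close> for constant \<open>X\<close>, \<open>Y\<close>
  with coordinates \<open>y\<close>, \<open>y'\<close>.
\<close>

lemma lift_str:
  assumes i: "i \<in> ind" "w \<in> tot TM" "fst w \<in> dom i"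
  shows "TA.str i w u v = (str i (fst w) (fst u) (fst v),
    FD (\<lambda>x. str i (psi i x) (fst u) (fst v)) (phi i (fst w)) (snd w i) +
    str i (fst w) (snd u) (fst v) + str i (fst w) (fst u) (snd v))"
proof -
  let ?p = "fst w"
  let ?C = "const_section V i ?p"
  let ?T = "\<lambda>y. tangent_section V (?C y)" and ?V = "\<lambda>y. vertical_section V (?C y)"
  let ?S = "\<lambda>u. sec_add TV (?T (fst u)) (?V (snd u))"
  note c = const_section(1)[OF i(1,3)]
  note T = tangent_section_mem(1)[OF c] and V = vertical_section_mem(1)[OF c]
  have S: "?S u \<in> sections TV" for u by (rule TA.sec_add_mem[OF T V])
  have i': "i \<in> TA.ind" "w \<in> TA.dom i" using i by simp_all
  have near: "\<exists>U. openin (manifold_topology (base TV)) U \<and> w \<in> U \<and> U \<subseteq> TA.dom i \<and> (\<forall>q\<in>U. triv TV i (?S u q) = u)" for u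
  proof -
    obtain U where U: "openin (manifold_topology (base V)) U" "?p \<in> U" "U \<subseteq> dom i"
      "\<And>q. q \<in> U \<Longrightarrow> triv V i (?C (fst u) q) = fst u" "\<And>q. q \<in> U \<Longrightarrow> triv V i (?C (snd u) q) = snd u"
      by (rule const_sections_near[OF i(1,3), of "fst u" "snd u"]) blast
    let ?U = "{w \<in> tot TM. fst w \<in> U}"
    have "triv TV i (?S u q) = u" if q: "q \<in> ?U" for q
    proof -
      have q': "q \<in> tot TM" "fst q \<in> dom i" "q \<in> TA.dom i" using q U by auto
      have "FD (\<lambda>x. triv V i (?C (fst u) (psi i x))) (phi i (fst q)) = (\<lambda>_. 0)"
        by (rule const_near_has_derivative[OF i(1) U(1) _ U(3,4)]) (use q in auto)
      then have "triv TV i (?S u q) = (fst u, 0) + (0, snd u)"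
        unfolding TA.sec_add_triv[OF T V i'(1) q'(3)] tangent_section_mem(2)[OF c i(1) q'(1,2)]
          vertical_section_mem(2)[OF c i(1) q'(1,2)] using U q by simp
      then show ?thesis by (simp add: prod_eq_iff)
    qed
    then show ?thesis
      using openin_lift[OF i(1) U(1,3)] U i by (intro exI[of _ ?U]) auto
  qed
  obtain U1 where U1: "openin (manifold_topology (base TV)) U1" "w \<in> U1" "U1 \<subseteq> TA.dom i"
    "\<And>q. q \<in> U1 \<Longrightarrow> triv TV i (?S u q) = u" using near[of u] by blast
  obtain U2 where U2: "openin (manifold_topology (base TV)) U2" "w \<in> U2" "U2 \<subseteq> TA.dom i"
    "\<And>q. q \<in> U2 \<Longrightarrow> triv TV i (?S v q) = v" using near[of v] by blast
  have "TA.str i w u v = triv TV i (TA.br (?S u) (?S v) w)"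
    by (rule TA.br_const_near[symmetric, OF S S i'(1) openin_Int[OF U1(1) U2(1)]]) (use U1 U2 in auto)
  also have "\<dots> = triv TV i (TA.br (?S u) (?T (fst v)) w) + triv TV i (TA.br (?S u) (?V (snd v)) w)"
    by (rule TA.br_add[OF T V S i'])
  \<comment> \<open>Additivity is used in the right argument, and the defining relations of the lift
    cover the orders \<open>(T, T)\<close>, \<open>(T, V)\<close> and \<open>(V, V)\<close>. Skew
    symmetry brings the left sums and the order \<open>(V, T)\<close> into these forms.\<close>
  also have "triv TV i (TA.br (?S u) (?T (fst v)) w) =
      - (triv TV i (TA.br (?T (fst v)) (?T (fst u)) w) + triv TV i (TA.br (?T (fst v)) (?V (snd u)) w))"
    unfolding TA.br_skew[OF S T i'] TA.br_add[OF T V T i'] ..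
  also have "triv TV i (TA.br (?S u) (?V (snd v)) w) =
      - (triv TV i (TA.br (?V (snd v)) (?T (fst u)) w) + triv TV i (TA.br (?V (snd v)) (?V (snd u)) w))"
    unfolding TA.br_skew[OF S V i'] TA.br_add[OF T V V i'] ..
  also have "triv TV i (TA.br (?V (snd v)) (?T (fst u)) w) = - triv TV i (TA.br (?T (fst u)) (?V (snd v)) w)"
    by (rule TA.br_skew[OF V T i'])
  also have "triv TV i (TA.br (?T (fst v)) (?T (fst u)) w) = - triv TV i (TA.br (?T (fst u)) (?T (fst v)) w)"
    by (rule TA.br_skew[OF T T i'])
  also have "TA.br (?T (fst u)) (?T (fst v)) = tangent_section V (br (?C (fst u)) (?C (fst v)))"
    using tl c unfolding is_tangent_lift_def by blast
  also have "TA.br (?T (fst v)) (?V (snd u)) = vertical_section V (br (?C (fst v)) (?C (snd u)))"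
    using tl c unfolding is_tangent_lift_def by blast
  also have "TA.br (?T (fst u)) (?V (snd v)) = vertical_section V (br (?C (fst u)) (?C (snd v)))"
    using tl c unfolding is_tangent_lift_def by blast
  also have "TA.br (?V (snd v)) (?V (snd u)) = (\<lambda>w\<in>pts (tangent (base V)). vzero TV w)"
    using tl c unfolding is_tangent_lift_def by blast
  also have "triv TV i ((\<lambda>w\<in>pts (tangent (base V)). vzero TV w) w) = 0"
    using TA.vzero(3)[of w i] i' i(2) by (simp del: tangent_lift_simps(4))
  also have "triv TV i (tangent_section V (br (?C (fst u)) (?C (fst v))) w) =
      (str i ?p (fst u) (fst v), FD (\<lambda>x. str i (psi i x) (fst u) (fst v)) (phi i ?p) (snd w i))"
  proof -
    obtain U where U: "openin (manifold_topology (base V)) U" "?p \<in> U" "U \<subseteq> dom i"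
      "\<And>q. q \<in> U \<Longrightarrow> triv V i (br (?C (fst u)) (?C (fst v)) q) = str i q (fst u) (fst v)"
      by (rule const_sections_near[OF i(1,3), of "fst u" "fst v"]) blast
    \<comment> \<open>The tangent section contains an \<open>x\<close>-derivative, so the bracket of
      the constant sections must be known on a neighbourhood of \<open>?p\<close> and not just at
      the point.\<close>
    have "FD (\<lambda>x. triv V i (br (?C (fst u)) (?C (fst v)) (psi i x))) (phi i ?p) =
        FD (\<lambda>x. str i (psi i x) (fst u) (fst v)) (phi i ?p)"
      by (rule frechet_derivative_cong_open[OF B.open_in_chart[OF i(1) U(1)]])
        (use U i in \<open>auto simp: B.chart_inv_chart\<close>)
    then show ?thesis
      using tangent_section_mem(2)[OF br_mem[OF c c] i] U by (simp del: tangent_lift_simps(4))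
  qed
  also have "triv TV i (vertical_section V (br (?C (fst v)) (?C (snd u))) w) = (0, str i ?p (fst v) (snd u))"
    unfolding vertical_section_mem(2)[OF br_mem[OF c c] i] by (simp add: structure_coord_def)
  also have "triv TV i (vertical_section V (br (?C (fst u)) (?C (snd v))) w) = (0, str i ?p (fst u) (snd v))"
    unfolding vertical_section_mem(2)[OF br_mem[OF c c] i] by (simp add: structure_coord_def)
  finally show ?thesis
    using str_skew[OF i(1,3), of "fst v" "snd u"] by (simp add: prod_eq_iff)
qed

end

text \<open>As a bundle over \<open>TM\<close>, \<open>TE\<close> has coordinates
  \<open>((x, x'), (y, y'))\<close>; as the tangent bundle of \<open>E\<close> it has
  \<open>((x, y), (x', y'))\<close>. \<open>base_part\<close> and \<open>tangent_part\<close>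
  translate the former into the point and the vector of the latter.\<close>

abbreviation base_part :: "('m \<times> 'n) \<times> ('k \<times> 'l) \<Rightarrow> 'm \<times> 'k" where
  "base_part \<zeta> \<equiv> (fst (fst \<zeta>), fst (snd \<zeta>))"

abbreviation tangent_part :: "('m \<times> 'n) \<times> ('k \<times> 'l) \<Rightarrow> 'n \<times> 'l" where
  "tangent_part \<zeta> \<equiv> (snd (fst \<zeta>), snd (snd \<zeta>))"

context lift
begin

section \<open>Momentum and force of the lifted Lagrangian\<close>

lemma lift_Z: "i \<in> ind \<Longrightarrow> \<zeta> \<in> TA.Z i \<longleftrightarrow> base_part \<zeta> \<in> Z i"
  using lift_img by (auto simp: mem_Times_iff)

lemma lift_rhoc:
  assumes i: "i \<in> ind" and \<zeta>: "\<zeta> \<in> TA.Z i"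
  shows "TA.rhoc i \<zeta> = (rhoc i (base_part \<zeta>), FD (rhoc i) (base_part \<zeta>) (tangent_part \<zeta>))"
proof -
  have x: "fst (fst \<zeta>) \<in> B.img i" using lift_Z[OF i] \<zeta> by (simp add: mem_Times_iff)
  note p = lift_psi[OF i x, of "snd (fst \<zeta>)", unfolded prod.collapse]
  show ?thesis
    using lift_rho[OF i p(1), of "snd \<zeta>"] p B.chart_inv_mem[OF x] B.chart_chart_inv[OF x]
      frechet_derivative_at[OF rhoc_has_derivative[OF i x, of "fst (snd \<zeta>)"], symmetric]
    by (simp add: TA.rhoc_def rhoc_def)
qed

context
  fixes L :: "'e \<Rightarrow> real"
  assumes smL: "smooth_fun (total_space V) L"
begin

abbreviation "L' \<equiv> dT_fun (total_space V) L"

lemma lift_ell: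
  assumes i: "i \<in> ind" and \<zeta>: "\<zeta> \<in> TA.Z i"
  shows "TA.ell L' i \<zeta> = dell L i (base_part \<zeta>) (tangent_part \<zeta>)"
proof -
  have x: "fst (fst \<zeta>) \<in> B.img i" using lift_Z[OF i] \<zeta> by (simp add: mem_Times_iff)
  note p = lift_psi[OF i x, of "snd (fst \<zeta>)", unfolded prod.collapse]
  have d: "fst (TA.psi i (fst \<zeta>)) \<in> dom i" using p by simp
  note f = lift_from_triv[OF i p(1) d, of "snd \<zeta>"]
  have "chart_inv (total_space TV) i \<zeta> = from_triv TV i (TA.psi i (fst \<zeta>)) (snd \<zeta>)"
    using TA.total_chart_inv[of i "fst \<zeta>" "snd \<zeta>"] i \<zeta> by (simp add: mem_Times_iff del: total_space_simps(3,4))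
  then show ?thesis
    using dT_fun_coord[OF smL f(1) i] f p d i B.chart_chart_inv[OF x] by (simp add: TA.ell_def)
qed

lemma smooth_base_tangent_part:
  assumes "i \<in> ind"
  shows "smooth_on (TA.Z i) base_part" "smooth_on (TA.Z i) tangent_part"
proof -
  have u: "uniq_diff (TA.Z i)" using TA.uniq_Z assms by simp
  have 1: "smooth_on (TA.Z i) (\<lambda>\<zeta>. fst \<zeta>)" "smooth_on (TA.Z i) (\<lambda>\<zeta>. snd \<zeta>)"
    using smooth_on_fst[OF u smooth_on_ident[OF u]] smooth_on_snd[OF u smooth_on_ident[OF u]] by simp_all
  show "smooth_on (TA.Z i) base_part" "smooth_on (TA.Z i) tangent_part"
    by (intro smooth_on_Pair u smooth_on_fst[OF u 1(1)] smooth_on_snd[OF u 1(1)]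
        smooth_on_fst[OF u 1(2)] smooth_on_snd[OF u 1(2)])+
qed

lemma lift_smooth: "smooth_fun (total_space TV) L'"
  unfolding smooth_fun_def
proof
  fix i assume "i \<in> idx (total_space TV)"
  then have i: "i \<in> ind" "i \<in> TA.ind" by simp_all
  have "smooth_on (TA.Z i) (\<lambda>\<zeta>. FD (ell L i) (base_part \<zeta>) (tangent_part \<zeta>))"
    by (rule smooth_on_deriv_apply[OF TA.uniq_Z[OF i(2)] open_Z[OF i(1)] ell_smooth[OF smL i(1)]
          smooth_base_tangent_part[OF i(1)]]) (use lift_Z[OF i(1)] in auto)
  then have "smooth_on (TA.Z i) (TA.ell L' i)"
    by (subst smooth_on_cong[OF lift_ell[OF i(1)]]) (auto simp: dell_def)
  then show "smooth_on (chart (total_space TV) i ` chart_dom (total_space TV) i) (\<lambda>x. L' (chart_inv (total_space TV) i x))"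
    unfolding TA.total_img[OF i(2)] TA.ell_def .
qed

lemma dell_symmetric:
  assumes "i \<in> ind" "z \<in> Z i"
  shows "FD (\<lambda>z. dell L i z u) z v = FD (\<lambda>z. dell L i z v) z u"
  unfolding dell_def by (rule second_derivative_symmetric[OF open_Z[OF assms(1)] ell_smooth[OF smL assms(1)] assms(2)])

text \<open>The symmetry of second derivatives moves the differentiation to the direction of the tangent part.\<close>

lemma lift_dell:
  assumes i: "i \<in> ind" and \<zeta>: "\<zeta> \<in> TA.Z i"
  shows "TA.dell L' i \<zeta> \<omega> = FD (\<lambda>z. dell L i z (base_part \<omega>)) (base_part \<zeta>) (tangent_part \<zeta>) +
    dell L i (base_part \<zeta>) (tangent_part \<omega>)"
proof -
  have z: "base_part \<zeta> \<in> Z i" using lift_Z[OF i] \<zeta> by simp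
  have "((\<lambda>q. dell L i (fst q) (snd q)) has_derivative (\<lambda>w. FD (\<lambda>z. dell L i z (tangent_part \<zeta>)) (base_part \<zeta>) (fst w) +
      dell L i (base_part \<zeta>) (snd w))) (at (base_part \<zeta>, tangent_part \<zeta>))"
    by (rule linear_family_has_derivative[OF open_Z[OF i] z dell_linear[OF smL i] dell_smooth[OF smL i]])
  moreover have "((\<lambda>\<zeta>. (base_part \<zeta>, tangent_part \<zeta>)) has_derivative (\<lambda>\<omega>. (base_part \<omega>, tangent_part \<omega>))) (at \<zeta>)"
    by (intro derivative_intros)
  ultimately have "((\<lambda>\<zeta>. dell L i (base_part \<zeta>) (tangent_part \<zeta>)) has_derivative
    (\<lambda>\<omega>. FD (\<lambda>z. dell L i z (tangent_part \<zeta>)) (base_part \<zeta>) (base_part \<omega>) +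
      dell L i (base_part \<zeta>) (tangent_part \<omega>))) (at \<zeta>)"
    by (drule_tac has_derivative_compose) (simp, simp)
  then have "(TA.ell L' i has_derivative
    (\<lambda>\<omega>. FD (\<lambda>z. dell L i z (tangent_part \<zeta>)) (base_part \<zeta>) (base_part \<omega>) +
      dell L i (base_part \<zeta>) (tangent_part \<omega>))) (at \<zeta>)"
    by (rule has_derivative_transform_within_open[OF _ TA.open_Z \<zeta>]) (use i lift_ell[OF i] in auto)
  from frechet_derivative_at[OF this, symmetric] show ?thesis
    unfolding TA.dell_def using dell_symmetric[OF i z] by simp
qed

lemma mom_has_derivative:
  "i \<in> ind \<Longrightarrow> z \<in> Z i \<Longrightarrow> (mom L i has_derivative FD (mom L i) z) (at z)"
  by (rule smooth_on_has_derivative_at[OF open_Z mom_smooth[OF smL]])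

lemma force_has_derivative:
  "i \<in> ind \<Longrightarrow> z \<in> Z i \<Longrightarrow> (force L i has_derivative FD (force L i) z) (at z)"
  by (rule smooth_on_has_derivative_at[OF open_Z force_smooth[OF smL]])

text \<open>\<open>d\<^sub>T L\<close> depends on \<open>y'\<close> linearly with coefficient
  \<open>p\<close>, and differentiating it in \<open>y\<close> gives \<open>Dp(v)\<close>. The
  derivative comes first in the pair because the tangent of the pairing of \<open>p\<close> with
  \<open>y\<close> matches \<open>p'\<close> with \<open>y\<close> and \<open>p\<close> with
  \<open>y'\<close>.\<close>

lemma lift_mom:
  assumes i: "i \<in> ind" and \<zeta>: "\<zeta> \<in> TA.Z i"
  shows "TA.mom L' i \<zeta> = (FD (mom L i) (base_part \<zeta>) (tangent_part \<zeta>), mom L i (base_part \<zeta>))"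
proof (rule inner_eqI)
  fix u :: "'k \<times> 'k"
  have z: "base_part \<zeta> \<in> Z i" using lift_Z[OF i] \<zeta> by simp
  have "((\<lambda>z. dell L i z (0, fst u)) has_derivative (\<lambda>w. FD (mom L i) (base_part \<zeta>) w \<bullet> fst u)) (at (base_part \<zeta>))"
    by (rule has_derivative_transform_within_open[OF has_derivative_inner_left[OF mom_has_derivative[OF i z]] open_Z[OF i] z])
      (rule mom_inner[OF smL i])
  from frechet_derivative_at[OF this, symmetric] show "TA.mom L' i \<zeta> \<bullet> u =
      (FD (mom L i) (base_part \<zeta>) (tangent_part \<zeta>), mom L i (base_part \<zeta>)) \<bullet> u"
    using TA.mom_inner[OF lift_smooth _ \<zeta>, of u] i lift_dell[OF i \<zeta>, of "(0, u)"] mom_inner[OF smL i z, of "snd u"]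
    by (simp add: inner_prod_def)
qed

text \<open>Tested against \<open>u\<close>, the terms containing \<open>snd u\<close> form the
  force itself, and those containing \<open>fst u\<close> are exactly the product rule for the force
  paired with the constant vector \<open>fst u\<close>.\<close>

lemma lift_force:
  assumes i: "i \<in> ind" and \<zeta>: "\<zeta> \<in> TA.Z i"
  shows "TA.force L' i \<zeta> = (FD (force L i) (base_part \<zeta>) (tangent_part \<zeta>), force L i (base_part \<zeta>))"
proof (rule inner_eqI)
  fix u :: "'k \<times> 'k"
  let ?x = "fst (fst \<zeta>)" and ?x' = "snd (fst \<zeta>)" and ?y = "fst (snd \<zeta>)" and ?y' = "snd (snd \<zeta>)"
  let ?g = "fst u" and ?g' = "snd u"
  let ?z = "(?x, ?y)" and ?w = "(?x', ?y')"
  have z: "?z \<in> Z i" using lift_Z[OF i] \<zeta> by simp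
  then have x: "?x \<in> B.img i" by simp
  define p where "p = psi i ?x"
  have p: "p \<in> dom i" "phi i p = ?x" using B.chart_inv_mem[OF x] B.chart_chart_inv[OF x] by (auto simp: p_def)
  note pp = lift_psi[OF i x, of ?x', unfolded prod.collapse]
  define Dm where "Dm = FD (mom L i) ?z"
  define DS where "DS = FD (\<lambda>x. str i (psi i x) ?y ?g) ?x ?x'"
  define DR where "DR = FD (\<lambda>x. rho i (psi i x) ?g) ?x"
  define DL where "DL = FD (\<lambda>z. dell L i z (rho i p ?g, 0)) ?z ?w"
  have str: "TA.str i (TA.psi i (fst \<zeta>)) (snd \<zeta>) u = (str i p ?y ?g, DS + str i p ?y' ?g + str i p ?y ?g')"
    using lift_str[OF i pp(1), of "snd \<zeta>" u] pp p by (simp add: p_def DS_def)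
  have rho: "TA.rho i (TA.psi i (fst \<zeta>)) u = (rho i p ?g, DR ?x' + rho i p ?g')"
    using lift_rho[OF i pp(1), of u] pp p by (simp add: p_def DR_def)
  have "TA.force L' i \<zeta> \<bullet> u = Dm ?w \<bullet> str i p ?y ?g + mom L i ?z \<bullet> (DS + str i p ?y' ?g + str i p ?y ?g') +
      DL + dell L i ?z (DR ?x' + rho i p ?g', 0)"
    using TA.force_inner[OF lift_smooth _ \<zeta>, of u] i lift_mom[OF i \<zeta>] lift_dell[OF i \<zeta>] str rho
    by (simp add: inner_prod_def Dm_def DL_def)
  also have "dell L i ?z (DR ?x' + rho i p ?g', 0) = dell L i ?z (DR ?x', 0) + dell L i ?z (rho i p ?g', 0)"
    using linear_add[OF dell_linear[OF smL i z], of "(DR ?x', 0)" "(rho i p ?g', 0)"] by simp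
  finally have 1: "TA.force L' i \<zeta> \<bullet> u = (Dm ?w \<bullet> str i p ?y ?g + mom L i ?z \<bullet> (DS + str i p ?y' ?g) +
      DL + dell L i ?z (DR ?x', 0)) + force L i ?z \<bullet> ?g'"
    using force_inner[OF smL i z, of ?g'] by (simp add: inner_add_right p_def)
  have S: "((\<lambda>z. str i (psi i (fst z)) (snd z) ?g) has_derivative
      (\<lambda>w. FD (\<lambda>x. str i (psi i x) ?y ?g) ?x (fst w) + str i p (snd w) ?g)) (at ?z)"
    unfolding p_def
    by (rule linear_family_has_derivative[OF B.open_img[OF i] x _ str_smooth_coeff[OF i]])
      (rule str_linear_left[OF i B.chart_inv_mem])
  have "((\<lambda>x. rho i (psi i x) ?g) has_derivative DR) (at ?x)"
    unfolding DR_def by (rule smooth_on_has_derivative_at[OF B.open_img[OF i] rho_smooth_coeff[OF i] x])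
  then have "((\<lambda>z. rho i (psi i (fst z)) ?g) has_derivative (\<lambda>w. DR (fst w))) (at ?z)"
    by (intro has_derivative_compose[OF has_derivative_fst[OF has_derivative_ident]]) simp
  then have R: "((\<lambda>z. (z, (rho i (psi i (fst z)) ?g, 0 :: 'k))) has_derivative (\<lambda>w. (w, (DR (fst w), 0)))) (at ?z)"
    by (intro has_derivative_Pair has_derivative_ident has_derivative_const)
  \<comment> \<open>In the force the differential of \<open>L\<close> is evaluated in the direction
    \<open>\<rho>(x) g\<close>, which moves with the point. Being linear in the direction, it
    contributes one term from the point and one from the derivative of the anchor.\<close>
  have "((\<lambda>q. dell L i (fst q) (snd q)) has_derivative (\<lambda>w. FD (\<lambda>z. dell L i z (rho i p ?g, 0)) ?z (fst w) +
      dell L i ?z (snd w))) (at (?z, (rho i p ?g, 0)))"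
    by (rule linear_family_has_derivative[OF open_Z[OF i] z dell_linear[OF smL i] dell_smooth[OF smL i]])
  then have "((\<lambda>q. dell L i (fst q) (snd q)) has_derivative (\<lambda>w. FD (\<lambda>z. dell L i z (rho i p ?g, 0)) ?z (fst w) +
      dell L i ?z (snd w))) (at (?z, (rho i (psi i (fst ?z)) ?g, 0)))" by (simp add: p_def)
  from has_derivative_compose[OF R this] have D2: "((\<lambda>z. dell L i z (rho i (psi i (fst z)) ?g, 0)) has_derivative
      (\<lambda>w. FD (\<lambda>z. dell L i z (rho i p ?g, 0)) ?z w + dell L i ?z (DR (fst w), 0))) (at ?z)"
    by simp
  have "((\<lambda>z. mom L i z \<bullet> str i (psi i (fst z)) (snd z) ?g + dell L i z (rho i (psi i (fst z)) ?g, 0)) has_derivative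
      (\<lambda>w. (mom L i ?z \<bullet> (FD (\<lambda>x. str i (psi i x) ?y ?g) ?x (fst w) + str i p (snd w) ?g) +
        Dm w \<bullet> str i (psi i (fst ?z)) (snd ?z) ?g) +
       (FD (\<lambda>z. dell L i z (rho i p ?g, 0)) ?z w + dell L i ?z (DR (fst w), 0)))) (at ?z)"
    unfolding Dm_def by (intro has_derivative_add has_derivative_inner S D2 mom_has_derivative i z)
  then have "((\<lambda>z. force L i z \<bullet> ?g) has_derivative
      (\<lambda>w. (mom L i ?z \<bullet> (FD (\<lambda>x. str i (psi i x) ?y ?g) ?x (fst w) + str i p (snd w) ?g) +
        Dm w \<bullet> str i (psi i (fst ?z)) (snd ?z) ?g) +
       (FD (\<lambda>z. dell L i z (rho i p ?g, 0)) ?z w + dell L i ?z (DR (fst w), 0)))) (at ?z)"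
    by (rule has_derivative_transform_within_open[OF _ open_Z[OF i] z]) (rule force_inner[OF smL i, symmetric])
  from has_derivative_unique[OF this has_derivative_inner_left[OF force_has_derivative[OF i z]]]
  have "FD (force L i) ?z ?w \<bullet> ?g = Dm ?w \<bullet> str i p ?y ?g + mom L i ?z \<bullet> (DS + str i p ?y' ?g) +
      DL + dell L i ?z (DR ?x', 0)"
    by (drule_tac fun_cong[of _ _ ?w]) (simp add: DS_def DL_def p_def)
  then show "TA.force L' i \<zeta> \<bullet> u =
      (FD (force L i) (base_part \<zeta>) (tangent_part \<zeta>), force L i (base_part \<zeta>)) \<bullet> u"
    unfolding 1 by (simp add: inner_prod_def)
qed

end

end


section \<open>The variation as a curve in the tangent lift\<close>

context algd
begin

context
  fixes t0 t1 :: real and \<gamma> \<eta> :: "real \<Rightarrow> 'e"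
  assumes t: "t0 < t1" and adm: "admissible V A t0 t1 \<gamma>" and over: "curve_over V t0 t1 \<gamma> \<eta>"
begin

abbreviation "I \<equiv> {t0..t1}"
abbreviation "var \<equiv> variation V A t0 t1 \<gamma> \<eta>"
abbreviation "xc i s \<equiv> phi i (proj V (\<gamma> s))"
abbreviation "yc i s \<equiv> triv V i (\<gamma> s)"
abbreviation "fc i s \<equiv> triv V i (\<eta> s)"

lemma curve_tot: "s \<in> I \<Longrightarrow> \<gamma> s \<in> tot V" "s \<in> I \<Longrightarrow> \<eta> s \<in> tot V" "s \<in> I \<Longrightarrow> proj V (\<eta> s) = proj V (\<gamma> s)"
  using adm over by (auto simp: admissible_def curve_over_def smooth_curve_def)

lemma var_coord:
  "i \<in> ind \<Longrightarrow> proj V (\<gamma> s) \<in> dom i \<Longrightarrow> snd (var s) i = (rho i (proj V (\<gamma> s)) (fc i s),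
     vector_derivative (fc i) (at s within I) + str i (proj V (\<gamma> s)) (yc i s) (fc i s))"
  by (simp add: variation_def Let_def)

lemma fst_var [simp]: "fst (var s) = \<gamma> s"
  by (simp add: variation_def)

text \<open>\<open>\<gamma>\<close> and \<open>\<eta>\<close> lie over the same base path, so one
  set of times serves both.\<close>

lemma curve_window:
  assumes i: "i \<in> ind"
  obtains W where "open W" "\<And>s. s \<in> I \<Longrightarrow> s \<in> W \<longleftrightarrow> proj V (\<gamma> s) \<in> dom i"
    "smooth_on (I \<inter> W) (xc i)" "smooth_on (I \<inter> W) (yc i)" "smooth_on (I \<inter> W) (fc i)"
proof -
  have \<gamma>: "smooth_curve (total_space V) t0 t1 \<gamma>" and \<eta>: "smooth_curve (total_space V) t0 t1 \<eta>"
    using adm over by (auto simp: admissible_def curve_over_def)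
  obtain W where W: "open W" "{s \<in> I. \<gamma> s \<in> chart_dom (total_space V) i} = I \<inter> W"
    "smooth_on (I \<inter> W) (\<lambda>s. chart (total_space V) i (\<gamma> s))"
    using smooth_curve_window[OF T.atlas_axioms \<gamma>, of i] i by auto
  obtain W' where W': "open W'" "{s \<in> I. \<eta> s \<in> chart_dom (total_space V) i} = I \<inter> W'"
    "smooth_on (I \<inter> W') (\<lambda>s. chart (total_space V) i (\<eta> s))"
    using smooth_curve_window[OF T.atlas_axioms \<eta>, of i] i by auto
  have "{s \<in> I. \<eta> s \<in> chart_dom (total_space V) i} = {s \<in> I. \<gamma> s \<in> chart_dom (total_space V) i}"
    using curve_tot by auto
  then have eq: "I \<inter> W' = I \<inter> W" unfolding W(2) W'(2) .
  have u: "uniq_diff (I \<inter> W)" by (rule uniq_diff_interval[OF t W(1)])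
  show ?thesis
  proof (rule that[OF W(1)])
    fix s assume s: "s \<in> I"
    have "s \<in> I \<inter> W \<longleftrightarrow> s \<in> {s \<in> I. \<gamma> s \<in> chart_dom (total_space V) i}" unfolding W(2) ..
    then show "s \<in> W \<longleftrightarrow> proj V (\<gamma> s) \<in> dom i" using s curve_tot(1)[OF s] by simp
  next
    show "smooth_on (I \<inter> W) (xc i)" "smooth_on (I \<inter> W) (yc i)"
      using smooth_on_fst[OF u W(3)] smooth_on_snd[OF u W(3)] by simp_all
    show "smooth_on (I \<inter> W) (fc i)"
      using smooth_on_snd[OF u W'(3)[unfolded eq]] by simp
  qed
qed

lemma curve_velocity:
  assumes "s \<in> I" "i \<in> ind" "proj V (\<gamma> s) \<in> dom i"
  shows "vector_derivative (xc i) (at s within I) = rho i (proj V (\<gamma> s)) (yc i s)"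
proof -
  have "snd (anchor A (\<gamma> s)) i = snd (velocity (base V) t0 t1 (\<lambda>s. proj V (\<gamma> s)) s) i"
    using adm assms(1) by (simp add: admissible_def)
  then show ?thesis
    using assms anchor_coord_eq[OF assms(2) curve_tot(1)[OF assms(1)] assms(3)] by (simp add: velocity_def)
qed

text \<open>
  The term of the transition law of the structure functions that is not tensorial cancels against
  the one of the time derivative of the generator, because the curve is admissible.
\<close>

lemma var_tangent:
  assumes s: "s \<in> I"
  shows "var s \<in> tot (tangent_bundle (total_space V))"
  unfolding T.mem_tangent_bundle
proof (intro conjI ballI allI impI)
  show "fst (var s) \<in> pts (total_space V)" using curve_tot(1)[OF s] by simp
  fix i j assume "i \<in> idx (total_space V)" "j \<in> idx (total_space V)"
    and "fst (var s) \<in> chart_dom (total_space V) i \<inter> chart_dom (total_space V) j"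
  then have i: "i \<in> ind" "proj V (\<gamma> s) \<in> dom i" and j: "j \<in> ind" "proj V (\<gamma> s) \<in> dom j" by auto
  define G where "G = (\<lambda>x y. triv V j (from_triv V i (psi i x) y))"
  let ?p = "proj V (\<gamma> s)"
  let ?y = "yc i s" and ?f = "fc i s"
  let ?x = "phi i ?p"
  let ?f' = "vector_derivative (fc i) (at s within I)"
  have px: "psi i ?x = ?p" by (rule B.chart_inv_chart[OF i])
  have lin: "linear (G ?x)" unfolding G_def px by (rule transition_linear[OF i(1) j(1) i(2) j(2)])
  have Gy: "yc j s = G ?x ?y"
    using triv_transition[OF i(1) curve_tot(1)[OF s] i(2), of j] by (simp add: G_def px)
  have Gf: "fc j r = G (phi i (proj V (\<gamma> r))) (fc i r)" if "r \<in> I" "proj V (\<gamma> r) \<in> dom i" for r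
    using triv_transition[OF i(1) curve_tot(2)[OF that(1)], of j] curve_tot(3)[OF that(1)] that i(1)
    by (simp add: G_def B.chart_inv_chart)
  have base: "rho j ?p (fc j s) = FD (\<lambda>x. phi j (psi i x)) ?x (rho i ?p ?f)"
    using B.tangent_transition[OF anchor_tangent(1)[OF curve_tot(2)[OF s]] i(1) j(1)]
      anchor_tangent(2)[OF curve_tot(2)[OF s]] anchor_coord_eq[OF i(1) curve_tot(2)[OF s]]
      anchor_coord_eq[OF j(1) curve_tot(2)[OF s]] curve_tot(3)[OF s] i j by simp
  obtain W where W: "open W" "\<And>s. s \<in> I \<Longrightarrow> s \<in> W \<longleftrightarrow> proj V (\<gamma> s) \<in> dom i"
    "smooth_on (I \<inter> W) (xc i)" "smooth_on (I \<inter> W) (fc i)" by (rule curve_window[OF i(1)]) blast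
  have sW: "s \<in> W" using W(2)[OF s] i by simp
  have "((\<lambda>r. (xc i r, fc i r)) has_vector_derivative (rho i ?p ?y, ?f')) (at s within I)"
    using has_vector_derivative_Pair[OF smooth_on_has_vector_derivative[OF W(3,1) sW s] smooth_on_has_vector_derivative[OF W(4,1) sW s]]
    unfolding curve_velocity[OF s i] .
  moreover have "((\<lambda>z. G (fst z) (snd z)) has_derivative
      (\<lambda>w. FD (\<lambda>x. G x ?f) ?x (fst w) + G ?x (snd w))) (at (xc i s, fc i s))"
    unfolding G_def
    by (rule linear_family_has_derivative[OF B.open_overlap[OF i(1) j(1)] _ _ transition_smooth[OF i(1) j(1)]])
      (use i j in \<open>auto simp: B.chart_inv_chart intro!: transition_linear\<close>)
  ultimately have "((\<lambda>r. G (xc i r) (fc i r)) has_vector_derivative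
      (FD (\<lambda>x. G x ?f) ?x (rho i ?p ?y) + G ?x ?f')) (at s within I)"
    using has_vector_derivative_compose_within[of "\<lambda>z. G (fst z) (snd z)" _ "\<lambda>r. (xc i r, fc i r)" s] by fastforce
  then have "vector_derivative (\<lambda>r. G (xc i r) (fc i r)) (at s within I) =
      FD (\<lambda>x. G x ?f) ?x (rho i ?p ?y) + G ?x ?f'"
    by (rule vector_derivative_within[OF interval_limpt[OF t s]])
  moreover have "vector_derivative (fc j) (at s within I) = vector_derivative (\<lambda>r. G (xc i r) (fc i r)) (at s within I)"
    by (rule vector_derivative_cong_window[OF W(1) sW s]) (use W(2) Gf in auto)
  \<comment> \<open>The correction that does not cancel,
    \<open>FD (\<lambda>x. G x ?y) ?x (rho i ?p ?f)\<close>, is the mixed term in the transition law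
    of \<open>TE\<close> for the base velocity \<open>rho i ?p ?f\<close>.\<close>
  moreover have "G ?x (?f' + str i ?p ?y ?f) = G ?x ?f' + (str j ?p (yc j s) (fc j s) +
    FD (\<lambda>x. G x ?f) ?x (rho i ?p ?y) - FD (\<lambda>x. G x ?y) ?x (rho i ?p ?f))"
    unfolding linear_add[OF lin] Gy Gf[OF s i(2)] using str_change_chart[OF i j, of ?y ?f] by (simp add: G_def)
  ultimately show "snd (var s) j = FD (\<lambda>x. chart (total_space V) j (chart_inv (total_space V) i x)) (chart (total_space V) i (fst (var s))) (snd (var s) i)"
    using frechet_derivative_at[OF total_transition_has_derivative[OF i j, of ?y], symmetric] base
    by (simp add: var_coord[OF i] var_coord[OF j] G_def)
qed (use curve_tot(1)[OF s] in \<open>auto simp: variation_def Let_def\<close>)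

lemma var_smooth:
  assumes i: "i \<in> ind" and W: "open W" "\<And>s. s \<in> I \<Longrightarrow> s \<in> W \<longleftrightarrow> proj V (\<gamma> s) \<in> dom i"
    "smooth_on (I \<inter> W) (xc i)" "smooth_on (I \<inter> W) (yc i)" "smooth_on (I \<inter> W) (fc i)"
  shows "smooth_on (I \<inter> W) (\<lambda>s. snd (var s) i)"
proof -
  have u: "uniq_diff (I \<inter> W)" by (rule uniq_diff_interval[OF t W(1)])
  have img: "xc i ` (I \<inter> W) \<subseteq> B.img i" using W(2) by auto
  have "smooth_on (I \<inter> W) (\<lambda>s. rhoc i (xc i s, fc i s))"
    by (rule smooth_on_compose[OF u uniq_Z[OF i] rhoc_smooth[OF i] smooth_on_Pair[OF u W(3,5)]]) (use img in auto)
  then have "smooth_on (I \<inter> W) (\<lambda>s. (rhoc i (xc i s, fc i s),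
      vector_derivative (fc i) (at s within I) + str i (psi i (xc i s)) (yc i s) (fc i s)))"
    by (intro smooth_on_Pair smooth_on_add u smooth_on_vector_derivative W t str_smooth i img)
  then show ?thesis
    by (rule smooth_on_cong[THEN iffD1, rotated]) (use i W(2) in \<open>auto simp: var_coord rhoc_def B.chart_inv_chart\<close>)
qed

end

end

section \<open>Jacobi fields\<close>

lemma (in lift) jacobi_iff_EL_lift:
  fixes L :: "'e \<Rightarrow> real" and \<gamma> \<eta> :: "real \<Rightarrow> 'e"
  assumes smL: "smooth_fun (total_space V) L" and t: "t0 < t1" and adm: "admissible V A t0 t1 \<gamma>"
    and EL: "EL_solution V A L t0 t1 \<gamma>" and over: "curve_over V t0 t1 \<gamma> \<eta>"
  shows "jacobi_field V A L t0 t1 \<gamma> \<eta> \<longleftrightarrow>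
    EL_solution TV A' (dT_fun (total_space V) L) t0 t1 (variation V A t0 t1 \<gamma> \<eta>)"
proof -
  let ?I = "{t0..t1}"
  \<comment> \<open>In chart \<open>i\<close> below, \<open>z\<close> is the curve, \<open>v\<close>
    the variation, \<open>r\<close> its base velocity \<open>\<rho> \<eta>\<close>, \<open>m\<close>
    the momentum along \<open>\<gamma>\<close> and \<open>q\<close> the variation of the
    momentum.\<close>
  let ?var = "variation V A t0 t1 \<gamma> \<eta>"
  let ?N = "total_space (dual_bundle V)"
  define z where "z i s = (phi i (proj V (\<gamma> s)), triv V i (\<gamma> s))" for i s
  define v where "v i s = snd (?var s) i" for i s
  define r where "r i s = fst (v i s)" for i s
  define m where "m i s = mom L i (z i s)" for i s
  define q where "q i s = FD (mom L i) (z i s) (v i s)" for i s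
  \<comment> \<open>The half of either system that is not already the Euler-Lagrange equation of
    \<open>\<gamma>\<close>.\<close>
  define E where "E s i \<longleftrightarrow>
      vector_derivative (r i) (at s within ?I) = FD (rhoc i) (z i s) (v i s) \<and>
      vector_derivative (q i) (at s within ?I) = FD (force L i) (z i s) (v i s)" for s i
  note tot = curve_tot[OF t adm over]
  note fv = fst_var[OF t adm over]
  have tan: "?var s \<in> tot TE" if "s \<in> ?I" for s by (rule var_tangent[OF t adm over that])
  have zZ: "z i s \<in> Z i" if "i \<in> ind" "proj V (\<gamma> s) \<in> dom i" for i s
    using that by (auto simp: z_def)
  have window: "\<exists>W. open W \<and> (\<forall>s\<in>?I. s \<in> W \<longleftrightarrow> proj V (\<gamma> s) \<in> dom i) \<and>
      smooth_on (?I \<inter> W) (z i) \<and> smooth_on (?I \<inter> W) (v i) \<and> smooth_on (?I \<inter> W) (r i) \<and>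
      smooth_on (?I \<inter> W) (m i) \<and> smooth_on (?I \<inter> W) (q i)" if i: "i \<in> ind" for i
  proof -
    obtain W where W: "open W" "\<And>s. s \<in> ?I \<Longrightarrow> s \<in> W \<longleftrightarrow> proj V (\<gamma> s) \<in> dom i"
      "smooth_on (?I \<inter> W) (\<lambda>s. phi i (proj V (\<gamma> s)))" "smooth_on (?I \<inter> W) (\<lambda>s. triv V i (\<gamma> s))"
      "smooth_on (?I \<inter> W) (\<lambda>s. triv V i (\<eta> s))"
      by (rule curve_window[OF t adm over i]) blast
    have u: "uniq_diff (?I \<inter> W)" by (rule uniq_diff_interval[OF t W(1)])
    have sv: "smooth_on (?I \<inter> W) (v i)" unfolding v_def by (rule var_smooth[OF t adm over i W])
    have sz: "smooth_on (?I \<inter> W) (z i)" unfolding z_def by (rule smooth_on_Pair[OF u W(3,4)])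
    have img: "z i ` (?I \<inter> W) \<subseteq> Z i" by (intro image_subsetI zZ[OF i]) (use W(2) in blast)
    have "smooth_on (?I \<inter> W) (m i)" unfolding m_def
      by (rule smooth_on_compose[OF u uniq_Z[OF i] mom_smooth[OF smL i] sz img])
    moreover have "smooth_on (?I \<inter> W) (q i)" unfolding q_def
      by (rule smooth_on_deriv_apply[OF u open_Z[OF i] mom_smooth[OF smL i] sz sv img])
    moreover have "smooth_on (?I \<inter> W) (r i)" unfolding r_def by (rule smooth_on_fst[OF u sv])
    ultimately show ?thesis using W sv sz by blast
  qed
  have \<gamma>: "smooth_curve (total_space V) t0 t1 \<gamma>" using adm by (simp add: admissible_def)
  have el: "vector_derivative (\<lambda>s. phi i (proj V (\<gamma> s))) (at s within ?I) = rhoc i (z i s)"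
    "vector_derivative (m i) (at s within ?I) = force L i (z i s)"
    if "s \<in> ?I" "i \<in> ind" "proj V (\<gamma> s) \<in> dom i" for s i
    using EL that unfolding EL_solution_coord[OF smL t \<gamma>] m_def z_def by auto

  \<comment> \<open>The variation in the chart of \<open>TE\<close> as a bundle over
    \<open>TM\<close>; \<open>bp\<close> recovers \<open>z\<close> and \<open>v\<close> from
    it.\<close>
  define cc where "cc i s = (TA.phi i (proj TV (?var s)), triv TV i (?var s))" for i s
  have pr: "proj TV (?var s) \<in> TA.dom i \<longleftrightarrow> proj V (\<gamma> s) \<in> dom i" if "s \<in> ?I" for i s
    using lift_proj(1)[OF tan[OF that]] by (simp add: fv)
  have cc: "fst (cc i s) = (phi i (proj V (\<gamma> s)), r i s)" "snd (cc i s) = (triv V i (\<gamma> s), snd (v i s))"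
    if "s \<in> ?I" "i \<in> ind" "proj V (\<gamma> s) \<in> dom i" for i s
    using lift_proj(4)[OF tan[OF that(1)] that(2)] that by (simp_all add: cc_def r_def v_def fv)
  have bp: "base_part (cc i s) = z i s" "tangent_part (cc i s) = v i s" "cc i s \<in> TA.Z i"
    if "s \<in> ?I" "i \<in> ind" "proj V (\<gamma> s) \<in> dom i" for i s
    using cc[OF that] zZ[OF that(2,3)] lift_Z[OF that(2), of "cc i s"] by (simp_all add: z_def r_def)
  \<comment> \<open>Smoothness of the curve is part of \<open>EL_solution\<close> for the lift and
    has to come from that of \<open>\<gamma>\<close> and \<open>\<eta>\<close> alone.\<close>
  have sc: "smooth_curve (total_space TV) t0 t1 ?var"
  proof (rule TA.T.smooth_curveI)
    show "?var s \<in> pts (total_space TV)" if "s \<in> ?I" for s using tan[OF that] by simp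
    fix i assume "i \<in> idx (total_space TV)"
    then have i: "i \<in> ind" by simp
    obtain W where W: "open W" "\<And>s. s \<in> ?I \<Longrightarrow> s \<in> W \<longleftrightarrow> proj V (\<gamma> s) \<in> dom i"
      "smooth_on (?I \<inter> W) (z i)" "smooth_on (?I \<inter> W) (v i)" using window[OF i] by blast
    have u: "uniq_diff (?I \<inter> W)" by (rule uniq_diff_interval[OF t W(1)])
    have "s \<in> W \<longleftrightarrow> ?var s \<in> chart_dom (total_space TV) i" if "s \<in> ?I" for s
      using tan[OF that] pr[OF that, of i] W(2)[OF that] by simp
    then have "{s \<in> ?I. ?var s \<in> chart_dom (total_space TV) i} = ?I \<inter> W" by blast
    moreover have "smooth_on (?I \<inter> W) (\<lambda>s. ((fst (z i s), fst (v i s)), (snd (z i s), snd (v i s))))"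
      by (intro smooth_on_Pair smooth_on_fst smooth_on_snd W u)
    then have "smooth_on (?I \<inter> W) (cc i)"
      by (rule smooth_on_cong[THEN iffD1, rotated]) (use cc[OF _ i] W(2) in \<open>auto simp: z_def r_def prod_eq_iff\<close>)
    then have "smooth_on (?I \<inter> W) (\<lambda>s. chart (total_space TV) i (?var s))"
      unfolding cc_def total_space_simps(4) .
    ultimately show "\<exists>W. open W \<and> {s \<in> ?I. ?var s \<in> chart_dom (total_space TV) i} = ?I \<inter> W \<and>
      smooth_on (?I \<inter> W) (\<lambda>s. chart (total_space TV) i (?var s))" using W(1) by blast
  qed

  \<comment> \<open>The same four components occur in both systems, paired as \<open>(x, r)\<close>
    and \<open>(q, m)\<close> for the lift and as \<open>(x, m)\<close> and \<open>(r, q)\<close>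
    for the Jacobi equation. Those for \<open>x\<close> and \<open>m\<close> hold by
    \<open>el\<close>.\<close>
  have lift_eq: "vector_derivative (\<lambda>s. fst (cc i s)) (at s within ?I) = TA.rhoc i (cc i s) \<and>
      vector_derivative (\<lambda>s. TA.mom (dT_fun (total_space V) L) i (cc i s)) (at s within ?I) =
        TA.force (dT_fun (total_space V) L) i (cc i s) \<longleftrightarrow> E s i"
    and jac_eq: "vector_derivative (\<lambda>s. ((phi i (proj V (\<gamma> s)), m i s), (r i s, q i s))) (at s within ?I) =
      ((rhoc i (z i s), force L i (z i s)), (FD (rhoc i) (z i s) (v i s),
        FD (force L i) (z i s) (v i s))) \<longleftrightarrow> E s i"
    if s: "s \<in> ?I" and i: "i \<in> ind" "proj V (\<gamma> s) \<in> dom i" for s i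
  proof -
    obtain W where W: "open W" "\<And>s. s \<in> ?I \<Longrightarrow> s \<in> W \<longleftrightarrow> proj V (\<gamma> s) \<in> dom i"
      "smooth_on (?I \<inter> W) (z i)" "smooth_on (?I \<inter> W) (r i)" "smooth_on (?I \<inter> W) (m i)" "smooth_on (?I \<inter> W) (q i)"
      using window[OF i(1)] by blast
    have sW: "s \<in> W" using W(2) s i by blast
    have u: "uniq_diff (?I \<inter> W)" by (rule uniq_diff_interval[OF t W(1)])
    have sx: "smooth_on (?I \<inter> W) (\<lambda>s. phi i (proj V (\<gamma> s)))" using smooth_on_fst[OF u W(3)] by (simp add: z_def)
    note d = smooth_on_has_vector_derivative[OF _ W(1) sW s]
    have "vector_derivative (\<lambda>s. fst (cc i s)) (at s within ?I) =
        vector_derivative (\<lambda>s. (phi i (proj V (\<gamma> s)), r i s)) (at s within ?I)"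
      by (rule vector_derivative_cong_window[OF W(1) sW s]) (use cc[OF _ i(1)] W(2) in auto)
    also have "\<dots> = (rhoc i (z i s), vector_derivative (r i) (at s within ?I))"
      using vector_derivative_Pair_within[OF t s d[OF sx] d[OF W(4)]] el(1)[OF s i] by simp
    finally have 1: "vector_derivative (\<lambda>s. fst (cc i s)) (at s within ?I) = \<dots>" .
    have "vector_derivative (\<lambda>s. TA.mom (dT_fun (total_space V) L) i (cc i s)) (at s within ?I) =
        vector_derivative (\<lambda>s. (q i s, m i s)) (at s within ?I)"
    proof (rule vector_derivative_cong_window[OF W(1) sW s])
      fix s' assume "s' \<in> ?I \<inter> W"
      then have s': "s' \<in> ?I" "proj V (\<gamma> s') \<in> dom i" using W(2) by auto
      show "TA.mom (dT_fun (total_space V) L) i (cc i s') = (q i s', m i s')"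
        using lift_mom[OF smL i(1) bp(3)[OF s'(1) i(1) s'(2)]] unfolding bp[OF s'(1) i(1) s'(2)] q_def m_def .
    qed
    also have "\<dots> = (vector_derivative (q i) (at s within ?I), force L i (z i s))"
      using vector_derivative_Pair_within[OF t s d[OF W(6)] d[OF W(5)]] el(2)[OF s i] by simp
    finally have 2: "vector_derivative (\<lambda>s. TA.mom (dT_fun (total_space V) L) i (cc i s)) (at s within ?I) = \<dots>" .
    show "vector_derivative (\<lambda>s. fst (cc i s)) (at s within ?I) = TA.rhoc i (cc i s) \<and>
      vector_derivative (\<lambda>s. TA.mom (dT_fun (total_space V) L) i (cc i s)) (at s within ?I) =
        TA.force (dT_fun (total_space V) L) i (cc i s) \<longleftrightarrow> E s i"
      unfolding 1 2 lift_force[OF smL i(1) bp(3)[OF s i]] lift_rhoc[OF i(1) bp(3)[OF s i]] bp(1,2)[OF s i] E_def by auto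
    have "vector_derivative (\<lambda>s. ((phi i (proj V (\<gamma> s)), m i s), (r i s, q i s))) (at s within ?I) =
      ((rhoc i (z i s), force L i (z i s)), (vector_derivative (r i) (at s within ?I), vector_derivative (q i) (at s within ?I)))"
      using vector_derivative_Pair_within[OF t s has_vector_derivative_Pair[OF d[OF sx] d[OF W(5)]]
          has_vector_derivative_Pair[OF d[OF W(4)] d[OF W(6)]]] el[OF s i] by simp
    then show "vector_derivative (\<lambda>s. ((phi i (proj V (\<gamma> s)), m i s), (r i s, q i s))) (at s within ?I) =
      ((rhoc i (z i s), force L i (z i s)), (FD (rhoc i) (z i s) (v i s),
        FD (force L i) (z i s) (v i s))) \<longleftrightarrow> E s i" unfolding E_def by auto
  qed

  have EL': "EL_solution TV A' (dT_fun (total_space V) L) t0 t1 ?var \<longleftrightarrow>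
      (\<forall>s\<in>?I. \<forall>i\<in>ind. proj V (\<gamma> s) \<in> dom i \<longrightarrow> E s i)"
  proof -
    have "EL_solution TV A' (dT_fun (total_space V) L) t0 t1 ?var \<longleftrightarrow>
      (\<forall>s\<in>?I. \<forall>i\<in>TA.ind. proj TV (?var s) \<in> TA.dom i \<longrightarrow>
        vector_derivative (\<lambda>s. fst (cc i s)) (at s within ?I) = TA.rhoc i (cc i s) \<and>
        vector_derivative (\<lambda>s. TA.mom (dT_fun (total_space V) L) i (cc i s)) (at s within ?I) =
          TA.force (dT_fun (total_space V) L) i (cc i s))"
      unfolding cc_def fst_conv by (rule TA.EL_solution_coord[OF lift_smooth[OF smL] t sc])
    also have "\<dots> \<longleftrightarrow> (\<forall>s\<in>?I. \<forall>i\<in>ind. proj V (\<gamma> s) \<in> dom i \<longrightarrow> E s i)"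
    proof (intro ball_cong refl imp_cong)
      show "TA.ind = ind" by simp
      show "(proj TV (?var s) \<in> TA.dom i) = (proj V (\<gamma> s) \<in> dom i)" if "s \<in> ?I" for s i by (rule pr[OF that])
    qed (rule lift_eq)
    finally show ?thesis .
  qed

  interpret N: vbun "dual_bundle V" by unfold_locales (rule vector_bundle_dual)
  let ?lam = "lambda V A L" and ?Lam = "Lambda V A L"
  let ?c = "\<lambda>s. tangent_map (total_space V) ?N ?lam (?var s)"
  let ?w = "\<lambda>s. tangent_map (total_space V) (tangent ?N) ?Lam (?var s)"
  have lam: "?lam (\<gamma> s) \<in> tot (dual_bundle V)" "fst (?lam (\<gamma> s)) = proj V (\<gamma> s)" if s: "s \<in> ?I" for s
    using lambda_coord(1,2)[OF smL tot(1)[OF s]] B.chart_at_mem[OF proj_pts[OF tot(1)[OF s]]] by auto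
  have lam_chart: "chart ?N i (?lam (chart_inv (total_space V) i \<zeta>)) = (fst \<zeta>, mom L i \<zeta>)"
    "chart (tangent ?N) i (?Lam (chart_inv (total_space V) i \<zeta>)) = ((fst \<zeta>, mom L i \<zeta>), (rhoc i \<zeta>, force L i \<zeta>))"
    "?lam (chart_inv (total_space V) i \<zeta>) \<in> chart_dom ?N i"
    if i: "i \<in> ind" and \<zeta>: "\<zeta> \<in> Z i" for i \<zeta>
  proof -
    obtain x y where xy: "\<zeta> = (x, y)" "x \<in> B.img i" using \<zeta> by auto
    note p = B.chart_inv_mem[OF xy(2)]
    let ?e = "from_triv V i (psi i x) y"
    have e: "?e \<in> tot V" "proj V ?e = psi i x" "triv V i ?e = y" using i p by simp_all
    have d: "proj V ?e \<in> dom i" using e p by simp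
    have eq: "chart_inv (total_space V) i \<zeta> = ?e" unfolding xy by (rule total_chart_inv[OF i xy(2)])
    have z: "(phi i (proj V ?e), triv V i ?e) = \<zeta>" using e xy B.chart_chart_inv by simp
    show "chart ?N i (?lam (chart_inv (total_space V) i \<zeta>)) = (fst \<zeta>, mom L i \<zeta>)"
      using lambda_coord[OF smL e(1) i d] unfolding eq z by (simp flip: z)
    then show "chart (tangent ?N) i (?Lam (chart_inv (total_space V) i \<zeta>)) = ((fst \<zeta>, mom L i \<zeta>), (rhoc i \<zeta>, force L i \<zeta>))"
      using Lambda_coord[OF smL e(1) i d] fst_Lambda[OF smL, of ?e] unfolding eq z
      by (simp add: rhoc_def xy e)
    show "?lam (chart_inv (total_space V) i \<zeta>) \<in> chart_dom ?N i"
      using lambda_coord(1,2)[OF smL e(1) i d] d unfolding eq by simp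
  qed
  have Dlam: "((\<lambda>\<zeta>. chart ?N i (?lam (chart_inv (total_space V) i \<zeta>))) has_derivative
      (\<lambda>w. (fst w, FD (mom L i) (z i s) w))) (at (z i s))"
    if "i \<in> ind" "proj V (\<gamma> s) \<in> dom i" for i s
    by (rule has_derivative_transform_within_open[OF has_derivative_Pair[OF has_derivative_fst[OF has_derivative_ident]
          mom_has_derivative[OF smL that(1) zZ[OF that]]] open_Z[OF that(1)] zZ[OF that]])
      (rule lam_chart(1)[OF that(1), symmetric])
  have DLam: "((\<lambda>\<zeta>. chart (tangent ?N) i (?Lam (chart_inv (total_space V) i \<zeta>))) has_derivative
      (\<lambda>w. ((fst w, FD (mom L i) (z i s) w),
        (FD (rhoc i) (z i s) w, FD (force L i) (z i s) w)))) (at (z i s))"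
    if "i \<in> ind" "proj V (\<gamma> s) \<in> dom i" for i s
    by (rule has_derivative_transform_within_open[OF has_derivative_Pair[OF has_derivative_Pair[OF has_derivative_fst[OF has_derivative_ident]
          mom_has_derivative[OF smL that(1) zZ[OF that]]]
          has_derivative_Pair[OF smooth_on_has_derivative_at[OF open_Z[OF that(1)] rhoc_smooth[OF that(1)] zZ[OF that]]
           force_has_derivative[OF smL that(1) zZ[OF that]]]] open_Z[OF that(1)] zZ[OF that]])
      (rule lam_chart(2)[OF that(1), symmetric])
  have cz: "chart (total_space V) i (fst (?var s)) = z i s" for i s by (simp add: z_def fv)
  have chart_zZ: "chart_inv (total_space V) i (z i s) = \<gamma> s" if "s \<in> ?I" "i \<in> ind" "proj V (\<gamma> s) \<in> dom i" for i s
    using T.chart_inv_chart[of i "\<gamma> s"] that tot(1)[OF that(1)] by (simp add: z_def)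
  \<comment> \<open>Chart domains of \<open>tangent ?N\<close> contain only families obeying the
    transition law, and \<open>velocity\<close> is 0 by default outside them; without this fact its
    components could not be read off.\<close>
  have c_tan: "?c s \<in> tot (tangent_bundle ?N)" if s: "s \<in> ?I" for s
  proof -
    have p: "proj V (\<gamma> s) \<in> pts (base V)" by (rule proj_pts[OF tot(1)[OF s]])
    define i where "i = chart_at (base V) (proj V (\<gamma> s))"
    have i: "i \<in> ind" "proj V (\<gamma> s) \<in> dom i" using B.chart_at_mem[OF p] by (auto simp: i_def)
    have dk: "k \<in> ind \<and> proj V (\<gamma> s) \<in> dom k" if "k \<in> idx ?N" "?lam (fst (?var s)) \<in> chart_dom ?N k" for k
      using that lam[OF s] by (simp add: fv)
    show ?thesis
    proof (rule T.tangent_map_tangent[OF N.T.atlas_axioms tan[OF s]])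
      show "i \<in> idx (total_space V)" "fst (?var s) \<in> chart_dom (total_space V) i"
        using i tot(1)[OF s] by (simp_all add: fv)
      show "?lam (fst (?var s)) \<in> pts ?N" using lam[OF s] by (simp add: fv)
      fix k assume "k \<in> idx ?N" "?lam (fst (?var s)) \<in> chart_dom ?N k"
      from dk[OF this] have k: "k \<in> ind" "proj V (\<gamma> s) \<in> dom k" by auto
      let ?Q = "chart (total_space V) i ` (chart_dom (total_space V) i \<inter> chart_dom (total_space V) k)"
      show "\<exists>Q. open Q \<and> chart (total_space V) i (fst (?var s)) \<in> Q \<and>
          (\<forall>x\<in>Q. ?lam (chart_inv (total_space V) i x) \<in> chart_dom ?N k)"
      proof (intro exI conjI ballI)
        show "open ?Q" using T.open_overlap[of i k] i k by simp
        show "chart (total_space V) i (fst (?var s)) \<in> ?Q" using i k tot(1)[OF s] by (auto simp: fv)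
        fix x assume "x \<in> ?Q"
        then obtain e where e: "e \<in> tot V" "proj V e \<in> dom i" "proj V e \<in> dom k" "x = chart (total_space V) i e" by auto
        then have "chart_inv (total_space V) i x = e" using T.chart_inv_chart[of i e] i by simp
        then show "?lam (chart_inv (total_space V) i x) \<in> chart_dom ?N k"
          using lambda_coord(1,2)[OF smL e(1) k(1) e(3)] e(3) by simp
      qed
      have "((\<lambda>x. chart ?N k (?lam (chart_inv (total_space V) k x))) has_derivative
          (\<lambda>w. (fst w, FD (mom L k) (z k s) w))) (at (chart (total_space V) k (\<gamma> s)))"
        using Dlam[OF k] by (simp add: z_def)
      from T.has_derivative_change_chart[OF _ _ _ _ this, of i]
      show "((\<lambda>x. chart ?N k (?lam (chart_inv (total_space V) i x))) has_derivative
          (\<lambda>u. (\<lambda>w. (fst w, FD (mom L k) (z k s) w))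
            (FD (\<lambda>x. chart (total_space V) k (chart_inv (total_space V) i x)) (chart (total_space V) i (\<gamma> s)) u)))
          (at (chart (total_space V) i (fst (?var s))))"
        using i k tot(1)[OF s] by (simp add: fv)
    qed
  qed
  have c_coord: "snd (?c s) i = (r i s, q i s)" if "s \<in> ?I" "i \<in> ind" "proj V (\<gamma> s) \<in> dom i" for s i
  proof -
    have "snd (?c s) i = (\<lambda>w. (fst w, FD (mom L i) (z i s) w)) (snd (?var s) i)"
    proof (rule T.tangent_map_eq[OF tan[OF that(1)]])
      show "((\<lambda>\<zeta>. chart ?N i (?lam (chart_inv (total_space V) i \<zeta>))) has_derivative
        (\<lambda>w. (fst w, FD (mom L i) (z i s) w))) (at (chart (total_space V) i (fst (?var s))))"
        unfolding cz by (rule Dlam[OF that(2,3)])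
    qed (use that tot(1)[OF that(1)] lam[OF that(1)] in \<open>simp_all add: fv\<close>)
    then show ?thesis by (simp add: r_def q_def v_def)
  qed
  \<comment> \<open>\<open>eps\<close> is defined chart by chart. Along a solution its value is the
    velocity of the curve \<open>?lam (\<gamma> s)\<close>, which supplies the transition law and
    places the foot point of \<open>?w s\<close> in the chart domains of
    \<open>tangent ?N\<close>.\<close>
  have Lam_tan: "?Lam (\<gamma> s) \<in> tot (tangent_bundle ?N)" if s: "s \<in> ?I" for s
  proof -
    have "?Lam (\<gamma> s) = velocity ?N t0 t1 (\<lambda>s. ?lam (\<gamma> s)) s"
      using EL s by (simp add: EL_solution_def)
    also have "\<dots> \<in> tot (tangent_bundle ?N)"
    proof (rule N.T.velocity_tangent[OF t s])
      show "?lam (\<gamma> s) \<in> pts ?N" using lam[OF s] by simp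
      fix i assume "i \<in> idx ?N" "?lam (\<gamma> s) \<in> chart_dom ?N i"
      then have i: "i \<in> ind" "proj V (\<gamma> s) \<in> dom i" using lam[OF s] by simp_all
      obtain W where W: "open W" "\<And>s. s \<in> ?I \<Longrightarrow> s \<in> W \<longleftrightarrow> proj V (\<gamma> s) \<in> dom i"
        "smooth_on (?I \<inter> W) (z i)" "smooth_on (?I \<inter> W) (m i)" using window[OF i(1)] by blast
      have sW: "s \<in> W" using W(2) s i by blast
      have u: "uniq_diff (?I \<inter> W)" by (rule uniq_diff_interval[OF t W(1)])
      show "\<exists>W. open W \<and> s \<in> W \<and> (\<forall>s\<in>?I \<inter> W. ?lam (\<gamma> s) \<in> chart_dom ?N i)"
        using W(1,2) sW lam by (intro exI[of _ W]) auto
      have "smooth_on (?I \<inter> W) (\<lambda>s. (fst (z i s), m i s))"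
        by (intro smooth_on_Pair smooth_on_fst W u)
      then have "smooth_on (?I \<inter> W) (\<lambda>s. chart ?N i (?lam (\<gamma> s)))"
        by (rule smooth_on_cong[THEN iffD1, rotated])
          (use W(2) lambda_coord(2,3)[OF smL tot(1) i(1)] in \<open>auto simp: z_def m_def\<close>)
      from smooth_on_has_vector_derivative[OF this W(1) sW s]
      show "((\<lambda>s. chart ?N i (?lam (\<gamma> s))) has_vector_derivative
        vector_derivative (\<lambda>s. chart ?N i (?lam (\<gamma> s))) (at s within ?I)) (at s within ?I)" .
    qed
    finally show ?thesis .
  qed
  have w_coord: "snd (?w s) i = ((r i s, q i s),
      (FD (rhoc i) (z i s) (v i s), FD (force L i) (z i s) (v i s)))"
    if "s \<in> ?I" "i \<in> ind" "proj V (\<gamma> s) \<in> dom i" for s i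
  proof -
    have "snd (?w s) i = (\<lambda>w. ((fst w, FD (mom L i) (z i s) w),
        (FD (rhoc i) (z i s) w, FD (force L i) (z i s) w))) (snd (?var s) i)"
    proof (rule T.tangent_map_eq[OF tan[OF that(1)]])
      show "((\<lambda>\<zeta>. chart (tangent ?N) i (?Lam (chart_inv (total_space V) i \<zeta>))) has_derivative
        (\<lambda>w. ((fst w, FD (mom L i) (z i s) w),
          (FD (rhoc i) (z i s) w, FD (force L i) (z i s) w))))
        (at (chart (total_space V) i (fst (?var s))))"
        unfolding cz by (rule DLam[OF that(2,3)])
    qed (use that tot(1)[OF that(1)] lam[OF that(1)] Lam_tan[OF that(1)] fst_Lambda[OF smL, of "\<gamma> s"] in \<open>simp_all add: fv\<close>)
    then show ?thesis by (simp add: r_def q_def v_def)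
  qed
  have out: "snd (?c s) i = 0" "snd (?w s) i = 0" "snd (?Lam (\<gamma> s)) i = 0"
    if "s \<in> ?I" "\<not> (i \<in> ind \<and> proj V (\<gamma> s) \<in> dom i)" for s i
  proof -
    show "snd (?c s) i = 0" "snd (?w s) i = 0"
      using that lam[OF that(1)] fst_Lambda[OF smL, of "\<gamma> s"]
      by (auto simp: tangent_map_def case_prod_unfold Let_def fv)
    show "snd (?Lam (\<gamma> s)) i = 0" by (rule Lambda_outside[OF smL tot(1)[OF that(1)] that(2)])
  qed
  have jac: "velocity (tangent ?N) t0 t1 ?c s = flip (?w s) \<longleftrightarrow> (\<forall>i\<in>ind. proj V (\<gamma> s) \<in> dom i \<longrightarrow> E s i)"
    if s: "s \<in> ?I" for s
  proof -
    have fl: "fst (flip (?w s)) = (?lam (\<gamma> s), \<lambda>i. fst (snd (?w s) i))"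
      "snd (flip (?w s)) = (\<lambda>i. (snd (?Lam (\<gamma> s)) i, snd (snd (?w s) i)))"
      by (simp_all add: flip_def case_prod_unfold fst_Lambda[OF smL] fv)
    \<comment> \<open>\<open>lambda V A L\<close> is the foot point of \<open>Lambda V A L\<close>,
      so the flipped vector is attached to \<open>?c s\<close> itself; only the velocity components
      remain to be compared.\<close>
    have "snd (?c s) i = fst (snd (?w s) i)" for i
      using c_coord[OF s, of i] w_coord[OF s, of i] out[OF s, of i]
      by (cases "i \<in> ind \<and> proj V (\<gamma> s) \<in> dom i") auto
    then have "?c s = fst (flip (?w s))" unfolding fl by (simp add: prod_eq_iff[of "?c s"] fun_eq_iff fv)
    then have "velocity (tangent ?N) t0 t1 ?c s = flip (?w s) \<longleftrightarrow>
        (\<forall>i. snd (velocity (tangent ?N) t0 t1 ?c s) i = snd (flip (?w s)) i)"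
      by (subst prod_eq_iff) (simp add: velocity_def fun_eq_iff)
    also have "\<dots> \<longleftrightarrow> (\<forall>i. i \<in> ind \<and> proj V (\<gamma> s) \<in> dom i \<longrightarrow> E s i)"
    proof (rule all_cong1)
      fix i
      show "snd (velocity (tangent ?N) t0 t1 ?c s) i = snd (flip (?w s)) i \<longleftrightarrow> (i \<in> ind \<and> proj V (\<gamma> s) \<in> dom i \<longrightarrow> E s i)"
      proof (cases "i \<in> ind \<and> proj V (\<gamma> s) \<in> dom i")
        case True
        then have i: "i \<in> ind" "proj V (\<gamma> s) \<in> dom i" by auto
        obtain W where W: "open W" "\<And>s. s \<in> ?I \<Longrightarrow> s \<in> W \<longleftrightarrow> proj V (\<gamma> s) \<in> dom i"
          using window[OF i(1)] by blast
        have sW: "s \<in> W" using W(2) s i by blast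
        have "snd (velocity (tangent ?N) t0 t1 ?c s) i = vector_derivative (\<lambda>s. chart (tangent ?N) i (?c s)) (at s within ?I)"
          using i c_tan[OF s] lam[OF s] by (simp add: velocity_def fv)
        also have "\<dots> = vector_derivative (\<lambda>s. ((phi i (proj V (\<gamma> s)), m i s), (r i s, q i s))) (at s within ?I)"
        proof (rule vector_derivative_cong_window[OF W(1) sW s])
          fix s' assume "s' \<in> ?I \<inter> W"
          then have s': "s' \<in> ?I" "proj V (\<gamma> s') \<in> dom i" using W(2) by auto
          show "chart (tangent ?N) i (?c s') = ((phi i (proj V (\<gamma> s')), m i s'), (r i s', q i s'))"
            using lambda_coord(2,3)[OF smL tot(1)[OF s'(1)] i(1) s'(2)] c_coord[OF s'(1) i(1) s'(2)]
            by (simp add: fv m_def z_def)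
        qed
        finally have lhs: "snd (velocity (tangent ?N) t0 t1 ?c s) i = \<dots>" .
        have "snd (flip (?w s)) i = ((rhoc i (z i s), force L i (z i s)), (FD (rhoc i) (z i s) (v i s),
          FD (force L i) (z i s) (v i s)))"
          unfolding fl using w_coord[OF s i] Lambda_coord[OF smL tot(1)[OF s] i] i
          by (simp add: rhoc_def z_def B.chart_inv_chart)
        then show ?thesis unfolding lhs using jac_eq[OF s i] i by simp
      next
        case False
        then have "snd (velocity (tangent ?N) t0 t1 ?c s) i = 0"
          using lam[OF s] by (auto simp: velocity_def fv)
        moreover have "snd (flip (?w s)) i = 0"
          unfolding fl using out(2,3)[OF s False] by (simp add: zero_prod_def)
        ultimately show ?thesis using False by auto
      qed
    qed
    finally show ?thesis by blast
  qed
  show ?thesis unfolding jacobi_field_def EL' using over jac by blast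
qed

theorem theorem1p2:
  fixes V :: "('i, 'a, 'm::finite_dim_inner, 'e, 'k::finite_dim_inner) vbundle"
    and A :: "('i, 'a, 'm, 'e) algebroid"
    and A' :: "('i, ('i, 'a, 'm) tvec, 'm \<times> 'm, ('i, 'e, 'm \<times> 'k) tvec) algebroid"
    and L :: "'e \<Rightarrow> real"
    and \<gamma> \<eta> :: "real \<Rightarrow> 'e"
    and t0 t1 :: real
  assumes "skew_algebroid V A"
    and "is_tangent_lift V A A'"
    and "smooth_fun (total_space V) L"
    and "t0 < t1"
    and "admissible V A t0 t1 \<gamma>"
    and "EL_solution V A L t0 t1 \<gamma>"
    and "curve_over V t0 t1 \<gamma> \<eta>"
  shows "jacobi_field V A L t0 t1 \<gamma> \<eta> \<longleftrightarrow>
         EL_solution (tangent_lift_bundle V) A' (dT_fun (total_space V) L) t0 t1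
           (variation V A t0 t1 \<gamma> \<eta>)"
proof -
  interpret lift V A A' using assms(1,2) by unfold_locales
  show ?thesis by (rule jacobi_iff_EL_lift[OF assms(3-7)])
qed

end
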